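(* Consider the multiparticle system controlled by a single control (force) applied to either the first or the last particle, i.e. $\dot x=f(x)+g(x)u$, $u\in\mathbb{R}$, on $\mathbb{R}^{2n}$ with $g=\frac{\partial}{\partial p_1}$ or $g=\frac{\partial}{\partial p_n}$. Then for any $T>0$ the system possesses the time-$T$ accessibility property (from every point), and for every $\tilde x\in\mathbb{R}^{2n}$ and every $T>0$ the set $\mathcal{A}^T_{\tilde x}$ of positions and momenta attainable from $\tilde x$ in time $T$ has an interior (in $\mathbb{R}^{2n}$) which is dense in $\mathcal{A}^T_{\tilde x}$.
   Context: Let $n\ge 2$. $\Phi:\mathbb{R}\to\mathbb{R}$ is a real analytic, bounded below function with $\lim_{y\to+\infty}\Phi(y)=+\infty$, and $\phi=\Phi'$. The state is $x=(q,p)=(q_1,\dots,q_n,p_1,\dots,p_n)\in\mathbb{R}^{2n}$. The drift is the vector field $$f=\sum_{k=1}^{n}p_k\frac{\partial}{\partial q_k}-\phi(q_1-q_2)\frac{\partial}{\partial p_1}+\sum_{k=2}^{n-1}\bigl(\phi(q_{k-1}-q_k)-\phi(q_k-q_{k+1})\bigr)\frac{\partial}{\partial p_k}+\phi(q_{n-1}-q_n)\frac{\partial}{\partial p_n}.$$ For a constant $c\in\mathbb{R}$ let $f^{c}=f+cg$, with flow $e^{tf^{c}}$. The time-$T$ attainable set $\mathcal{A}^T_{\tilde x}$ is the set of all points $e^{t_1f^{c_1}}\circ\cdots\circ e^{t_Nf^{c_N}}(\tilde x)$ with $N\ge1$, $c_j\in\mathbb{R}$, $t_j\ge 0$, $t_1+\cdots+t_N=T$.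 The system possesses the time-$T$ accessibility property from $\tilde x$ if $\mathcal{A}^T_{\tilde x}$ has nonempty interior in $\mathbb{R}^{2n}$. *)

theory Defs
  imports "HOL-Analysis.Analysis"
begin

definition real_analytic :: "(real \<Rightarrow> real) \<Rightarrow> bool" where
  "real_analytic F \<longleftrightarrow>
     (\<forall>y0. \<exists>r>0. \<exists>a :: nat \<Rightarrow> real.
        \<forall>y. \<bar>y - y0\<bar> < r \<longrightarrow> (\<lambda>k. a k * (y - y0) ^ k) sums F y)"

text \<open>
  The phase space of dimension \<open>2n\<close> is \<open>(real ^ 'n) \<times> (real ^ 'n)\<close> with \<open>n = CARD('n)\<close>, a state
  being \<open>x = (q, p)\<close>. A finite index type has no preferred order, so the numbering of the
  particles \<open>1, \<dots>, n\<close> is a parameter \<open>e\<close>, meant to be a bijection from \<open>{1..n}\<close> onto \<open>'n\<close>.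
\<close>

type_synonym 'n phase = "(real ^ 'n) \<times> (real ^ 'n)"

definition pos :: "(nat \<Rightarrow> 'n::finite) \<Rightarrow> 'n phase \<Rightarrow> nat \<Rightarrow> real" where
  "pos e x k = fst x $ e k"

definition mom :: "(nat \<Rightarrow> 'n::finite) \<Rightarrow> 'n phase \<Rightarrow> nat \<Rightarrow> real" where
  "mom e x k = snd x $ e k"

text \<open>The constant coordinate vector fields along \<open>q\<^sub>k\<close> and \<open>p\<^sub>k\<close>.\<close>

definition d_pos :: "(nat \<Rightarrow> 'n::finite) \<Rightarrow> nat \<Rightarrow> 'n phase" where
  "d_pos e k = (axis (e k) 1, 0)"

definition d_mom :: "(nat \<Rightarrow> 'n::finite) \<Rightarrow> nat \<Rightarrow> 'n phase" where
  "d_mom e k = (0, axis (e k) 1)"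

definition drift :: "(nat \<Rightarrow> 'n::finite) \<Rightarrow> (real \<Rightarrow> real) \<Rightarrow> 'n phase \<Rightarrow> 'n phase" where
  "drift e \<phi> x =
     (let n = CARD('n); q = pos e x; p = mom e x in
        (\<Sum>k=1..n. p k *\<^sub>R d_pos e k)
        - \<phi> (q 1 - q 2) *\<^sub>R d_mom e 1
        + (\<Sum>k=2..n-1. (\<phi> (q (k-1) - q k) - \<phi> (q k - q (k+1))) *\<^sub>R d_mom e k)
        + \<phi> (q (n-1) - q n) *\<^sub>R d_mom e n)"

text \<open>
  The graph of the time-\<open>t\<close> flow map (\<open>t \<ge> 0\<close>) of a vector field \<open>X\<close>. A relation is used because
  the flow of a general vector field is only a partial map; for locally Lipschitz \<open>X\<close> the relation
  is single-valued.
\<close>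

definition flow :: "('a::real_normed_vector \<Rightarrow> 'a) \<Rightarrow> real \<Rightarrow> ('a \<times> 'a) set" where
  "flow X t = {(x, y). \<exists>\<gamma>. \<gamma> 0 = x \<and> \<gamma> t = y \<and>
     (\<forall>s\<in>{0..t}. (\<gamma> has_vector_derivative X (\<gamma> s)) (at s within {0..t}))}"

definition ctrl_field :: "('a::real_vector \<Rightarrow> 'a) \<Rightarrow> ('a \<Rightarrow> 'a) \<Rightarrow> real \<Rightarrow> 'a \<Rightarrow> 'a" where
  "ctrl_field f g c x = f x + c *\<^sub>R g x"

text \<open>
  The composition of flows for \<open>[(t\<^sub>1, c\<^sub>1), \<dots>, (t\<^sub>N, c\<^sub>N)]\<close>; the last entry of the list acts first
  (note that \<open>R O S\<close> applies \<open>R\<close> before \<open>S\<close>).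
\<close>

fun flow_comp ::
  "('a::real_normed_vector \<Rightarrow> 'a) \<Rightarrow> ('a \<Rightarrow> 'a) \<Rightarrow> (real \<times> real) list \<Rightarrow> ('a \<times> 'a) set" where
  "flow_comp f g [] = Id"
| "flow_comp f g ((t, c) # tcs) = flow_comp f g tcs O flow (ctrl_field f g c) t"

definition attainable ::
  "('a::real_normed_vector \<Rightarrow> 'a) \<Rightarrow> ('a \<Rightarrow> 'a) \<Rightarrow> real \<Rightarrow> 'a \<Rightarrow> 'a set" where
  "attainable f g T x =
     {y. \<exists>tcs. tcs \<noteq> [] \<and> (\<forall>(t, c)\<in>set tcs. 0 \<le> t) \<and> sum_list (map fst tcs) = T \<and>
         (x, y) \<in> flow_comp f g tcs}"

definition accessible_from ::
  "('a::real_normed_vector \<Rightarrow> 'a) \<Rightarrow> ('a \<Rightarrow> 'a) \<Rightarrow> real \<Rightarrow> 'a \<Rightarrow> bool" where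
  "accessible_from f g T x \<longleftrightarrow> interior (attainable f g T x) \<noteq> {}"

end

theory Submission
  imports Defs "HOL-Complex_Analysis.Cauchy_Integral_Formula"
begin

text \<open>
  It suffices to reach an open set close to the end point of any trajectory \<open>x\<close> with constant
  control; accessibility then follows, since conservation of energy makes the drift complete. By the
  open mapping theorem it is enough that the linearisation along a nearby trajectory is controllable.
  Its adjoint is \<open>\<eta>'' = - H \<eta>\<close> with \<open>H\<close> the Hessian of the potential, and a covector annihilating
  the reachable directions has \<open>\<eta>\<^sub>1 = 0\<close>; if all \<open>\<phi>' (q\<^sub>k - q\<^sub>k\<^sub>+\<^sub>1)\<close> are nonzero on some time interval,
  the equations give \<open>\<eta>\<^sub>2 = 0\<close>, \<open>\<eta>\<^sub>3 = 0\<close>, \<open>\<dots>\<close> in turn. Such an interval is obtained by perturbing the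
  control, bond by bond: zeros of \<open>\<phi>'\<close> are isolated by analyticity, so if bond \<open>j\<close> stayed
  degenerate under two different controls its length would be constant, hence the particles beyond
  it, then those before it, and finally the control itself would agree for both.
\<close>

section \<open>Ordinary differential equations\<close>

text \<open>The obstacle is a bond along which \<phi>' vanishes: to first order it transmits
  nothing. An affine \<Phi> would make every bond like that; it is excluded because no affine
  function both tends to infinity at +infinity and is bounded below. As \<phi> is only locally
  Lipschitz, motions could blow up and perturbation estimates would lack uniform constants. These
  arguments are therefore carried out for a truncated, globally Lipschitz force and transferred back
  on a bounded region where both forces agree. Controls are represented by their primitives
  \<open>w\<close>, because closeness of \<open>w\<close> in the sup norm already gives closeness of
  the motions. Only the last piece of positive duration of an attaining control is perturbed, which
  yields density at every attainable point. Control of the last particle reduces to control of the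
  first by reversing the numbering and replacing \<open>\<Phi> y\<close> by
  \<open>\<Phi> (- y)\<close>.\<close>

lemma gronwall_scalar:
  fixes d :: "real \<Rightarrow> real"
  assumes cont: "continuous_on {a..b} d" and "0 \<le> L" "0 \<le> A"
    and ineq: "\<And>t. t \<in> {a..b} \<Longrightarrow> d t \<le> A + L * integral {a..t} d"
    and t: "t \<in> {a..b}"
  shows "d t \<le> 2 * A * exp (2 * L * (t - a))"
proof -
  \<comment> \<open>The weight uses twice the rate: at a positive maximum \<open>h m\<close> the
    integral term is at most half of the left-hand side and can be absorbed. This is the origin of
    the factors 2.\<close>
  define h where "h t = exp (- (2 * L * (t - a))) * d t" for t
  have "continuous_on {a..b} h"
    unfolding h_def by (intro continuous_intros cont)
  then obtain m where m: "m \<in> {a..b}" "\<And>t. t \<in> {a..b} \<Longrightarrow> h t \<le> h m"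
    using continuous_attains_sup[of "{a..b}" h] t by auto
  have d_le: "d t \<le> h m * exp (2 * L * (t - a))" if "t \<in> {a..b}" for t
  proof -
    have "d t = h t * exp (2 * L * (t - a))"
      by (simp add: h_def exp_minus)
    also have "\<dots> \<le> h m * exp (2 * L * (t - a))"
      by (intro mult_right_mono m that) simp
    finally show ?thesis .
  qed
  have FTC: "((\<lambda>t. L * exp (2 * L * (t - a))) has_integral
      exp (2 * L * (m - a)) / 2 - exp (2 * L * (a - a)) / 2) {a..m}"
    using m(1) by (intro fundamental_theorem_of_calculus)
      (auto intro!: derivative_eq_intros simp flip: has_real_derivative_iff_has_vector_derivative)
  have "L * integral {a..m} d = integral {a..m} (\<lambda>t. L * d t)"
    by simp
  also have "\<dots> \<le> integral {a..m} (\<lambda>t. h m * (L * exp (2 * L * (t - a))))"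
  proof (rule integral_le)
    show "(\<lambda>t. L * d t) integrable_on {a..m}"
      using m(1) by (intro integrable_continuous_real continuous_intros continuous_on_subset[OF cont]) auto
    show "(\<lambda>t. h m * (L * exp (2 * L * (t - a)))) integrable_on {a..m}"
      using FTC by (auto intro: integrable_on_mult_right)
    fix t assume "t \<in> {a..m}"
    with m(1) have "t \<in> {a..b}" by auto
    from mult_left_mono[OF d_le[OF this] \<open>0 \<le> L\<close>]
    show "L * d t \<le> h m * (L * exp (2 * L * (t - a)))" by (simp add: algebra_simps)
  qed
  also have "\<dots> = h m * (exp (2 * L * (m - a)) / 2 - 1 / 2)"
    using integral_unique[OF FTC] by simp
  finally have *: "d m \<le> A + h m * (exp (2 * L * (m - a)) / 2 - 1 / 2)"
    using ineq[OF m(1)] by simp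
  have "d m = h m * exp (2 * L * (m - a))"
    by (simp add: h_def exp_minus)
  with * have **: "h m * (exp (2 * L * (m - a)) + 1) \<le> 2 * A"
    by (simp add: algebra_simps)
  have "h m \<le> 2 * A"
  proof (cases "h m \<le> 0")
    case False
    then have "h m * 1 \<le> h m * (exp (2 * L * (m - a)) + 1)"
      by (intro mult_left_mono) auto
    with ** show ?thesis by simp
  qed (use \<open>0 \<le> A\<close> in simp)
  then have "h m * exp (2 * L * (t - a)) \<le> 2 * A * exp (2 * L * (t - a))"
    by (intro mult_right_mono) auto
  with d_le[OF t] show ?thesis by linarith
qed

text \<open>The differential inequality is integrated first; the forcing \<open>A\<close> is charged
  over all of \<open>{a..b}\<close>, which gives the constant that the scalar version
  expects.\<close>

lemma gronwall:
  fixes y :: "real \<Rightarrow> 'a::euclidean_space"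
  assumes deriv: "\<And>t. t \<in> {a..b} \<Longrightarrow> (y has_vector_derivative y' t) (at t within {a..b})"
    and bound: "\<And>t. t \<in> {a..b} \<Longrightarrow> norm (y' t) \<le> L * norm (y t) + A"
    and "0 \<le> L" "0 \<le> A" and t: "t \<in> {a..b}"
  shows "norm (y t) \<le> 2 * (norm (y a) + A * (b - a)) * exp (2 * L * (t - a))"
proof (rule gronwall_scalar)
  show cont: "continuous_on {a..b} (\<lambda>t. norm (y t))"
    using deriv by (intro continuous_intros continuous_on_vector_derivative) auto
  show "0 \<le> norm (y a) + A * (b - a)"
    using t \<open>0 \<le> A\<close> by auto
  fix t assume t: "t \<in> {a..b}"
  then have sub: "{a..t} \<subseteq> {a..b}" by auto
  have I: "(y' has_integral (y t - y a)) {a..t}"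
    using t by (intro fundamental_theorem_of_calculus has_vector_derivative_within_subset[OF deriv]) auto
  have c: "continuous_on {a..t} (\<lambda>t. norm (y t))"
    by (rule continuous_on_subset[OF cont sub])
  have "norm (integral {a..t} y') \<le> integral {a..t} (\<lambda>t. L * norm (y t) + A)"
  proof (rule integral_norm_bound_integral)
    show "y' integrable_on {a..t}" using I by blast
    show "(\<lambda>t. L * norm (y t) + A) integrable_on {a..t}"
      by (intro integrable_continuous_real continuous_intros c)
  qed (use sub bound in auto)
  also have "\<dots> = L * integral {a..t} (\<lambda>t. norm (y t)) + A * (t - a)"
    using t by (subst integral_add)
      (auto intro!: integrable_continuous_real continuous_intros c)
  also have "\<dots> \<le> L * integral {a..t} (\<lambda>t. norm (y t)) + A * (b - a)"
    using t \<open>0 \<le> A\<close> by (intro add_left_mono mult_left_mono) auto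
  also have "integral {a..t} y' = y t - y a"
    using I by (rule integral_unique)
  finally show "norm (y t) \<le> norm (y a) + A * (b - a) + L * integral {a..t} (\<lambda>t. norm (y t))"
    using norm_triangle_ineq2[of "y t" "y a"] by linarith
qed (use assms in auto)

text \<open>The weight \<open>exp (2 L (t - a))\<close> turns the Picard operator into a contraction on all of
  \<open>{a..b}\<close>, so no subdivision of the interval is needed.\<close>

lemma picard_lindeloef:
  fixes X :: "real \<Rightarrow> 'a::euclidean_space \<Rightarrow> 'a"
  assumes cont: "continuous_on ({a..b} \<times> UNIV) (\<lambda>(t, x). X t x)"
    and lip: "\<And>t x y. t \<in> {a..b} \<Longrightarrow> norm (X t x - X t y) \<le> L * norm (x - y)"
    and "0 \<le> L" "a \<le> b"
  obtains z where "z a = x0"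
    "\<And>t. t \<in> {a..b} \<Longrightarrow> (z has_vector_derivative X t (z t)) (at t within {a..b})"
proof -
  \<comment> \<open>Freezing time outside \<open>{a..b}\<close> lets the fixed point live in the
    complete type of bounded continuous functions on the whole line, so that
    \<open>banach_fix_type\<close> applies.\<close>
  define clip where "clip t = max a (min b t)" for t
  define E where "E t = exp (2 * L * (t - a))" for t
  have clip: "clip t \<in> {a..b}" for t
    using \<open>a \<le> b\<close> by (auto simp: clip_def)
  have clip_id: "clip t = t" if "t \<in> {a..b}" for t
    using that by (auto simp: clip_def)
  have Xcont: "continuous_on {a..b} (\<lambda>t. X t (z t))" if "continuous_on {a..b} z" for z
  proof -
    have "continuous_on {a..b} (\<lambda>t. case (t, z t) of (t, x) \<Rightarrow> X t x)"
      by (rule continuous_on_compose2[OF cont]) (auto intro!: continuous_intros that)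
    then show ?thesis by simp
  qed
  \<comment> \<open>\<open>P\<close> acts on the unknown \<open>y = z / E\<close>, so that the
    weighted norm of \<open>z\<close> is the plain sup norm of \<open>y\<close>.\<close>
  define P where "P y t = (1 / E t) *\<^sub>R (x0 + integral {a..t} (\<lambda>s. X s (E s *\<^sub>R y s)))" for y t
  have Econt: "continuous_on S E" for S
    unfolding E_def by (intro continuous_intros)
  have E_pos: "0 < E t" for t
    by (simp add: E_def)
  have integrand_cont: "continuous_on {a..b} (\<lambda>s. X s (E s *\<^sub>R apply_bcontfun y s))" for y
    by (intro Xcont continuous_intros Econt) auto
  have Pcont: "continuous_on {a..b} (P (apply_bcontfun y))" for y
  proof -
    have "continuous_on {a..b} (\<lambda>t. integral {a..t} (\<lambda>s. X s (E s *\<^sub>R apply_bcontfun y s)))"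
      by (intro indefinite_integral_continuous_1 integrable_continuous_real integrand_cont)
    then show ?thesis
      unfolding P_def using E_pos by (intro continuous_intros Econt) (auto simp: less_imp_neq[symmetric])
  qed
  have Pb: "(\<lambda>t. P (apply_bcontfun y) (clip t)) \<in> bcontfun" for y
  proof -
    have "continuous_on UNIV (\<lambda>t. P (apply_bcontfun y) (clip t))"
      by (rule continuous_on_compose2[OF Pcont]) (use clip in \<open>auto simp: clip_def intro!: continuous_intros\<close>)
    moreover have "bounded (range (\<lambda>t. P (apply_bcontfun y) (clip t)))"
      by (rule bounded_subset[OF compact_imp_bounded[OF compact_continuous_image[OF Pcont[of y]]]])
        (use clip in auto)
    ultimately show ?thesis by (simp add: bcontfun_def)
  qed
  define Q :: "(real \<Rightarrow>\<^sub>C 'a) \<Rightarrow> (real \<Rightarrow>\<^sub>C 'a)"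
    where "Q y = Bcontfun (\<lambda>t. P (apply_bcontfun y) (clip t))" for y
  have Q: "apply_bcontfun (Q y) t = P (apply_bcontfun y) (clip t)" for y t
    unfolding Q_def by (simp add: Bcontfun_inverse[OF Pb])
  have "\<exists>!y. Q y = y"
  proof (rule banach_fix_type[where c = "1/2"])
    show "\<forall>y1 y2. dist (Q y1) (Q y2) \<le> 1 / 2 * dist y1 y2"
    proof (intro allI dist_bound)
      fix y1 y2 :: "real \<Rightarrow>\<^sub>C 'a" and t'
      define t where "t = clip t'"
      have t: "t \<in> {a..b}" using clip by (simp only: t_def)
      have sub: "{a..t} \<subseteq> {a..b}" using t by auto
      \<comment> \<open>\<open>E\<close> grows at rate \<open>2 * L\<close>, twice the Lipschitz
        constant; hence the contraction factor 1/2.\<close>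
      have FTC: "((\<lambda>s. L * E s) has_integral E t / 2 - E a / 2) {a..t}"
        unfolding E_def using t by (intro fundamental_theorem_of_calculus)
          (auto intro!: derivative_eq_intros simp flip: has_real_derivative_iff_has_vector_derivative)
      have int: "(\<lambda>s. X s (E s *\<^sub>R apply_bcontfun y s)) integrable_on {a..t}" for y
        by (intro integrable_continuous_real continuous_on_subset[OF integrand_cont sub])
      have "norm (integral {a..t} (\<lambda>s. X s (E s *\<^sub>R y1 s) - X s (E s *\<^sub>R y2 s)))
          \<le> integral {a..t} (\<lambda>s. dist y1 y2 * (L * E s))"
      proof (rule integral_norm_bound_integral)
        show "(\<lambda>s. X s (E s *\<^sub>R y1 s) - X s (E s *\<^sub>R y2 s)) integrable_on {a..t}"
          by (intro integrable_diff int[of y1] int[of y2])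
        show "(\<lambda>s. dist y1 y2 * (L * E s)) integrable_on {a..t}"
          using FTC by (auto intro: integrable_on_mult_right)
        fix s assume "s \<in> {a..t}"
        then have "norm (X s (E s *\<^sub>R y1 s) - X s (E s *\<^sub>R y2 s)) \<le> L * norm (E s *\<^sub>R y1 s - E s *\<^sub>R y2 s)"
          using sub by (intro lip) auto
        also have "\<dots> = L * E s * dist (y1 s) (y2 s)"
          using E_pos[of s] by (simp add: dist_norm flip: scaleR_diff_right)
        also have "\<dots> \<le> L * E s * dist y1 y2"
          using E_pos[of s] \<open>0 \<le> L\<close> by (intro mult_left_mono dist_bounded) auto
        finally show "norm (X s (E s *\<^sub>R y1 s) - X s (E s *\<^sub>R y2 s)) \<le> dist y1 y2 * (L * E s)"
          by (simp add: algebra_simps)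
      qed
      also have "\<dots> = dist y1 y2 * (E t / 2 - E a / 2)"
        using integral_unique[OF FTC] by simp
      also have "\<dots> \<le> dist y1 y2 * (E t / 2)"
        using E_pos[of a] by (intro mult_left_mono) auto
      finally have *: "norm (integral {a..t} (\<lambda>s. X s (E s *\<^sub>R y1 s)) - integral {a..t} (\<lambda>s. X s (E s *\<^sub>R y2 s)))
          \<le> dist y1 y2 * (E t / 2)"
        by (simp add: integral_diff[OF int int])
      have "dist (Q y1 t') (Q y2 t') = norm (integral {a..t} (\<lambda>s. X s (E s *\<^sub>R y1 s)) - integral {a..t} (\<lambda>s. X s (E s *\<^sub>R y2 s))) / E t"
        using E_pos[of t]
        by (simp add: Q P_def t_def[symmetric] dist_norm divide_inverse_commute flip: scaleR_diff_right)
      also have "\<dots> \<le> dist y1 y2 * (E t / 2) / E t"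
        using E_pos[of t] * by (intro divide_right_mono) auto
      also have "\<dots> = 1 / 2 * dist y1 y2"
        using E_pos[of t] by simp
      finally show "dist (Q y1 t') (Q y2 t') \<le> 1 / 2 * dist y1 y2" .
    qed
  qed auto
  then obtain y where y: "Q y = y" by blast
  define z where "z t = E t *\<^sub>R y t" for t
  have z: "z t = x0 + integral {a..t} (\<lambda>s. X s (z s))" if "t \<in> {a..b}" for t
  proof -
    have "y t = P y t"
      using Q[of y t] y clip_id[OF that] by simp
    then show ?thesis
      using E_pos[of t] by (simp add: P_def z_def)
  qed
  show ?thesis
  proof (rule that[of z])
    show "z a = x0" using z[of a] \<open>a \<le> b\<close> by simp
    fix t assume t: "t \<in> {a..b}"
    have "continuous_on {a..b} (\<lambda>s. X s (z s))"
      unfolding z_def by (rule integrand_cont)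
    from integral_has_vector_derivative[OF this t]
    have "((\<lambda>t. x0 + integral {a..t} (\<lambda>s. X s (z s))) has_vector_derivative X t (z t)) (at t within {a..b})"
      by (auto intro!: derivative_eq_intros)
    then show "(z has_vector_derivative X t (z t)) (at t within {a..b})"
      using has_vector_derivative_transform[OF t, of z] z by simp
  qed
qed

text \<open>Time reversal. The adjoint equation is solved from a prescribed final value.\<close>

lemma picard_lindeloef_backward:
  fixes X :: "real \<Rightarrow> 'a::euclidean_space \<Rightarrow> 'a"
  assumes cont: "continuous_on ({a..b} \<times> UNIV) (\<lambda>(t, x). X t x)"
    and lip: "\<And>t x y. t \<in> {a..b} \<Longrightarrow> norm (X t x - X t y) \<le> L * norm (x - y)"
    and "0 \<le> L" "a \<le> b"
  obtains z where "z b = x0"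
    "\<And>t. t \<in> {a..b} \<Longrightarrow> (z has_vector_derivative X t (z t)) (at t within {a..b})"
proof -
  have "continuous_on ({a..b} \<times> UNIV) (\<lambda>p. - (case (a + b - fst p, snd p) of (t, x) \<Rightarrow> X t x))"
    by (rule continuous_on_minus, rule continuous_on_compose2[OF cont]) (auto intro!: continuous_intros)
  then have "continuous_on ({a..b} \<times> UNIV) (\<lambda>(t, x). - X (a + b - t) x)"
    by (simp add: case_prod_unfold)
  moreover have "norm (- X (a + b - t) x - - X (a + b - t) y) \<le> L * norm (x - y)"
    if "t \<in> {a..b}" for t x y
    using lip[of "a + b - t" x y] that by (simp add: norm_minus_commute)
  ultimately obtain z where z: "z a = x0"
    "\<And>t. t \<in> {a..b} \<Longrightarrow> (z has_vector_derivative - X (a + b - t) (z t)) (at t within {a..b})"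
    using picard_lindeloef[of a b "\<lambda>t x. - X (a + b - t) x" L x0] assms by blast
  show ?thesis
  proof (rule that[of "\<lambda>t. z (a + b - t)"])
    fix t assume t: "t \<in> {a..b}"
    have "((\<lambda>t. a + b - t) has_vector_derivative -1) (at t within {a..b})"
      by (auto intro!: derivative_eq_intros)
    moreover have "(z has_vector_derivative - X t (z (a + b - t))) (at (a + b - t) within (\<lambda>t. a + b - t) ` {a..b})"
      by (rule has_vector_derivative_within_subset[OF z(2)[of "a + b - t", simplified]]) (use t in auto)
    ultimately have "(z \<circ> (\<lambda>t. a + b - t) has_vector_derivative (-1) *\<^sub>R - X t (z (a + b - t))) (at t within {a..b})"
      by (rule vector_diff_chain_within)
    then show "((\<lambda>t. z (a + b - t)) has_vector_derivative X t (z (a + b - t))) (at t within {a..b})"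
      by (simp add: o_def)
  qed (use z in simp)
qed

section \<open>Piecewise constant controls\<close>

text \<open>Primitives of piecewise constant controls; \<open>D\<close> contains the switching
  times. Asking for affinity on every interval without a switching time inside lets the sets
  \<open>D\<close> of a sum simply unite, with no list of pieces to carry along.\<close>

definition piecewise_affine :: "(real \<Rightarrow> real) \<Rightarrow> bool" where
  "piecewise_affine w \<longleftrightarrow> continuous_on UNIV w \<and>
     (\<exists>D. finite D \<and> (\<forall>\<alpha> \<beta>. \<alpha> < \<beta> \<longrightarrow> D \<inter> {\<alpha><..<\<beta>} = {} \<longrightarrow>
        (\<exists>c. \<forall>t\<in>{\<alpha>..\<beta>}. w t = w \<alpha> + c * (t - \<alpha>))))"

lemma piecewise_affine_continuous: "piecewise_affine w \<Longrightarrow> continuous_on S w"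
  by (auto simp: piecewise_affine_def intro: continuous_on_subset)

lemma piecewise_affine_add:
  assumes "piecewise_affine v" "piecewise_affine w"
  shows "piecewise_affine (\<lambda>t. v t + w t)"
proof -
  obtain D where D: "finite D"
    "\<And>\<alpha> \<beta>. \<alpha> < \<beta> \<Longrightarrow> D \<inter> {\<alpha><..<\<beta>} = {} \<Longrightarrow> \<exists>c. \<forall>t\<in>{\<alpha>..\<beta>}. v t = v \<alpha> + c * (t - \<alpha>)"
    using assms(1) by (auto simp: piecewise_affine_def)
  obtain E where E: "finite E"
    "\<And>\<alpha> \<beta>. \<alpha> < \<beta> \<Longrightarrow> E \<inter> {\<alpha><..<\<beta>} = {} \<Longrightarrow> \<exists>c. \<forall>t\<in>{\<alpha>..\<beta>}. w t = w \<alpha> + c * (t - \<alpha>)"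
    using assms(2) by (auto simp: piecewise_affine_def)
  have "\<exists>c. \<forall>t\<in>{\<alpha>..\<beta>}. v t + w t = v \<alpha> + w \<alpha> + c * (t - \<alpha>)"
    if *: "\<alpha> < \<beta>" "(D \<union> E) \<inter> {\<alpha><..<\<beta>} = {}" for \<alpha> \<beta>
  proof -
    obtain c where c: "\<And>t. t \<in> {\<alpha>..\<beta>} \<Longrightarrow> v t = v \<alpha> + c * (t - \<alpha>)"
      using D(2)[OF *(1)] *(2) by blast
    obtain d where d: "\<And>t. t \<in> {\<alpha>..\<beta>} \<Longrightarrow> w t = w \<alpha> + d * (t - \<alpha>)"
      using E(2)[OF *(1)] *(2) by blast
    have "v t + w t = v \<alpha> + w \<alpha> + (c + d) * (t - \<alpha>)" if "t \<in> {\<alpha>..\<beta>}" for t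
      using c[OF that] d[OF that] by (simp add: algebra_simps)
    then show ?thesis by blast
  qed
  moreover have "finite (D \<union> E)" using D(1) E(1) by simp
  moreover have "continuous_on UNIV (\<lambda>t. v t + w t)"
    using assms by (auto simp: piecewise_affine_def intro!: continuous_intros)
  ultimately show ?thesis
    unfolding piecewise_affine_def by blast
qed

lemma piecewise_affine_scale:
  assumes "piecewise_affine w"
  shows "piecewise_affine (\<lambda>t. c * w t)"
proof -
  obtain D where D: "finite D"
    "\<And>\<alpha> \<beta>. \<alpha> < \<beta> \<Longrightarrow> D \<inter> {\<alpha><..<\<beta>} = {} \<Longrightarrow> \<exists>c. \<forall>t\<in>{\<alpha>..\<beta>}. w t = w \<alpha> + c * (t - \<alpha>)"
    using assms by (auto simp: piecewise_affine_def)
  have "\<exists>d. \<forall>t\<in>{\<alpha>..\<beta>}. c * w t = c * w \<alpha> + d * (t - \<alpha>)"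
    if *: "\<alpha> < \<beta>" "D \<inter> {\<alpha><..<\<beta>} = {}" for \<alpha> \<beta>
  proof -
    obtain d where d: "\<And>t. t \<in> {\<alpha>..\<beta>} \<Longrightarrow> w t = w \<alpha> + d * (t - \<alpha>)"
      using D(2)[OF *] by blast
    have "c * w t = c * w \<alpha> + (c * d) * (t - \<alpha>)" if "t \<in> {\<alpha>..\<beta>}" for t
      by (subst d[OF that]) (simp add: algebra_simps)
    then show ?thesis by blast
  qed
  moreover have "continuous_on UNIV (\<lambda>t. c * w t)"
    using assms by (auto simp: piecewise_affine_def intro!: continuous_intros)
  ultimately show ?thesis
    using D(1) unfolding piecewise_affine_def by blast
qed

text \<open>Primitive of the unit control switched on at time \<open>d\<close>. Such ramps serve
  both as perturbations of a control and as test directions for the linearised end point.\<close>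

lemma piecewise_affine_ramp: "piecewise_affine (\<lambda>t. max 0 (t - d))"
proof -
  have "\<exists>c. \<forall>t\<in>{\<alpha>..\<beta>}. max 0 (t - d) = max 0 (\<alpha> - d) + c * (t - \<alpha>)"
    if "\<alpha> < \<beta>" "{d} \<inter> {\<alpha><..<\<beta>} = {}" for \<alpha> \<beta> :: real
  proof (cases "d \<le> \<alpha>")
    case True
    then show ?thesis by (intro exI[of _ 1]) auto
  next
    case False
    with that show ?thesis by (intro exI[of _ 0]) auto
  qed
  then show ?thesis
    unfolding piecewise_affine_def by (auto intro!: continuous_intros exI[of _ "{d}"])
qed

lemma piecewise_affine_linear: "piecewise_affine (\<lambda>t. c * t)"
proof -
  have "\<exists>k. \<forall>t\<in>{\<alpha>..\<beta>}. c * t = c * \<alpha> + k * (t - \<alpha>)" for \<alpha> \<beta> :: real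
    by (intro exI[of _ c]) (simp add: algebra_simps)
  then show ?thesis
    unfolding piecewise_affine_def by (auto intro!: continuous_intros exI[of _ "{}"])
qed

lemma piecewise_affine_sum:
  "(\<And>i. i \<in> I \<Longrightarrow> piecewise_affine (w i)) \<Longrightarrow> piecewise_affine (\<lambda>t. \<Sum>i\<in>I. w i t)"
proof (induction I rule: infinite_finite_induct)
  case (insert x F)
  then show ?case by (auto intro!: piecewise_affine_add)
qed (use piecewise_affine_linear[of 0] in simp_all)

section \<open>Concatenating and splitting attaining controls\<close>

lemma flow_comp_append: "flow_comp f g (xs @ ys) = flow_comp f g ys O flow_comp f g xs"
proof (induction xs)
  case (Cons tc xs)
  then show ?case by (cases tc) (simp add: O_assoc)
qed simp

lemma attainable_trans:
  assumes "y \<in> attainable f g \<sigma> x" "z \<in> attainable f g \<tau> y"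
  shows "z \<in> attainable f g (\<sigma> + \<tau>) x"
proof -
  obtain us where us: "us \<noteq> []" "\<forall>(t, c)\<in>set us. 0 \<le> t" "sum_list (map fst us) = \<sigma>" "(x, y) \<in> flow_comp f g us"
    using assms(1) unfolding attainable_def by blast
  obtain vs where vs: "vs \<noteq> []" "\<forall>(t, c)\<in>set vs. 0 \<le> t" "sum_list (map fst vs) = \<tau>" "(y, z) \<in> flow_comp f g vs"
    using assms(2) unfolding attainable_def by blast
  have "(x, z) \<in> flow_comp f g (vs @ us)"
    using us(4) vs(4) by (auto simp: flow_comp_append)
  then show ?thesis
    unfolding attainable_def using us vs by (auto intro!: exI[of _ "vs @ us"])
qed

lemma attainable_flow:
  "0 \<le> t \<Longrightarrow> (x, y) \<in> flow (ctrl_field f g c) t \<Longrightarrow> y \<in> attainable f g t x"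
  unfolding attainable_def by (auto intro!: exI[of _ "[(t, c)]"])

text \<open>Perturbing the control on the last piece of positive duration keeps everything before
  it, so openness found there carries over to the full attainable set. The head of the list acts
  last, so the induction discards trivial pieces from the head.\<close>

lemma attainable_last_piece:
  assumes "y \<in> attainable f g T x" "0 < T"
  obtains t c z where "0 < t" "(z, y) \<in> flow (ctrl_field f g c) t"
    "attainable f g t z \<subseteq> attainable f g T x"
proof -
  obtain tcs where "\<forall>(t, c)\<in>set tcs. 0 \<le> t" "sum_list (map fst tcs) = T" "(x, y) \<in> flow_comp f g tcs"
    using assms(1) unfolding attainable_def by blast
  then have "\<exists>t c z. 0 < t \<and> (z, y) \<in> flow (ctrl_field f g c) t \<and> attainable f g t z \<subseteq> attainable f g T x"
  proof (induction tcs)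
    case Nil
    with \<open>0 < T\<close> show ?case by simp
  next
    case (Cons tc tcs)
    obtain t c where tc: "tc = (t, c)" by force
    obtain z where z: "(x, z) \<in> flow_comp f g tcs" "(z, y) \<in> flow (ctrl_field f g c) t"
      using Cons.prems by (auto simp: tc)
    show ?case
    proof (cases "t = 0")
      case True
      then have "z = y" using z(2) by (auto simp: flow_def)
      with Cons z True show ?thesis by (auto simp: tc)
    next
      case False
      then have "0 < t" using Cons.prems by (auto simp: tc)
      moreover have "attainable f g t z \<subseteq> attainable f g T x"
      \<comment> \<open>\<open>attainable\<close> demands a nonempty list, so the case without
        earlier pieces is separate; there \<open>z = x\<close> and \<open>t = T\<close>.\<close>
      proof (cases "tcs = []")
        case True
        then show ?thesis using Cons.prems z(1) by (simp add: tc)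
      next
        case False
        then have "z \<in> attainable f g (T - t) x"
          unfolding attainable_def using z(1) Cons.prems by (auto simp: tc intro!: exI[of _ tcs])
        then show ?thesis
          using attainable_trans[of z f g "T - t" x _ t] by auto
      qed
      ultimately show ?thesis using z(2) by blast
    qed
  qed
  then show ?thesis using that by blast
qed

text \<open>Along a solution of \<open>q' = p\<close>, \<open>p' = F q + u a\<close>, the shifted state \<open>(q, p - w a)\<close>, where \<open>w\<close>
  is a primitive of \<open>u\<close>, solves an equation whose right hand side depends continuously on time even
  if \<open>u\<close> jumps. Controlled paths are these shifted trajectories.\<close>

definition controlled_path ::
  "('v::euclidean_space \<Rightarrow> 'v) \<Rightarrow> 'v \<Rightarrow> (real \<Rightarrow> real) \<Rightarrow> real \<Rightarrow> (real \<Rightarrow> 'v \<times> 'v) \<Rightarrow> bool" where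
  "controlled_path F a w s z \<longleftrightarrow> (\<forall>t\<in>{0..s}.
     (z has_vector_derivative (snd (z t) + w t *\<^sub>R a, F (fst (z t)))) (at t within {0..s}))"

lemma has_vector_derivative_line:
  "((\<lambda>t. (0, (k + c * t) *\<^sub>R a)) has_vector_derivative (0, c *\<^sub>R a)) (at t within S)"
proof -
  have "((\<lambda>t. k + c * t) has_real_derivative c) (at t within S)"
    by (auto intro!: derivative_eq_intros)
  from has_vector_derivative_scaleR[OF this has_vector_derivative_const[of a]]
  have "((\<lambda>t. (k + c * t) *\<^sub>R a) has_vector_derivative c *\<^sub>R a) (at t within S)"
    by simp
  then show ?thesis
    by (intro has_vector_derivative_Pair has_vector_derivative_const)
qed

text \<open>Strong induction on the number of breakpoints strictly between \<alpha> and \<beta>,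
  splitting at one of them. Without breakpoints the slope of \<open>w\<close> is the constant
  control, and \<open>w t *\<^sub>R a\<close> is added back to the momentum.\<close>

lemma controlled_path_attainable:
  fixes F :: "'v::euclidean_space \<Rightarrow> 'v"
  assumes z: "controlled_path F a w s z" and w: "piecewise_affine w"
    and "0 \<le> \<alpha>" "\<alpha> < \<beta>" "\<beta> \<le> s"
  shows "z \<beta> + (0, w \<beta> *\<^sub>R a) \<in>
    attainable (\<lambda>x. (snd x, F (fst x))) (\<lambda>x. (0, a)) (\<beta> - \<alpha>) (z \<alpha> + (0, w \<alpha> *\<^sub>R a))"
proof -
  obtain D where D: "finite D"
    "\<And>\<alpha> \<beta>. \<alpha> < \<beta> \<Longrightarrow> D \<inter> {\<alpha><..<\<beta>} = {} \<Longrightarrow> \<exists>c. \<forall>t\<in>{\<alpha>..\<beta>}. w t = w \<alpha> + c * (t - \<alpha>)"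
    using w by (auto simp: piecewise_affine_def)
  show ?thesis
    using assms(3-5)
  proof (induction "card (D \<inter> {\<alpha><..<\<beta>})" arbitrary: \<alpha> \<beta> rule: less_induct)
    case less
    show ?case
    proof (cases "D \<inter> {\<alpha><..<\<beta>} = {}")
      case False
      then obtain d where d: "d \<in> D" "\<alpha> < d" "d < \<beta>" by auto
      have "D \<inter> {\<alpha><..<d} \<subset> D \<inter> {\<alpha><..<\<beta>}" "D \<inter> {d<..<\<beta>} \<subset> D \<inter> {\<alpha><..<\<beta>}"
        using d by auto
      then have "card (D \<inter> {\<alpha><..<d}) < card (D \<inter> {\<alpha><..<\<beta>})"
        "card (D \<inter> {d<..<\<beta>}) < card (D \<inter> {\<alpha><..<\<beta>})"
        using D(1) by (simp_all add: psubset_card_mono)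
      from attainable_trans[OF less.hyps[OF this(1)] less.hyps[OF this(2)]]
      show ?thesis
        using d less.prems by simp
    next
      case True
      then obtain c where c: "\<And>t. t \<in> {\<alpha>..\<beta>} \<Longrightarrow> w t = w \<alpha> + c * (t - \<alpha>)"
        using D(2)[OF less.prems(2) True] by blast
      define \<gamma> where "\<gamma> t = z (\<alpha> + t) + (0, (w \<alpha> + c * t) *\<^sub>R a)" for t
      let ?X = "ctrl_field (\<lambda>x. (snd x, F (fst x))) (\<lambda>x. (0, a)) c"
      have "(\<gamma> has_vector_derivative ?X (\<gamma> t)) (at t within {0..\<beta> - \<alpha>})" if t: "t \<in> {0..\<beta> - \<alpha>}" for t
      proof -
        have "(z has_vector_derivative (snd (z (\<alpha> + t)) + w (\<alpha> + t) *\<^sub>R a, F (fst (z (\<alpha> + t)))))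
            (at (\<alpha> + t) within (\<lambda>t. \<alpha> + t) ` {0..\<beta> - \<alpha>})"
          by (rule has_vector_derivative_within_subset[of z _ "\<alpha> + t" "{0..s}"])
            (use z t less.prems in \<open>auto simp: controlled_path_def\<close>)
        moreover have "((\<lambda>t. \<alpha> + t) has_vector_derivative 1) (at t within {0..\<beta> - \<alpha>})"
          by (auto intro!: derivative_eq_intros)
        ultimately have "(z \<circ> (\<lambda>t. \<alpha> + t) has_vector_derivative
            1 *\<^sub>R (snd (z (\<alpha> + t)) + w (\<alpha> + t) *\<^sub>R a, F (fst (z (\<alpha> + t))))) (at t within {0..\<beta> - \<alpha>})"
          by (intro vector_diff_chain_within)
        moreover have "((\<lambda>t. (0, (w \<alpha> + c * t) *\<^sub>R a)) has_vector_derivative (0, c *\<^sub>R a)) (at t within {0..\<beta> - \<alpha>})"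
          by (rule has_vector_derivative_line)
        ultimately have deriv: "((\<lambda>t. (z \<circ> (\<lambda>t. \<alpha> + t)) t + (0, (w \<alpha> + c * t) *\<^sub>R a)) has_vector_derivative
            1 *\<^sub>R (snd (z (\<alpha> + t)) + w (\<alpha> + t) *\<^sub>R a, F (fst (z (\<alpha> + t)))) + (0, c *\<^sub>R a)) (at t within {0..\<beta> - \<alpha>})"
          by (rule has_vector_derivative_add)
        have "w (\<alpha> + t) = w \<alpha> + c * t"
          using c[of "\<alpha> + t"] t by simp
        with deriv show ?thesis
          by (simp add: \<gamma>_def[abs_def] o_def ctrl_field_def)
      qed
      moreover have "\<gamma> 0 = z \<alpha> + (0, w \<alpha> *\<^sub>R a)" "\<gamma> (\<beta> - \<alpha>) = z \<beta> + (0, w \<beta> *\<^sub>R a)"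
        using c[of \<beta>] less.prems by (simp_all add: \<gamma>_def)
      ultimately have "(z \<alpha> + (0, w \<alpha> *\<^sub>R a), z \<beta> + (0, w \<beta> *\<^sub>R a)) \<in> flow ?X (\<beta> - \<alpha>)"
        unfolding flow_def mem_Collect_eq prod.case by (intro exI[of _ \<gamma>]) simp
      then show ?thesis
        using less.prems by (intro attainable_flow) auto
    qed
  qed
qed

text \<open>The primitive \<open>c * t\<close> vanishes at time 0, so the shift leaves the initial
  state alone and has to be undone only at the end point.\<close>

lemma flow_controlled_path:
  fixes F :: "'v::euclidean_space \<Rightarrow> 'v"
  assumes "(x, y) \<in> flow (ctrl_field (\<lambda>x. (snd x, F (fst x))) (\<lambda>x. (0, a)) c) s"
  obtains z where "controlled_path F a (\<lambda>t. c * t) s z" "z 0 = x" "z s + (0, (c * s) *\<^sub>R a) = y"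
proof -
  obtain \<gamma> where \<gamma>: "\<gamma> 0 = x" "\<gamma> s = y"
    "\<And>t. t \<in> {0..s} \<Longrightarrow> (\<gamma> has_vector_derivative (snd (\<gamma> t), F (fst (\<gamma> t)) + c *\<^sub>R a)) (at t within {0..s})"
    using assms by (auto simp: flow_def ctrl_field_def)
  have "((\<lambda>t. \<gamma> t - (0, (c * t) *\<^sub>R a)) has_vector_derivative
      (snd (\<gamma> t), F (fst (\<gamma> t)) + c *\<^sub>R a) - (0, c *\<^sub>R a)) (at t within {0..s})" if "t \<in> {0..s}" for t
    using has_vector_derivative_line[of 0 c a] by (intro has_vector_derivative_diff \<gamma> that) simp
  then have "controlled_path F a (\<lambda>t. c * t) s (\<lambda>t. \<gamma> t - (0, (c * t) *\<^sub>R a))"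
    by (simp add: controlled_path_def)
  then show ?thesis
    using \<gamma> by (intro that[of "\<lambda>t. \<gamma> t - (0, (c * t) *\<^sub>R a)"]) (auto simp: zero_prod_def[symmetric])
qed

lemma controlled_path_continuous:
  "controlled_path F a w s z \<Longrightarrow> continuous_on {0..s} z"
  unfolding controlled_path_def by (auto intro!: continuous_on_vector_derivative)

lemma controlled_path_subset:
  "controlled_path F a w s z \<Longrightarrow> r \<le> s \<Longrightarrow> controlled_path F a w r z"
  unfolding controlled_path_def
  by (intro ballI has_vector_derivative_within_subset[of z _ _ "{0..s}" "{0..r}"]) auto

lemma controlled_path_cong:
  "controlled_path F a w s z \<Longrightarrow> (\<And>t. t \<in> {0..s} \<Longrightarrow> G (fst (z t)) = F (fst (z t))) \<Longrightarrow> controlled_path G a w s z"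
  unfolding controlled_path_def by simp

lemma norm_fst_bound: "norm (fst p) \<le> norm p"
  by (cases p) (simp add: norm_fst_le)

lemma norm_snd_bound: "norm (snd p) \<le> norm p"
  by (cases p) (simp add: norm_snd_le)

lemma controlled_path_exists:
  fixes F :: "'v::euclidean_space \<Rightarrow> 'v"
  assumes lip: "\<And>x y. norm (F x - F y) \<le> L * norm (x - y)" and "0 \<le> L" "0 \<le> s"
    and w: "continuous_on {0..s} w"
  obtains z where "controlled_path F a w s z" "z 0 = x0"
proof -
  have "continuous_on UNIV F"
  proof (rule Lipschitz.lipschitz_on_continuous_on)
    show "L-lipschitz_on UNIV F"
      using assms by (intro lipschitz_onI) (auto simp: dist_norm)
  qed
  then have F: "continuous_on S F" for S
    by (rule continuous_on_subset) auto
  have "continuous_on ({0..s} \<times> UNIV) (\<lambda>p. (snd (snd p) + w (fst p) *\<^sub>R a, F (fst (snd p))))"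
    by (intro continuous_intros continuous_on_compose2[OF F[of UNIV]] continuous_on_compose2[OF w]) auto
  then have "continuous_on ({0..s} \<times> UNIV) (\<lambda>(t, x). (snd x + w t *\<^sub>R a, F (fst x)))"
    by (simp add: case_prod_unfold)
  moreover have "norm ((snd x + w t *\<^sub>R a, F (fst x)) - (snd y + w t *\<^sub>R a, F (fst y))) \<le> (L + 1) * norm (x - y)"
    for t and x y :: "'v \<times> 'v"
  proof -
    have "norm ((snd x + w t *\<^sub>R a, F (fst x)) - (snd y + w t *\<^sub>R a, F (fst y)))
        \<le> norm (snd (x - y)) + norm (F (fst x) - F (fst y))"
      using norm_Pair_le[of "snd (x - y)" "F (fst x) - F (fst y)"] by simp
    also have "\<dots> \<le> norm (x - y) + L * norm (x - y)"
      using lip[of "fst x" "fst y"] mult_left_mono[OF norm_fst_bound[of "x - y"] \<open>0 \<le> L\<close>]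
      by (intro add_mono norm_snd_bound) simp
    finally show ?thesis by (simp add: algebra_simps)
  qed
  ultimately have "\<exists>z. z 0 = x0 \<and> controlled_path F a w s z"
    by (rule picard_lindeloef[where ?x0.0 = x0]) (use assms in \<open>auto simp: controlled_path_def\<close>)
  then show ?thesis
    using that by blast
qed

text \<open>In shifted coordinates the difference of two paths solves a Lipschitz equation with
  forcing \<open>(w t - w' t) *\<^sub>R a\<close>, so only the distance of the primitives enters,
  not that of the controls.\<close>

lemma controlled_path_lipschitz:
  fixes F :: "'v::euclidean_space \<Rightarrow> 'v"
  assumes lip: "\<And>x y. norm (F x - F y) \<le> L * norm (x - y)" and "0 \<le> L"
    and z: "controlled_path F a w s z" "controlled_path F a w' s z'" "z 0 = z' 0"
    and \<delta>: "\<And>t. t \<in> {0..s} \<Longrightarrow> \<bar>w t - w' t\<bar> \<le> \<delta>" and t: "t \<in> {0..s}"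
  shows "norm (z t - z' t) \<le> 2 * norm a * s * exp (2 * (L + 1) * s) * \<delta>"
proof -
  have "0 \<le> \<delta>" using \<delta>[OF t] by linarith
  let ?d = "\<lambda>t. (snd (z t - z' t) + (w t - w' t) *\<^sub>R a, F (fst (z t)) - F (fst (z' t)))"
  have "norm (z t - z' t) \<le> 2 * (norm (z 0 - z' 0) + (norm a * \<delta>) * (s - 0)) * exp (2 * (L + 1) * (t - 0))"
  proof (rule gronwall[where y' = ?d and b = s])
    fix t assume t: "t \<in> {0..s}"
    have "((\<lambda>t. z t - z' t) has_vector_derivative
      (snd (z t) + w t *\<^sub>R a, F (fst (z t))) - (snd (z' t) + w' t *\<^sub>R a, F (fst (z' t)))) (at t within {0..s})"
      using z t by (intro has_vector_derivative_diff) (auto simp: controlled_path_def)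
    then show "((\<lambda>t. z t - z' t) has_vector_derivative ?d t) (at t within {0..s})"
      by (simp add: algebra_simps)
    have "norm (?d t) \<le> norm (snd (z t - z' t) + (w t - w' t) *\<^sub>R a) + norm (F (fst (z t)) - F (fst (z' t)))"
      by (rule norm_Pair_le)
    also have "\<dots> \<le> (norm (snd (z t - z' t)) + \<bar>w t - w' t\<bar> * norm a) + L * norm (fst (z t - z' t))"
      using lip[of "fst (z t)" "fst (z' t)"] by (intro add_mono order.trans[OF norm_triangle_ineq]) auto
    also have "\<dots> \<le> (norm (z t - z' t) + \<delta> * norm a) + L * norm (z t - z' t)"
      using \<open>0 \<le> L\<close> \<open>0 \<le> \<delta>\<close> by (intro add_mono mult_mono \<delta> t norm_fst_bound norm_snd_bound) auto
    finally show "norm (?d t) \<le> (L + 1) * norm (z t - z' t) + norm a * \<delta>"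
      by (simp add: algebra_simps)
  qed (use t \<open>0 \<le> \<delta>\<close> \<open>0 \<le> L\<close> in auto)
  also have "\<dots> = 2 * norm a * s * \<delta> * exp (2 * (L + 1) * t)"
    using z(3) by simp
  also have "\<dots> \<le> 2 * norm a * s * \<delta> * exp (2 * (L + 1) * s)"
    using t \<open>0 \<le> \<delta>\<close> \<open>0 \<le> L\<close> by (intro mult_left_mono) auto
  finally show ?thesis by (simp add: algebra_simps)
qed

section \<open>Chains of particles\<close>

text \<open>Derivatives within \<open>S\<close> restrict to the subinterval and are unique there,
  end points included. This allows identities between coordinates of motions to be differentiated on
  closed time intervals.\<close>

lemma zero_derivative_on_subinterval:
  assumes "\<And>t. t \<in> {\<alpha>..\<beta>} \<Longrightarrow> f t = 0" "\<alpha> < \<beta>" "{\<alpha>..\<beta>} \<subseteq> S" "t \<in> {\<alpha>..\<beta>}"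
    and "(f has_real_derivative D) (at t within S)"
  shows "D = 0"
proof -
  have "(f has_vector_derivative D) (at t within cbox \<alpha> \<beta>)"
    using has_vector_derivative_within_subset[OF assms(5)[unfolded has_real_derivative_iff_has_vector_derivative] assms(3)]
    by simp
  moreover have "((\<lambda>t. 0) has_vector_derivative 0) (at t within {\<alpha>..\<beta>})"
    by simp
  then have "(f has_vector_derivative 0) (at t within cbox \<alpha> \<beta>)"
    using has_vector_derivative_transform[OF assms(4), of f "\<lambda>t. 0"] assms(1) by simp
  ultimately show ?thesis
    using vector_derivative_unique_within_closed_interval[of \<alpha> \<beta> t f D 0] assms by simp
qed

lemma nonzero_subinterval:
  fixes f :: "real \<Rightarrow> real"
  assumes "continuous_on {\<alpha>..\<beta>} f" "\<alpha> < \<beta>" "t \<in> {\<alpha>..\<beta>}" "f t \<noteq> 0"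
  obtains \<alpha>' \<beta>' where "\<alpha> \<le> \<alpha>'" "\<alpha>' < \<beta>'" "\<beta>' \<le> \<beta>" "\<And>r. r \<in> {\<alpha>'..\<beta>'} \<Longrightarrow> f r \<noteq> 0"
proof -
  have "\<exists>d>0. \<forall>r\<in>{\<alpha>..\<beta>}. dist r t < d \<longrightarrow> dist (f r) (f t) < \<bar>f t\<bar>"
    using assms(1,3,4) by (simp add: continuous_on_iff)
  then obtain d where d: "0 < d" "\<And>r. r \<in> {\<alpha>..\<beta>} \<Longrightarrow> dist r t < d \<Longrightarrow> dist (f r) (f t) < \<bar>f t\<bar>"
    by blast
  have nz: "f r \<noteq> 0" if "r \<in> {\<alpha>..\<beta>}" "dist r t < d" for r
    using d(2)[OF that] by (auto simp: dist_real_def)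
  define \<alpha>' \<beta>' where "\<alpha>' = max \<alpha> (t - d / 2)" and "\<beta>' = min \<beta> (t + d / 2)"
  show ?thesis
  proof (rule that[of \<alpha>' \<beta>'])
    fix r assume "r \<in> {\<alpha>'..\<beta>'}"
    then show "f r \<noteq> 0"
      using d(1) by (intro nz) (auto simp: \<alpha>'_def \<beta>'_def dist_real_def abs_if)
  qed (use assms(2,3) d(1) in \<open>auto simp: \<alpha>'_def \<beta>'_def\<close>)
qed

text \<open>The Lipschitz estimate with \<delta> = 0: the past of the control determines the
  state.\<close>

lemma controlled_path_determined:
  fixes F :: "'v::euclidean_space \<Rightarrow> 'v"
  assumes lip: "\<And>x y. norm (F x - F y) \<le> L * norm (x - y)" "0 \<le> L"
    and "controlled_path F a w s z" "controlled_path F a w' s z'" "z 0 = z' 0"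
    and "\<And>t. t \<in> {0..\<alpha>} \<Longrightarrow> w t = w' t" and "0 \<le> \<alpha>" "\<alpha> \<le> s"
  shows "z \<alpha> = z' \<alpha>"
proof -
  have "norm (z \<alpha> - z' \<alpha>) \<le> 2 * norm a * \<alpha> * exp (2 * (L + 1) * \<alpha>) * 0"
    using assms(5-7)
    by (intro controlled_path_lipschitz[OF lip controlled_path_subset[OF assms(3,8)] controlled_path_subset[OF assms(4,8)]]) auto
  then show ?thesis by simp
qed

text \<open>An orthonormal basis replaces the numbered coordinates, so that the numberings from
  either end of the chain are both instances; the control always acts along
  \<open>\<epsilon> 1\<close>.\<close>

locale chain =
  fixes \<epsilon> :: "nat \<Rightarrow> 'v::euclidean_space" and n :: nat
  assumes two_le: "2 \<le> n"
    and orthonormal: "i \<in> {1..n} \<Longrightarrow> j \<in> {1..n} \<Longrightarrow> \<epsilon> i \<bullet> \<epsilon> j = (if i = j then 1 else 0)"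
    and complete: "(\<And>k. k \<in> {1..n} \<Longrightarrow> \<epsilon> k \<bullet> v = 0) \<Longrightarrow> v = 0"
begin

definition bond :: "nat \<Rightarrow> 'v" where
  "bond k = \<epsilon> k - \<epsilon> (Suc k)"

text \<open>For \<psi> = \<Phi>' this is minus the gradient of the sum of the bond potentials. The
  law \<psi> is a parameter because truncations of \<phi> are used as well.\<close>

definition force :: "(real \<Rightarrow> real) \<Rightarrow> 'v \<Rightarrow> 'v" where
  "force \<psi> q = - (\<Sum>k=1..<n. \<psi> (bond k \<bullet> q) *\<^sub>R bond k)"

lemma norm_unit: "k \<in> {1..n} \<Longrightarrow> norm (\<epsilon> k) = 1"
  using orthonormal[of k k] by (simp add: norm_eq_sqrt_inner)

lemma norm_bond: "k \<in> {1..<n} \<Longrightarrow> norm (bond k) \<le> 2"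
  using norm_triangle_ineq4[of "\<epsilon> k" "\<epsilon> (Suc k)"] norm_unit[of k] norm_unit[of "Suc k"]
  by (auto simp: bond_def)

lemma inner_bond: "bond k \<bullet> v = \<epsilon> k \<bullet> v - \<epsilon> (Suc k) \<bullet> v"
  by (simp add: bond_def inner_diff_left)

lemma abs_inner_bond_le: "k \<in> {1..<n} \<Longrightarrow> \<bar>bond k \<bullet> v\<bar> \<le> 2 * norm v"
  using Cauchy_Schwarz_ineq2[of "bond k" v] mult_right_mono[OF norm_bond, of k "norm v"] by simp

lemma inner_chain:
  assumes "k \<in> {1..n}"
  shows "\<epsilon> k \<bullet> (\<Sum>i=1..<n. c i *\<^sub>R bond i) = (if k < n then c k else 0) - (if 1 < k then c (k - 1) else 0)"
proof -
  have "\<epsilon> k \<bullet> (\<Sum>i=1..<n. c i *\<^sub>R bond i) = (\<Sum>i=1..<n. (if k = i then c i else 0) - (if k = Suc i then c i else 0))"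
    unfolding inner_sum_right using assms
    by (intro sum.cong) (auto simp: bond_def inner_diff_right orthonormal)
  also have "\<dots> = (\<Sum>i=1..<n. if k = i then c i else 0) - (\<Sum>i=1..<n. if k - 1 = i then (if 1 < k then c i else 0) else 0)"
    unfolding sum_subtractf using assms
    by (intro arg_cong2[where f = "(-)"] sum.cong) auto
  also have "\<dots> = (if k < n then c k else 0) - (if 1 < k then c (k - 1) else 0)"
    using assms by auto
  finally show ?thesis .
qed

lemma inner_force:
  assumes "k \<in> {1..n}"
  shows "\<epsilon> k \<bullet> force \<psi> q = (if 1 < k then \<psi> (bond (k - 1) \<bullet> q) else 0) - (if k < n then \<psi> (bond k \<bullet> q) else 0)"
  using inner_chain[OF assms, of "\<lambda>i. \<psi> (bond i \<bullet> q)"] by (simp add: force_def)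

text \<open>Fewer than \<open>n\<close> bonds contribute, each with two factors
  \<open>norm (bond k) \<le> 2\<close>: one from the argument of \<psi>, one from the direction of
  the force.\<close>

lemma force_lipschitz:
  assumes "\<And>x y. \<bar>\<psi> x - \<psi> y\<bar> \<le> L * \<bar>x - y\<bar>"
  shows "norm (force \<psi> x - force \<psi> y) \<le> (4 * real n * L) * norm (x - y)"
proof -
  have "0 \<le> L" using assms[of 0 1] by simp
  have "norm (force \<psi> x - force \<psi> y) = norm (\<Sum>k=1..<n. (\<psi> (bond k \<bullet> y) - \<psi> (bond k \<bullet> x)) *\<^sub>R bond k)"
    by (simp add: force_def sum_subtractf scaleR_diff_left)
  also have "\<dots> \<le> (\<Sum>k=1..<n. (L * (2 * norm (x - y))) * 2)"
  proof (rule sum_norm_le)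
    fix k assume k: "k \<in> {1..<n}"
    have "\<bar>\<psi> (bond k \<bullet> y) - \<psi> (bond k \<bullet> x)\<bar> \<le> L * \<bar>bond k \<bullet> (x - y)\<bar>"
      using assms[of "bond k \<bullet> y" "bond k \<bullet> x"] by (simp add: inner_diff_right abs_minus_commute)
    also have "\<dots> \<le> L * (2 * norm (x - y))"
      by (intro mult_left_mono abs_inner_bond_le k \<open>0 \<le> L\<close>)
    finally show "norm ((\<psi> (bond k \<bullet> y) - \<psi> (bond k \<bullet> x)) *\<^sub>R bond k) \<le> (L * (2 * norm (x - y))) * 2"
      unfolding norm_scaleR using norm_bond[OF k] \<open>0 \<le> L\<close> by (intro mult_mono) auto
  qed
  also have "\<dots> = real (n - 1) * (4 * L * norm (x - y))"
    by simp
  also have "\<dots> \<le> real n * (4 * L * norm (x - y))"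
    using \<open>0 \<le> L\<close> by (intro mult_right_mono) auto
  finally show ?thesis by (simp add: algebra_simps)
qed

text \<open>In shifted coordinates the control is visible only in the position equation of the first
  particle; the momentum equations are free of it.\<close>

lemma path_coordinates:
  assumes z: "controlled_path (force \<psi>) (\<epsilon> 1) w s z" and t: "t \<in> {0..s}" and k: "k \<in> {1..n}"
  shows "((\<lambda>t. \<epsilon> k \<bullet> fst (z t)) has_real_derivative \<epsilon> k \<bullet> snd (z t) + (if k = 1 then w t else 0)) (at t within {0..s})"
    and "((\<lambda>t. \<epsilon> k \<bullet> snd (z t)) has_real_derivative
      (if 1 < k then \<psi> (bond (k - 1) \<bullet> fst (z t)) else 0) - (if k < n then \<psi> (bond k \<bullet> fst (z t)) else 0)) (at t within {0..s})"
proof -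
  have z': "(z has_vector_derivative (snd (z t) + w t *\<^sub>R \<epsilon> 1, force \<psi> (fst (z t)))) (at t within {0..s})"
    using z t by (auto simp: controlled_path_def)
  have "((\<lambda>t. \<epsilon> k \<bullet> fst (z t)) has_vector_derivative \<epsilon> k \<bullet> fst (snd (z t) + w t *\<^sub>R \<epsilon> 1, force \<psi> (fst (z t)))) (at t within {0..s})"
    by (rule bounded_linear.has_vector_derivative[OF _ z', of "\<lambda>x. \<epsilon> k \<bullet> fst x"])
      (intro bounded_linear_compose[OF bounded_linear_inner_right] bounded_linear_fst)
  then show "((\<lambda>t. \<epsilon> k \<bullet> fst (z t)) has_real_derivative \<epsilon> k \<bullet> snd (z t) + (if k = 1 then w t else 0)) (at t within {0..s})"
    using orthonormal[of k 1] k by (simp add: has_real_derivative_iff_has_vector_derivative inner_add_right split: if_splits)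
  have "((\<lambda>t. \<epsilon> k \<bullet> snd (z t)) has_vector_derivative \<epsilon> k \<bullet> snd (snd (z t) + w t *\<^sub>R \<epsilon> 1, force \<psi> (fst (z t)))) (at t within {0..s})"
    by (rule bounded_linear.has_vector_derivative[OF _ z', of "\<lambda>x. \<epsilon> k \<bullet> snd x"])
      (intro bounded_linear_compose[OF bounded_linear_inner_right] bounded_linear_snd)
  then show "((\<lambda>t. \<epsilon> k \<bullet> snd (z t)) has_real_derivative
      (if 1 < k then \<psi> (bond (k - 1) \<bullet> fst (z t)) else 0) - (if k < n then \<psi> (bond k \<bullet> fst (z t)) else 0)) (at t within {0..s})"
    by (simp add: has_real_derivative_iff_has_vector_derivative inner_force[OF k])
qed

text \<open>The particles beyond a bond of constant length feel a constant pull.\<close>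

lemma upper_particles_agree:
  assumes lip: "\<And>x y. \<bar>\<psi> x - \<psi> y\<bar> \<le> L * \<bar>x - y\<bar>"
    and z: "controlled_path (force \<psi>) (\<epsilon> 1) w s z" "controlled_path (force \<psi>) (\<epsilon> 1) w' s z'"
    and \<alpha>\<beta>: "0 \<le> \<alpha>" "\<alpha> < \<beta>" "\<beta> \<le> s" and init: "z \<alpha> = z' \<alpha>" and j: "j \<in> {1..<n}"
    and bond_j: "\<And>t. t \<in> {\<alpha>..\<beta>} \<Longrightarrow> bond j \<bullet> fst (z t) = \<rho>" "\<And>t. t \<in> {\<alpha>..\<beta>} \<Longrightarrow> bond j \<bullet> fst (z' t) = \<rho>"
    and t: "t \<in> {\<alpha>..\<beta>}" and k: "k \<in> {j<..n}"
  shows "\<epsilon> k \<bullet> fst (z t) = \<epsilon> k \<bullet> fst (z' t)"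
proof -
  have "0 \<le> L" using lip[of 0 1] by simp
  \<comment> \<open>Projection onto the particles beyond bond \<open>j\<close>. It kills the control
    and the bonds below \<open>j\<close>; bond \<open>j\<close> carries the same tension in both
    motions; the bonds above \<open>j\<close> depend on projected positions only. The projected
    difference thus obeys a closed homogeneous estimate.\<close>
  define pr where "pr v = (\<Sum>i\<in>{j<..n}. (\<epsilon> i \<bullet> v) *\<^sub>R \<epsilon> i)" for v
  have lin: "bounded_linear pr"
    unfolding pr_def by (intro bounded_linear_sum bounded_linear_scaleR_const bounded_linear_inner_right)
  interpret pr: bounded_linear pr by (rule lin)
  have inner_pr: "\<epsilon> k \<bullet> pr v = \<epsilon> k \<bullet> v" if "k \<in> {j<..n}" for k v
  proof -
    have "\<epsilon> k \<bullet> pr v = (\<Sum>i\<in>{j<..n}. if i = k then \<epsilon> k \<bullet> v else 0)"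
      unfolding pr_def inner_sum_right using that j by (intro sum.cong) (auto simp: orthonormal)
    also have "\<dots> = \<epsilon> k \<bullet> v"
      using that by simp
    finally show ?thesis .
  qed
  have pr_unit: "pr (\<epsilon> k) = 0" if "k \<in> {1..j}" for k
    unfolding pr_def using that j by (intro sum.neutral) (auto simp: orthonormal)
  have pr_bond: "pr (bond k) = 0" if "k \<in> {1..<j}" for k
    using that by (simp add: bond_def pr.diff pr_unit)
  have force_diff: "norm (pr (force \<psi> x - force \<psi> y)) \<le> (\<Sum>k=1..<n. (L * 2) * norm (pr (bond k))) * norm (pr (x - y))"
    if "bond j \<bullet> x = \<rho>" "bond j \<bullet> y = \<rho>" for x y
  proof -
    have "pr (force \<psi> x - force \<psi> y) = (\<Sum>k=1..<n. (\<psi> (bond k \<bullet> y) - \<psi> (bond k \<bullet> x)) *\<^sub>R pr (bond k))"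
      by (simp add: force_def pr.diff pr.neg pr.sum pr.scaleR sum_subtractf scaleR_diff_left)
    also have "norm \<dots> \<le> (\<Sum>k=1..<n. ((L * 2) * norm (pr (bond k))) * norm (pr (x - y)))"
    proof (rule sum_norm_le)
      fix k assume k: "k \<in> {1..<n}"
      consider "k < j" | "k = j" | "j < k" by linarith
      then show "norm ((\<psi> (bond k \<bullet> y) - \<psi> (bond k \<bullet> x)) *\<^sub>R pr (bond k)) \<le> ((L * 2) * norm (pr (bond k))) * norm (pr (x - y))"
      proof cases
        case 1
        then show ?thesis using k by (simp add: pr_bond)
      next
        case 2
        then show ?thesis using that \<open>0 \<le> L\<close> by simp
      next
        case 3
        have "\<bar>\<psi> (bond k \<bullet> y) - \<psi> (bond k \<bullet> x)\<bar> \<le> L * \<bar>bond k \<bullet> (x - y)\<bar>"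
          using lip[of "bond k \<bullet> y" "bond k \<bullet> x"] by (simp add: inner_diff_right abs_minus_commute)
        also have "bond k \<bullet> (x - y) = bond k \<bullet> pr (x - y)"
          using 3 k by (simp add: inner_bond inner_pr)
        also have "L * \<bar>bond k \<bullet> pr (x - y)\<bar> \<le> L * (2 * norm (pr (x - y)))"
          by (intro mult_left_mono abs_inner_bond_le k \<open>0 \<le> L\<close>)
        finally have "\<bar>\<psi> (bond k \<bullet> y) - \<psi> (bond k \<bullet> x)\<bar> * norm (pr (bond k))
            \<le> L * (2 * norm (pr (x - y))) * norm (pr (bond k))"
          by (rule mult_right_mono) simp
        then show ?thesis
          unfolding norm_scaleR real_norm_def by (simp only: mult_ac)
      qed
    qed
    finally show ?thesis by (simp add: sum_distrib_right)
  qed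
  define C where "C = (\<Sum>k=1..<n. (L * 2) * norm (pr (bond k)))"
  have "0 \<le> C" unfolding C_def using \<open>0 \<le> L\<close> by (intro sum_nonneg) simp
  define y where "y t = (pr (fst (z t - z' t)), pr (snd (z t - z' t)))" for t
  let ?y' = "\<lambda>t. (pr (snd (z t - z' t)), pr (force \<psi> (fst (z t)) - force \<psi> (fst (z' t))))"
  have "norm (y t) \<le> 2 * (norm (y \<alpha>) + 0 * (\<beta> - \<alpha>)) * exp (2 * (C + 1) * (t - \<alpha>))"
  proof (rule gronwall[where y' = ?y' and b = \<beta>])
    fix t assume t: "t \<in> {\<alpha>..\<beta>}"
    let ?D = "(snd (z t) + w t *\<^sub>R \<epsilon> 1, force \<psi> (fst (z t))) - (snd (z' t) + w' t *\<^sub>R \<epsilon> 1, force \<psi> (fst (z' t)))"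
    have "((\<lambda>t. z t - z' t) has_vector_derivative ?D) (at t within {0..s})"
      using z t \<alpha>\<beta> by (intro has_vector_derivative_diff) (auto simp: controlled_path_def)
    then have D: "((\<lambda>t. z t - z' t) has_vector_derivative ?D) (at t within {\<alpha>..\<beta>})"
      by (rule has_vector_derivative_within_subset) (use \<alpha>\<beta> in auto)
    have "(y has_vector_derivative (pr (fst ?D), pr (snd ?D))) (at t within {\<alpha>..\<beta>})"
      unfolding y_def
      by (intro has_vector_derivative_Pair bounded_linear.has_vector_derivative[OF lin]
          bounded_linear.has_vector_derivative[OF bounded_linear_fst D]
          bounded_linear.has_vector_derivative[OF bounded_linear_snd D])
    moreover have "pr (fst ?D) = pr (snd (z t - z' t))"
      using pr_unit[of 1] j by (simp add: pr.diff pr.add pr.scaleR)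
    ultimately show "(y has_vector_derivative ?y' t) (at t within {\<alpha>..\<beta>})"
      by simp
    have "norm (?y' t) \<le> norm (snd (y t)) + C * norm (fst (y t))"
      unfolding C_def y_def using force_diff[OF bond_j[OF t]]
      by (intro order.trans[OF norm_Pair_le] add_mono) auto
    also have "\<dots> \<le> norm (y t) + C * norm (y t)"
      by (intro add_mono mult_left_mono norm_fst_bound norm_snd_bound \<open>0 \<le> C\<close>)
    finally show "norm (?y' t) \<le> (C + 1) * norm (y t) + 0"
      by (simp add: algebra_simps)
  qed (use t \<open>0 \<le> C\<close> in auto)
  then have "pr (fst (z t - z' t)) = 0"
    using init by (simp add: y_def pr.zero zero_prod_def)
  then show ?thesis
    using inner_pr[OF k, of "fst (z t - z' t)"] by (simp add: inner_diff_right)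
qed

text \<open>Reading the equations of motion from bond \<open>j\<close> down to the first particle recovers the control.\<close>

lemma control_determined:
  assumes lip: "\<And>x y. \<bar>\<psi> x - \<psi> y\<bar> \<le> L * \<bar>x - y\<bar>"
    and deriv: "\<And>y. (\<psi> has_real_derivative \<psi>' y) (at y)"
    and z: "controlled_path (force \<psi>) (\<epsilon> 1) w s z" "controlled_path (force \<psi>) (\<epsilon> 1) w' s z'"
    and \<alpha>\<beta>: "0 \<le> \<alpha>" "\<alpha> < \<beta>" "\<beta> \<le> s" and init: "z \<alpha> = z' \<alpha>" and j: "j \<in> {1..<n}"
    and bond_j: "\<And>t. t \<in> {\<alpha>..\<beta>} \<Longrightarrow> bond j \<bullet> fst (z t) = \<rho>" "\<And>t. t \<in> {\<alpha>..\<beta>} \<Longrightarrow> bond j \<bullet> fst (z' t) = \<rho>"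
    and regular: "\<And>k t y. k \<in> {1..<j} \<Longrightarrow> t \<in> {\<alpha>..\<beta>} \<Longrightarrow>
      y \<in> closed_segment (bond k \<bullet> fst (z t)) (bond k \<bullet> fst (z' t)) \<Longrightarrow> \<psi>' y \<noteq> 0"
    and t: "t \<in> {\<alpha>..\<beta>}"
  shows "w t = w' t"
proof -
  have sub: "{\<alpha>..\<beta>} \<subseteq> {0..s}" using \<alpha>\<beta> by auto
  \<comment> \<open>Equal tensions force equal lengths: by the mean value theorem \<psi> separates
    the end points of a segment on which \<psi>' has no zero.\<close>
  have inj: "x = y" if "\<psi> x = \<psi> y" "\<And>u. u \<in> closed_segment x y \<Longrightarrow> \<psi>' u \<noteq> 0" for x y
  proof -
    have *: False if "x < y" "\<psi> x = \<psi> y" "\<And>u. u \<in> {x..y} \<Longrightarrow> \<psi>' u \<noteq> 0" for x y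
    proof -
      obtain u where "x < u" "u < y" "\<psi> y - \<psi> x = (y - x) * \<psi>' u"
        using MVT2[OF \<open>x < y\<close>, of \<psi> \<psi>'] deriv by blast
      with that show False by auto
    qed
    from *[of x y] *[of y x] that show ?thesis
      by (cases x y rule: linorder_cases) (auto simp: closed_segment_eq_real_ivl split: if_splits)
  qed
  \<comment> \<open>After \<open>i\<close> steps the particles beyond \<open>j - i\<close> agree; at
    \<open>i = j\<close> all particles are covered.\<close>
  have agree: "\<forall>k\<in>{j-i<..n}. \<forall>t\<in>{\<alpha>..\<beta>}. \<epsilon> k \<bullet> fst (z t) = \<epsilon> k \<bullet> fst (z' t)" if "i \<le> j" for i
    using that
  proof (induction i)
    case 0
    then show ?case
      using upper_particles_agree[OF lip z \<alpha>\<beta> init j bond_j] by simp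
  next
    case (Suc i)
    define m where "m = j - i"
    have m: "1 \<le> m" "m \<le> j" "m < n" "j - Suc i = m - 1" using Suc.prems j by (auto simp: m_def)
    have IH: "\<epsilon> k \<bullet> fst (z t) = \<epsilon> k \<bullet> fst (z' t)" if "k \<in> {m<..n}" "t \<in> {\<alpha>..\<beta>}" for k t
      using Suc that by (simp add: m_def)
    have bond_m: "bond m \<bullet> fst (z t) = bond m \<bullet> fst (z' t)" if t: "t \<in> {\<alpha>..\<beta>}" for t
    proof (cases "m = j")
      case True
      then show ?thesis using bond_j t by simp
    next
      case False
      then have m': "Suc m \<le> j" using m by simp
      have k: "Suc m \<in> {1..n}" using m by simp
      \<comment> \<open>Agreement of particle \<open>m + 1\<close> is differentiated twice: its
        momenta agree, hence also the forces on it. As bond \<open>m + 1\<close> is already known,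
        only the tension of bond \<open>m\<close> remains.\<close>
      have mom: "\<epsilon> (Suc m) \<bullet> snd (z t) - \<epsilon> (Suc m) \<bullet> snd (z' t) = 0" if t: "t \<in> {\<alpha>..\<beta>}" for t
      proof (rule zero_derivative_on_subinterval[OF _ \<alpha>\<beta>(2) sub t])
        show "\<epsilon> (Suc m) \<bullet> fst (z t) - \<epsilon> (Suc m) \<bullet> fst (z' t) = 0" if "t \<in> {\<alpha>..\<beta>}" for t
          using IH[of "Suc m" t] that m by simp
        show "((\<lambda>t. \<epsilon> (Suc m) \<bullet> fst (z t) - \<epsilon> (Suc m) \<bullet> fst (z' t)) has_real_derivative
            \<epsilon> (Suc m) \<bullet> snd (z t) - \<epsilon> (Suc m) \<bullet> snd (z' t)) (at t within {0..s})"
          using DERIV_diff[OF path_coordinates(1)[OF z(1) _ k] path_coordinates(1)[OF z(2) _ k]] sub t m by auto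
      qed
      have "(\<psi> (bond m \<bullet> fst (z t)) - \<psi> (bond (Suc m) \<bullet> fst (z t)))
          - (\<psi> (bond m \<bullet> fst (z' t)) - \<psi> (bond (Suc m) \<bullet> fst (z' t))) = 0"
        using DERIV_diff[OF path_coordinates(2)[OF z(1) _ k] path_coordinates(2)[OF z(2) _ k], of t] sub t m m' j
        by (intro zero_derivative_on_subinterval[OF mom \<alpha>\<beta>(2) sub t]) auto
      moreover have "bond (Suc m) \<bullet> fst (z t) = bond (Suc m) \<bullet> fst (z' t)"
        using IH[of "Suc m" t] IH[of "Suc (Suc m)" t] t m m' j by (simp add: inner_bond)
      ultimately have "\<psi> (bond m \<bullet> fst (z t)) = \<psi> (bond m \<bullet> fst (z' t))"
        by simp
      then show ?thesis
      proof (rule inj)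
        show "\<psi>' u \<noteq> 0" if "u \<in> closed_segment (bond m \<bullet> fst (z t)) (bond m \<bullet> fst (z' t))" for u
          using m m' by (intro regular[OF _ t that]) simp
      qed
    qed
    show ?case
    proof (intro ballI)
      fix k t assume kt: "k \<in> {j - Suc i<..n}" "t \<in> {\<alpha>..\<beta>}"
      show "\<epsilon> k \<bullet> fst (z t) = \<epsilon> k \<bullet> fst (z' t)"
      proof (cases "k = m")
        case True
        then show ?thesis
          using bond_m[OF kt(2)] IH[of "Suc m" t] kt m by (simp add: inner_bond)
      next
        case False
        then show ?thesis using IH[of k t] kt m by auto
      qed
    qed
  qed
  have pos: "\<epsilon> k \<bullet> fst (z t) - \<epsilon> k \<bullet> fst (z' t) = 0" if "k \<in> {1..n}" "t \<in> {\<alpha>..\<beta>}" for k t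
    using agree[of j] that by simp
  have one: "1 \<in> {1..n}" using two_le by simp
  have "\<exists>c. \<forall>t\<in>{\<alpha>..\<beta>}. \<epsilon> 1 \<bullet> snd (z t) - \<epsilon> 1 \<bullet> snd (z' t) = c"
  proof (rule has_field_derivative_zero_constant)
    fix t assume t: "t \<in> {\<alpha>..\<beta>}"
    have "bond 1 \<bullet> fst (z t) = bond 1 \<bullet> fst (z' t)"
      using pos[OF one t] pos[of 2 t] t two_le by (simp add: inner_bond numeral_2_eq_2)
    then have "((\<lambda>t. \<epsilon> 1 \<bullet> snd (z t) - \<epsilon> 1 \<bullet> snd (z' t)) has_real_derivative 0) (at t within {0..s})"
      using DERIV_diff[OF path_coordinates(2)[OF z(1) _ one] path_coordinates(2)[OF z(2) _ one], of t] sub t two_le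
      by (auto simp del: One_nat_def)
    then show "((\<lambda>t. \<epsilon> 1 \<bullet> snd (z t) - \<epsilon> 1 \<bullet> snd (z' t)) has_real_derivative 0) (at t within {\<alpha>..\<beta>})"
      by (rule has_field_derivative_subset[OF _ sub])
  qed simp
  then obtain c where c: "\<And>t. t \<in> {\<alpha>..\<beta>} \<Longrightarrow> \<epsilon> 1 \<bullet> snd (z t) - \<epsilon> 1 \<bullet> snd (z' t) = c"
    by blast
  have "c = 0" using c[of \<alpha>] init \<alpha>\<beta> by simp
  \<comment> \<open>Position and shifted momentum of the first particle agree in both motions, so
    its position equation reveals the control.\<close>
  have "(\<epsilon> 1 \<bullet> snd (z t) + w t) - (\<epsilon> 1 \<bullet> snd (z' t) + w' t) = 0"
    using DERIV_diff[OF path_coordinates(1)[OF z(1) _ one] path_coordinates(1)[OF z(2) _ one], of t] sub t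
    by (intro zero_derivative_on_subinterval[OF pos[OF one] \<alpha>\<beta>(2) sub t]) auto
  then show ?thesis
    using c[OF t] \<open>c = 0\<close> by simp
qed

end

text \<open>The setting of the truncated interaction. Global bounds make motions exist for all
  times; \<open>deriv_nonzero\<close> is what survives of analyticity: the zeros of \<psi>' contain
  no interval.\<close>

locale smooth_chain = chain \<epsilon> n for \<epsilon> :: "nat \<Rightarrow> 'v::euclidean_space" and n +
  fixes \<psi> \<psi>' :: "real \<Rightarrow> real" and L M :: real
  assumes deriv: "(\<psi> has_real_derivative \<psi>' y) (at y)"
    and deriv_bound: "\<bar>\<psi>' y\<bar> \<le> L"
    and deriv_lipschitz: "\<bar>\<psi>' x - \<psi>' y\<bar> \<le> M * \<bar>x - y\<bar>"
    and deriv_nonzero: "u < v \<Longrightarrow> \<exists>y. u < y \<and> y < v \<and> \<psi>' y \<noteq> 0"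
begin

lemma L_nonneg: "0 \<le> L"
  using deriv_bound[of 0] by linarith

lemma M_nonneg: "0 \<le> M"
  using deriv_lipschitz[of 0 1] by simp

lemma lipschitz: "\<bar>\<psi> x - \<psi> y\<bar> \<le> L * \<bar>x - y\<bar>"
  using field_differentiable_bound[of UNIV \<psi> \<psi>' L x y] deriv deriv_bound by simp

lemma continuous_deriv: "continuous_on S \<psi>'"
proof -
  have "M-lipschitz_on S \<psi>'"
    using deriv_lipschitz M_nonneg by (intro lipschitz_onI) (auto simp: dist_real_def)
  then show ?thesis by (rule lipschitz_on_continuous_on)
qed

text \<open>The image of the interval is connected and lies in the zero set of \<psi>', which
  contains no interval; so it is a point.\<close>

lemma constant_if_deriv_zero:
  fixes f :: "real \<Rightarrow> real"
  assumes cont: "continuous_on {\<alpha>..\<beta>} f" and zero: "\<And>t. t \<in> {\<alpha>..\<beta>} \<Longrightarrow> \<psi>' (f t) = 0" and t: "t \<in> {\<alpha>..\<beta>}"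
  shows "f t = f \<alpha>"
proof (rule ccontr)
  assume "f t \<noteq> f \<alpha>"
  then have "min (f \<alpha>) (f t) < max (f \<alpha>) (f t)"
    by (auto simp: min_def max_def)
  from deriv_nonzero[OF this] obtain y where y: "min (f \<alpha>) (f t) < y" "y < max (f \<alpha>) (f t)" "\<psi>' y \<noteq> 0"
    by blast
  have "connected (f ` {\<alpha>..\<beta>})"
    by (intro connected_continuous_image cont connected_Icc)
  then have "y \<in> f ` {\<alpha>..\<beta>}"
    using y(1,2) t connectedD_interval[of "f ` {\<alpha>..\<beta>}" "min (f \<alpha>) (f t)" "max (f \<alpha>) (f t)" y]
    by (auto simp: min_def max_def)
  then show False using zero y(3) by auto
qed

abbreviation motion :: "(real \<Rightarrow> real) \<Rightarrow> real \<Rightarrow> (real \<Rightarrow> 'v \<times> 'v) \<Rightarrow> bool" where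
  "motion \<equiv> controlled_path (force \<psi>) (\<epsilon> 1)"

lemma path_exists:
  assumes "continuous_on {0..s} w" "0 \<le> s"
  obtains z where "motion w s z" "z 0 = x0"
proof -
  have "0 \<le> 4 * real n * L" using L_nonneg by simp
  from controlled_path_exists[OF force_lipschitz[OF lipschitz] this assms(2,1), where a = "\<epsilon> 1" and ?x0.0 = x0] that
  show ?thesis by blast
qed

text \<open>The constant depends on \<open>s\<close> but not on the two motions, so the size of a
  perturbation can be chosen after it.\<close>

lemma path_lipschitz:
  obtains C where "0 \<le> C" "\<And>w w' z z' \<delta> t. motion w s z \<Longrightarrow> motion w' s z' \<Longrightarrow> z 0 = z' 0 \<Longrightarrow>
    (\<And>t. t \<in> {0..s} \<Longrightarrow> \<bar>w t - w' t\<bar> \<le> \<delta>) \<Longrightarrow> t \<in> {0..s} \<Longrightarrow> norm (z t - z' t) \<le> C * \<delta>"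
proof
  let ?C = "2 * norm (\<epsilon> 1) * \<bar>s\<bar> * exp (2 * (4 * real n * L + 1) * s)"
  show "0 \<le> ?C" by simp
  fix w w' z z' \<delta> t
  assume *: "motion w s z" "motion w' s z'" "z 0 = z' 0"
    "\<And>t. t \<in> {0..s} \<Longrightarrow> \<bar>w t - w' t\<bar> \<le> \<delta>" "t \<in> {0..s}"
  have "0 \<le> 4 * real n * L" using L_nonneg by simp
  from controlled_path_lipschitz[OF force_lipschitz[OF lipschitz] this *] *(5)
  show "norm (z t - z' t) \<le> ?C * \<delta>" by simp
qed

lemma continuous_bond:
  "motion w s z \<Longrightarrow> S \<subseteq> {0..s} \<Longrightarrow> continuous_on S (\<lambda>t. bond k \<bullet> fst (z t))"
  by (intro continuous_intros continuous_on_subset[OF controlled_path_continuous])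

lemma continuous_stiffness:
  "motion w s z \<Longrightarrow> S \<subseteq> {0..s} \<Longrightarrow> continuous_on S (\<lambda>t. \<psi>' (bond k \<bullet> fst (z t)))"
  by (rule continuous_on_compose2[OF continuous_deriv[of UNIV] continuous_bond]) auto

text \<open>Induction over the number of bonds active on a common time interval; each step spends
  half of the allowed deviation and may shrink the interval. The value at time 0 is kept because
  \<open>w 0\<close> enters the actual initial state.\<close>

lemma activate_bonds:
  assumes w: "piecewise_affine w" and z: "motion w s z" and "0 < s" and "m < n" "0 < \<delta>"
  shows "\<exists>w' z' \<alpha> \<beta>. piecewise_affine w' \<and> w' 0 = w 0 \<and> motion w' s z' \<and> z' 0 = z 0 \<and>
    (\<forall>t\<in>{0..s}. \<bar>w' t - w t\<bar> \<le> \<delta> \<and> norm (z' t - z t) \<le> \<delta>) \<and>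
    0 \<le> \<alpha> \<and> \<alpha> < \<beta> \<and> \<beta> \<le> s \<and> (\<forall>k\<in>{1..m}. \<forall>t\<in>{\<alpha>..\<beta>}. \<psi>' (bond k \<bullet> fst (z' t)) \<noteq> 0)"
  using assms(4,5)
proof (induction m arbitrary: \<delta>)
  case 0
  show ?case
    by (rule exI[of _ w], rule exI[of _ z], rule exI[of _ 0], rule exI[of _ s]) (use assms 0 in simp)
next
  case (Suc m)
  define j where "j = Suc m"
  have j: "j \<in> {1..<n}" using Suc.prems by (simp add: j_def)
  obtain w1 z1 \<alpha> \<beta> where w1: "piecewise_affine w1" "w1 0 = w 0" and z1: "motion w1 s z1" "z1 0 = z 0"
    and near1: "\<And>t. t \<in> {0..s} \<Longrightarrow> \<bar>w1 t - w t\<bar> \<le> \<delta> / 2" "\<And>t. t \<in> {0..s} \<Longrightarrow> norm (z1 t - z t) \<le> \<delta> / 2"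
    and \<alpha>\<beta>: "0 \<le> \<alpha>" "\<alpha> < \<beta>" "\<beta> \<le> s"
    and active: "\<And>k t. k \<in> {1..m} \<Longrightarrow> t \<in> {\<alpha>..\<beta>} \<Longrightarrow> \<psi>' (bond k \<bullet> fst (z1 t)) \<noteq> 0"
    using Suc.IH[of "\<delta> / 2"] Suc.prems by auto
  have sub: "{\<alpha>..\<beta>} \<subseteq> {0..s}" using \<alpha>\<beta> by auto
  \<comment> \<open>A single time at which bond \<open>j\<close> is nondegenerate suffices, since
    continuity provides a subinterval. This is applied to the motion \<open>z1\<close> itself or to
    its perturbation.\<close>
  have extend: ?case
    if w2: "piecewise_affine w2" "w2 0 = w1 0" and z2: "motion w2 s z2" "z2 0 = z1 0"
      and near2: "\<And>t. t \<in> {0..s} \<Longrightarrow> \<bar>w2 t - w1 t\<bar> \<le> \<delta> / 2" "\<And>t. t \<in> {0..s} \<Longrightarrow> norm (z2 t - z1 t) \<le> \<delta> / 2"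
      and active2: "\<And>k t. k \<in> {1..m} \<Longrightarrow> t \<in> {\<alpha>..\<beta>} \<Longrightarrow> \<psi>' (bond k \<bullet> fst (z2 t)) \<noteq> 0"
      and t: "t \<in> {\<alpha>..\<beta>}" "\<psi>' (bond j \<bullet> fst (z2 t)) \<noteq> 0" for w2 z2 t
  proof -
    obtain \<alpha>' \<beta>' where *: "\<alpha> \<le> \<alpha>'" "\<alpha>' < \<beta>'" "\<beta>' \<le> \<beta>" "\<And>r. r \<in> {\<alpha>'..\<beta>'} \<Longrightarrow> \<psi>' (bond j \<bullet> fst (z2 r)) \<noteq> 0"
      using nonzero_subinterval[OF continuous_stiffness[OF z2(1) sub] \<alpha>\<beta>(2) t] by blast
    have "\<psi>' (bond k \<bullet> fst (z2 r)) \<noteq> 0" if "k \<in> {1..Suc m}" "r \<in> {\<alpha>'..\<beta>'}" for k r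
      using active2[of k r] *(4)[of r] that *(1,3) by (cases "k = j") (auto simp: j_def)
    moreover have "\<bar>w2 t - w t\<bar> \<le> \<delta> \<and> norm (z2 t - z t) \<le> \<delta>" if "t \<in> {0..s}" for t
      using near1[OF that] near2[OF that] norm_triangle_ineq[of "z2 t - z1 t" "z1 t - z t"]
        abs_triangle_ineq[of "w2 t - w1 t" "w1 t - w t"] by simp
    ultimately show ?thesis
      using w2 z2 w1(2) z1(2) * \<alpha>\<beta>
      by (intro exI[of _ w2] exI[of _ z2] exI[of _ \<alpha>'] exI[of _ \<beta>']) simp
  qed
  show ?case
  proof (cases "\<exists>t\<in>{\<alpha>..\<beta>}. \<psi>' (bond j \<bullet> fst (z1 t)) \<noteq> 0")
    case True
    then obtain t where "t \<in> {\<alpha>..\<beta>}" "\<psi>' (bond j \<bullet> fst (z1 t)) \<noteq> 0" by blast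
    then show ?thesis
      using Suc.prems by (intro extend[OF w1(1) _ z1(1) _ _ _ active]) auto
  next
    case False
    have "\<exists>c>0. \<forall>t\<in>{\<alpha>..\<beta>}. c \<le> \<bar>\<psi>' (bond k \<bullet> fst (z1 t))\<bar>" if "k \<in> {1..m}" for k
    proof -
      have "continuous_on {\<alpha>..\<beta>} (\<lambda>t. \<bar>\<psi>' (bond k \<bullet> fst (z1 t))\<bar>)"
        by (intro continuous_intros continuous_stiffness[OF z1(1) sub])
      from continuous_attains_inf[OF compact_Icc _ this] \<alpha>\<beta>(2) obtain t0 where "t0 \<in> {\<alpha>..\<beta>}"
        "\<And>t. t \<in> {\<alpha>..\<beta>} \<Longrightarrow> \<bar>\<psi>' (bond k \<bullet> fst (z1 t0))\<bar> \<le> \<bar>\<psi>' (bond k \<bullet> fst (z1 t))\<bar>"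
        by auto
      then show ?thesis
        using active[OF that] by (intro exI[of _ "\<bar>\<psi>' (bond k \<bullet> fst (z1 t0))\<bar>"]) auto
    qed
    then obtain c where c: "\<And>k. k \<in> {1..m} \<Longrightarrow> 0 < c k"
      "\<And>k t. k \<in> {1..m} \<Longrightarrow> t \<in> {\<alpha>..\<beta>} \<Longrightarrow> c k \<le> \<bar>\<psi>' (bond k \<bullet> fst (z1 t))\<bar>"
      by metis
    \<comment> \<open>Common margin by which the earlier bonds are active; the element 1 keeps the
      minimum defined for \<open>m = 0\<close>.\<close>
    define \<mu> where "\<mu> = Min (insert 1 (c ` {1..m}))"
    have \<mu>: "0 < \<mu>" using c(1) by (auto simp: \<mu>_def)
    have \<mu>_le: "\<mu> \<le> \<bar>\<psi>' (bond k \<bullet> fst (z1 t))\<bar>" if "k \<in> {1..m}" "t \<in> {\<alpha>..\<beta>}" for k t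
    proof -
      have "\<mu> \<le> c k" unfolding \<mu>_def using that(1) by (intro Min_le) auto
      with c(2)[OF that] show ?thesis by linarith
    qed
    obtain C where C: "0 \<le> C" "\<And>w w' z z' \<delta> t. motion w s z \<Longrightarrow> motion w' s z' \<Longrightarrow> z 0 = z' 0 \<Longrightarrow>
      (\<And>t. t \<in> {0..s} \<Longrightarrow> \<bar>w t - w' t\<bar> \<le> \<delta>) \<Longrightarrow> t \<in> {0..s} \<Longrightarrow> norm (z t - z' t) \<le> C * \<delta>"
      using path_lipschitz by blast
    \<comment> \<open>The three bounds keep, in this order, the change of \<open>w1\<close> within
      \<delta>/2, the change \<open>C * \<eta>\<close> of the motion within \<delta>/2, and the
      resulting change of \<psi>' along the earlier bonds below \<mu>. Adding 1 avoids vanishing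
      denominators.\<close>
    define \<eta> where "\<eta> = min (\<delta> / 2) (min (\<delta> / (2 * (C + 1))) (\<mu> / (4 * (M + 1) * (C + 1))))"
    have \<eta>: "0 < \<eta>" using Suc.prems \<mu> C(1) M_nonneg by (simp add: \<eta>_def)
    have "\<eta> * (2 * (C + 1)) \<le> \<delta>"
      using C(1) by (subst pos_le_divide_eq[symmetric]) (auto simp: \<eta>_def)
    then have C\<eta>: "C * \<eta> \<le> \<delta> / 2" using \<eta> by (simp add: algebra_simps)
    have "\<eta> * (4 * (M + 1) * (C + 1)) \<le> \<mu>"
      using C(1) M_nonneg by (subst pos_le_divide_eq[symmetric]) (auto simp: \<eta>_def)
    moreover have "M * (2 * (C * \<eta>)) < \<eta> * (4 * (M + 1) * (C + 1))"
    proof -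
      have "0 \<le> M * C * \<eta>" "0 \<le> M * \<eta>" "0 \<le> C * \<eta>" using M_nonneg C(1) \<eta> by simp_all
      then show ?thesis using \<eta> by (simp add: algebra_simps)
    qed
    ultimately have MC\<eta>: "M * (2 * (C * \<eta>)) < \<mu>" by linarith
    \<comment> \<open>The ramp starts at \<alpha>, so both motions share the state at \<alpha>,
      while the primitives differ at \<beta>.\<close>
    define w2 where "w2 t = w1 t + (\<eta> / s) * max 0 (t - \<alpha>)" for t
    have w2: "piecewise_affine w2"
      unfolding w2_def by (intro piecewise_affine_add piecewise_affine_scale piecewise_affine_ramp w1)
    obtain z2 where z2: "motion w2 s z2" "z2 0 = z1 0"
      using path_exists[OF piecewise_affine_continuous[OF w2]] \<open>0 < s\<close> by (metis less_imp_le)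
    have w21: "\<bar>w2 t - w1 t\<bar> \<le> \<eta>" if "t \<in> {0..s}" for t
    proof -
      have "(\<eta> / s) * max 0 (t - \<alpha>) \<le> (\<eta> / s) * s"
        using that \<alpha>\<beta> \<eta> \<open>0 < s\<close> by (intro mult_left_mono) auto
      then show ?thesis using \<eta> \<open>0 < s\<close> by (simp add: w2_def)
    qed
    have z21: "norm (z2 t - z1 t) \<le> C * \<eta>" if "t \<in> {0..s}" for t
      by (rule C(2)[OF z2(1) z1(1) z2(2) w21 that])
    \<comment> \<open>The whole segment between both bond lengths is covered, as the mean value
      argument in \<open>control_determined\<close> requires; its far end point gives activity along
      \<open>z2\<close>.\<close>
    have regular: "\<psi>' y \<noteq> 0" if k: "k \<in> {1..m}" and t: "t \<in> {\<alpha>..\<beta>}"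
      and y: "y \<in> closed_segment (bond k \<bullet> fst (z1 t)) (bond k \<bullet> fst (z2 t))" for k t y
    proof -
      have "\<bar>y - bond k \<bullet> fst (z1 t)\<bar> \<le> \<bar>bond k \<bullet> fst (z2 t - z1 t)\<bar>"
        using y by (auto simp: closed_segment_eq_real_ivl inner_diff_right split: if_splits)
      also have "\<dots> \<le> 2 * norm (fst (z2 t - z1 t))"
        using k Suc.prems by (intro abs_inner_bond_le) auto
      also have "\<dots> \<le> 2 * (C * \<eta>)"
        using order.trans[OF norm_fst_bound z21, of t] t sub by auto
      finally have "M * \<bar>y - bond k \<bullet> fst (z1 t)\<bar> \<le> M * (2 * (C * \<eta>))"
        by (rule mult_left_mono) (rule M_nonneg)
      with deriv_lipschitz[of y "bond k \<bullet> fst (z1 t)"] MC\<eta> \<mu>_le[OF k t] show ?thesis by auto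
    qed
    show ?thesis
    proof (cases "\<exists>t\<in>{\<alpha>..\<beta>}. \<psi>' (bond j \<bullet> fst (z2 t)) \<noteq> 0")
      case True
      then obtain t where t: "t \<in> {\<alpha>..\<beta>}" "\<psi>' (bond j \<bullet> fst (z2 t)) \<noteq> 0" by blast
      show ?thesis
      proof (rule extend[OF w2 _ z2 _ _ _ t])
        show "w2 0 = w1 0" using \<alpha>\<beta> by (simp add: w2_def)
        show "\<bar>w2 t - w1 t\<bar> \<le> \<delta> / 2" if "t \<in> {0..s}" for t
          using w21[OF that] by (simp add: \<eta>_def)
        show "norm (z2 t - z1 t) \<le> \<delta> / 2" if "t \<in> {0..s}" for t
          using z21[OF that] C\<eta> by linarith
        show "\<psi>' (bond k \<bullet> fst (z2 t)) \<noteq> 0" if "k \<in> {1..m}" "t \<in> {\<alpha>..\<beta>}" for k t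
          using regular[OF that] by simp
      qed
    next
      \<comment> \<open>Bond \<open>j\<close> is degenerate under both controls: its length is
        constant in each motion, with the same value because the states at \<alpha> agree. Then
        \<open>w1 \<beta> = w2 \<beta>\<close>, which contradicts the ramp.\<close>
      case False2: False
      have init: "z1 \<alpha> = z2 \<alpha>"
        by (rule controlled_path_determined[OF force_lipschitz[OF lipschitz] _ z1(1) z2(1)])
          (use \<alpha>\<beta> L_nonneg z2(2) in \<open>auto simp: w2_def\<close>)
      have "w1 \<beta> = w2 \<beta>"
      proof (rule control_determined[OF lipschitz deriv z1(1) z2(1) \<alpha>\<beta> init j])
        show "bond j \<bullet> fst (z1 t) = bond j \<bullet> fst (z1 \<alpha>)" if "t \<in> {\<alpha>..\<beta>}" for t
          using False by (intro constant_if_deriv_zero[OF continuous_bond[OF z1(1) sub] _ that]) auto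
        show "bond j \<bullet> fst (z2 t) = bond j \<bullet> fst (z1 \<alpha>)" if "t \<in> {\<alpha>..\<beta>}" for t
          unfolding init
          using False2 by (intro constant_if_deriv_zero[OF continuous_bond[OF z2(1) sub] _ that]) auto
        show "\<psi>' y \<noteq> 0" if "k \<in> {1..<j}" "t \<in> {\<alpha>..\<beta>}"
          "y \<in> closed_segment (bond k \<bullet> fst (z1 t)) (bond k \<bullet> fst (z2 t))" for k t y
          using that by (intro regular[OF _ that(2,3)]) (auto simp: j_def)
        show "\<beta> \<in> {\<alpha>..\<beta>}" using \<alpha>\<beta> by simp
      qed
      then have False
        using \<alpha>\<beta> \<eta> \<open>0 < s\<close> by (simp add: w2_def)
      then show ?thesis ..
    qed
  qed
qed

end

section \<open>Linearisation\<close>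

context smooth_chain
begin

text \<open>The Hessian at \<open>fst (z t)\<close> of the potential whose bond law is \<psi>;
  \<open>- hess z t\<close> is the derivative of \<open>force \<psi>\<close> there.\<close>

definition hess :: "(real \<Rightarrow> 'v \<times> 'v) \<Rightarrow> real \<Rightarrow> 'v \<Rightarrow> 'v" where
  "hess z t v = (\<Sum>k=1..<n. (\<psi>' (bond k \<bullet> fst (z t)) * (bond k \<bullet> v)) *\<^sub>R bond k)"

text \<open>The equation of \<open>controlled_path\<close> linearised along \<open>z\<close>;
  \<omega> is the variation of the primitive \<open>w\<close>.\<close>

definition variation :: "(real \<Rightarrow> 'v \<times> 'v) \<Rightarrow> (real \<Rightarrow> real) \<Rightarrow> real \<Rightarrow> (real \<Rightarrow> 'v \<times> 'v) \<Rightarrow> bool" where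
  "variation z \<omega> s \<xi> \<longleftrightarrow> (\<forall>t\<in>{0..s}.
     (\<xi> has_vector_derivative (snd (\<xi> t) + \<omega> t *\<^sub>R \<epsilon> 1, - hess z t (fst (\<xi> t)))) (at t within {0..s}))"

lemma hess_add: "hess z t (u + v) = hess z t u + hess z t v"
  by (simp add: hess_def inner_add_right distrib_left scaleR_add_left sum.distrib)

lemma hess_scaleR: "hess z t (c *\<^sub>R v) = c *\<^sub>R hess z t v"
  by (simp add: hess_def scaleR_sum_right mult.left_commute)

lemma hess_diff: "hess z t (u - v) = hess z t u - hess z t v"
  using hess_add[of z t u "(-1) *\<^sub>R v"] unfolding hess_scaleR by simp

lemma hess_symmetric: "u \<bullet> hess z t v = v \<bullet> hess z t u"
  by (simp add: hess_def inner_sum_right inner_commute mult_ac)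

lemma norm_hess: "norm (hess z t v) \<le> 4 * real n * L * norm v"
proof -
  have "norm (hess z t v) \<le> (\<Sum>k=1..<n. L * (2 * norm v) * 2)"
    unfolding hess_def
  proof (rule sum_norm_le)
    fix k assume k: "k \<in> {1..<n}"
    show "norm ((\<psi>' (bond k \<bullet> fst (z t)) * (bond k \<bullet> v)) *\<^sub>R bond k) \<le> L * (2 * norm v) * 2"
      unfolding norm_scaleR abs_mult
      using L_nonneg by (intro mult_mono deriv_bound abs_inner_bond_le norm_bond k) auto
  qed
  also have "\<dots> = real (n - 1) * (4 * L * norm v)"
    by simp
  also have "\<dots> \<le> real n * (4 * L * norm v)"
    using L_nonneg by (intro mult_right_mono) auto
  finally show ?thesis by (simp add: algebra_simps)
qed

lemma variation_rhs_lipschitz: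
  "norm ((snd x + c *\<^sub>R a, - hess z t (fst x)) - (snd y + c *\<^sub>R a, - hess z t (fst y)))
    \<le> (1 + 4 * real n * L) * norm (x - y)"
proof -
  have "norm ((snd x + c *\<^sub>R a, - hess z t (fst x)) - (snd y + c *\<^sub>R a, - hess z t (fst y)))
      = norm (snd (x - y), - hess z t (fst (x - y)))"
    by (simp add: hess_diff)
  also have "\<dots> \<le> norm (snd (x - y)) + norm (- hess z t (fst (x - y)))"
    by (rule norm_Pair_le)
  also have "\<dots> \<le> norm (x - y) + 4 * real n * L * norm (fst (x - y))"
    unfolding norm_minus_cancel by (intro add_mono norm_snd_bound norm_hess)
  also have "\<dots> \<le> norm (x - y) + 4 * real n * L * norm (x - y)"
    using L_nonneg by (intro add_left_mono mult_left_mono norm_fst_bound) auto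
  finally show ?thesis by (simp add: algebra_simps)
qed

lemma variation_rhs_continuous:
  assumes z: "motion w s z" and \<omega>: "continuous_on {0..s} \<omega>"
  shows "continuous_on ({0..s} \<times> UNIV) (\<lambda>(t, x). (snd x + \<omega> t *\<^sub>R \<epsilon> 1, - hess z t (fst x)))"
proof -
  have "continuous_on ({0..s} \<times> UNIV) (\<lambda>p. \<psi>' (bond k \<bullet> fst (z (fst p))))" for k
    by (rule continuous_on_compose2[OF continuous_stiffness[OF z order.refl]]) (auto intro: continuous_intros)
  moreover have "continuous_on ({0..s} \<times> UNIV) (\<lambda>p. \<omega> (fst p))"
    by (rule continuous_on_compose2[OF \<omega>]) (auto intro: continuous_intros)
  ultimately have "continuous_on ({0..s} \<times> UNIV) (\<lambda>p. (snd (snd p) + \<omega> (fst p) *\<^sub>R \<epsilon> 1, - hess z (fst p) (fst (snd p))))"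
    unfolding hess_def by (intro continuous_intros)
  then show ?thesis by (simp add: case_prod_unfold)
qed

lemma variation_exists:
  assumes "motion w s z" "continuous_on {0..s} \<omega>" "0 \<le> s"
  obtains \<xi> where "variation z \<omega> s \<xi>" "\<xi> 0 = x0"
proof -
  have "0 \<le> 1 + 4 * real n * L" using L_nonneg by simp
  show ?thesis
  proof (rule picard_lindeloef[OF variation_rhs_continuous[OF assms(1,2)] variation_rhs_lipschitz \<open>0 \<le> 1 + 4 * real n * L\<close> assms(3), of x0])
    fix \<xi> assume "\<xi> 0 = x0"
      and "\<And>t. t \<in> {0..s} \<Longrightarrow> (\<xi> has_vector_derivative (snd (\<xi> t) + \<omega> t *\<^sub>R \<epsilon> 1, - hess z t (fst (\<xi> t)))) (at t within {0..s})"
    then show ?thesis by (intro that[of \<xi>]) (auto simp: variation_def)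
  qed
qed

lemma variation_exists_backward:
  assumes "motion w s z" "continuous_on {0..s} \<omega>" "0 \<le> s"
  obtains \<xi> where "variation z \<omega> s \<xi>" "\<xi> s = x0"
proof -
  have "0 \<le> 1 + 4 * real n * L" using L_nonneg by simp
  show ?thesis
  proof (rule picard_lindeloef_backward[OF variation_rhs_continuous[OF assms(1,2)] variation_rhs_lipschitz \<open>0 \<le> 1 + 4 * real n * L\<close> assms(3), of x0])
    fix \<xi> assume "\<xi> s = x0"
      and "\<And>t. t \<in> {0..s} \<Longrightarrow> (\<xi> has_vector_derivative (snd (\<xi> t) + \<omega> t *\<^sub>R \<epsilon> 1, - hess z t (fst (\<xi> t)))) (at t within {0..s})"
    then show ?thesis by (intro that[of \<xi>]) (auto simp: variation_def)
  qed
qed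

lemma variation_components:
  assumes "variation z \<omega> s \<xi>" "t \<in> {0..s}"
  shows "((\<lambda>t. fst (\<xi> t)) has_vector_derivative snd (\<xi> t) + \<omega> t *\<^sub>R \<epsilon> 1) (at t within {0..s})"
    and "((\<lambda>t. snd (\<xi> t)) has_vector_derivative - hess z t (fst (\<xi> t))) (at t within {0..s})"
  using bounded_linear.has_vector_derivative[OF bounded_linear_fst, of \<xi> _ "at t within {0..s}"]
    bounded_linear.has_vector_derivative[OF bounded_linear_snd, of \<xi> _ "at t within {0..s}"] assms
  by (fastforce simp: variation_def)+

lemma variation_continuous: "variation z \<omega> s \<xi> \<Longrightarrow> continuous_on {0..s} \<xi>"
  unfolding variation_def by (auto intro!: continuous_on_vector_derivative)

lemma variation_superpose:
  assumes "\<And>b. b \<in> B \<Longrightarrow> variation z (\<omega> b) s (\<xi> b)"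
  shows "variation z (\<lambda>t. \<Sum>b\<in>B. c b * \<omega> b t) s (\<lambda>t. \<Sum>b\<in>B. c b *\<^sub>R \<xi> b t)"
  unfolding variation_def
proof
  fix t assume t: "t \<in> {0..s}"
  have hess_sum: "hess z t (\<Sum>b\<in>B. v b) = (\<Sum>b\<in>B. hess z t (v b))" for v :: "_ \<Rightarrow> 'v"
    using hess_scaleR[of z t 0 0] by (induction B rule: infinite_finite_induct) (simp_all add: hess_add)
  have "((\<lambda>t. \<Sum>b\<in>B. c b *\<^sub>R \<xi> b t) has_vector_derivative
      (\<Sum>b\<in>B. c b *\<^sub>R (snd (\<xi> b t) + \<omega> b t *\<^sub>R \<epsilon> 1, - hess z t (fst (\<xi> b t))))) (at t within {0..s})"
    using assms t unfolding variation_def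
    by (intro has_vector_derivative_sum bounded_linear.has_vector_derivative[OF bounded_linear_scaleR_right]) auto
  moreover have "(\<Sum>b\<in>B. c b *\<^sub>R (snd (\<xi> b t) + \<omega> b t *\<^sub>R \<epsilon> 1, - hess z t (fst (\<xi> b t))))
      = (snd (\<Sum>b\<in>B. c b *\<^sub>R \<xi> b t) + (\<Sum>b\<in>B. c b * \<omega> b t) *\<^sub>R \<epsilon> 1, - hess z t (fst (\<Sum>b\<in>B. c b *\<^sub>R \<xi> b t)))"
    by (rule prod_eqI) (simp_all add: fst_sum snd_sum hess_sum hess_scaleR scaleR_add_right sum.distrib
        scaleR_sum_left sum_negf)
  ultimately show "((\<lambda>t. \<Sum>b\<in>B. c b *\<^sub>R \<xi> b t) has_vector_derivative
      (snd (\<Sum>b\<in>B. c b *\<^sub>R \<xi> b t) + (\<Sum>b\<in>B. c b * \<omega> b t) *\<^sub>R \<epsilon> 1, - hess z t (fst (\<Sum>b\<in>B. c b *\<^sub>R \<xi> b t))))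
      (at t within {0..s})"
    by simp
qed

text \<open>Since the Hessian is symmetric, the linearised equation is its own adjoint, up to the pairing
  \<open>\<eta> \<bullet> \<delta>p - \<eta>' \<bullet> \<delta>q\<close>.\<close>

lemma adjoint_pairing:
  assumes \<nu>: "variation z (\<lambda>t. 0) s \<nu>" and \<xi>: "variation z \<omega> s \<xi>" and t: "t \<in> {0..s}"
  shows "((\<lambda>t. fst (\<nu> t) \<bullet> snd (\<xi> t) - snd (\<nu> t) \<bullet> fst (\<xi> t)) has_real_derivative
    - \<omega> t * (snd (\<nu> t) \<bullet> \<epsilon> 1)) (at t within {0..s})"
proof -
  note inner = bounded_bilinear.has_vector_derivative[OF bounded_bilinear_inner]
  have "((\<lambda>t. fst (\<nu> t) \<bullet> snd (\<xi> t) - snd (\<nu> t) \<bullet> fst (\<xi> t)) has_vector_derivative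
      (fst (\<nu> t) \<bullet> - hess z t (fst (\<xi> t)) + (snd (\<nu> t) + 0 *\<^sub>R \<epsilon> 1) \<bullet> snd (\<xi> t)) -
      (snd (\<nu> t) \<bullet> (snd (\<xi> t) + \<omega> t *\<^sub>R \<epsilon> 1) + - hess z t (fst (\<nu> t)) \<bullet> fst (\<xi> t))) (at t within {0..s})"
    by (intro has_vector_derivative_diff inner variation_components[OF \<nu> t] variation_components[OF \<xi> t])
  moreover have "(fst (\<nu> t) \<bullet> - hess z t (fst (\<xi> t)) + (snd (\<nu> t) + 0 *\<^sub>R \<epsilon> 1) \<bullet> snd (\<xi> t)) -
      (snd (\<nu> t) \<bullet> (snd (\<xi> t) + \<omega> t *\<^sub>R \<epsilon> 1) + - hess z t (fst (\<nu> t)) \<bullet> fst (\<xi> t))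
      = - \<omega> t * (snd (\<nu> t) \<bullet> \<epsilon> 1)"
    using hess_symmetric[of "fst (\<nu> t)" z t "fst (\<xi> t)"]
    by (simp add: inner_add_right inner_commute)
  ultimately show ?thesis
    by (simp add: has_real_derivative_iff_has_vector_derivative)
qed

text \<open>Variation of constants for the unit control on \<open>{d..s}\<close>: integration by
  parts moves the derivative from the adjoint solution to the ramp. The term
  \<open>(s - d) *\<^sub>R \<epsilon> 1\<close> undoes the momentum shift at the end point.\<close>

lemma ramp_response:
  assumes z: "motion w s z" and \<nu>: "variation z (\<lambda>t. 0) s \<nu>" and \<xi>: "variation z (\<lambda>t. max 0 (t - d)) s \<xi>" "\<xi> 0 = 0"
    and d: "0 \<le> d" "d \<le> s"
  shows "((\<lambda>t. fst (\<nu> t) \<bullet> \<epsilon> 1) has_integral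
    fst (\<nu> s) \<bullet> (snd (\<xi> s) + (s - d) *\<^sub>R \<epsilon> 1) - snd (\<nu> s) \<bullet> fst (\<xi> s)) {d..s}"
proof -
  define P where "P t = fst (\<nu> t) \<bullet> snd (\<xi> t) - snd (\<nu> t) \<bullet> fst (\<xi> t)" for t
  have P': "(P has_real_derivative - max 0 (t - d) * (snd (\<nu> t) \<bullet> \<epsilon> 1)) (at t within {0..s})" if "t \<in> {0..s}" for t
    unfolding P_def by (rule adjoint_pairing[OF \<nu> \<xi>(1) that])
  have "\<exists>c. \<forall>t\<in>{0..d}. P t = c"
  proof (rule has_field_derivative_zero_constant)
    show "(P has_real_derivative 0) (at t within {0..d})" if "t \<in> {0..d}" for t
      using has_field_derivative_subset[OF P'[of t], of "{0..d}"] that d by simp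
  qed simp
  then have "P d = P 0" using d by auto
  then have "P d = 0" using \<xi>(2) by (simp add: P_def)
  \<comment> \<open>\<open>Q\<close> pairs \<nu> with the unshifted variation; in its derivative the
    terms with \<open>snd (\<nu> t)\<close> cancel on \<open>{d..s}\<close>.\<close>
  define Q where "Q t = P t + (t - d) * (fst (\<nu> t) \<bullet> \<epsilon> 1)" for t
  have "((\<lambda>t. fst (\<nu> t) \<bullet> \<epsilon> 1) has_integral (Q s - Q d)) {d..s}"
  proof (rule fundamental_theorem_of_calculus[OF d(2)])
    fix t assume t: "t \<in> {d..s}"
    then have t0: "t \<in> {0..s}" using d by auto
    have "((\<lambda>t. fst (\<nu> t) \<bullet> \<epsilon> 1) has_vector_derivative (snd (\<nu> t) + 0 *\<^sub>R \<epsilon> 1) \<bullet> \<epsilon> 1) (at t within {0..s})"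
      by (intro bounded_linear.has_vector_derivative[OF bounded_linear_inner_left] variation_components[OF \<nu> t0])
    then have "((\<lambda>t. fst (\<nu> t) \<bullet> \<epsilon> 1) has_real_derivative snd (\<nu> t) \<bullet> \<epsilon> 1) (at t within {0..s})"
      by (simp add: has_real_derivative_iff_has_vector_derivative)
    moreover have "((\<lambda>t. t - d) has_real_derivative 1) (at t within {0..s})"
      by (auto intro!: derivative_eq_intros)
    ultimately have "(Q has_real_derivative - max 0 (t - d) * (snd (\<nu> t) \<bullet> \<epsilon> 1)
        + ((t - d) * (snd (\<nu> t) \<bullet> \<epsilon> 1) + 1 * (fst (\<nu> t) \<bullet> \<epsilon> 1))) (at t within {0..s})"
      unfolding Q_def by (intro DERIV_add P'[OF t0] DERIV_mult')
    then have "(Q has_vector_derivative fst (\<nu> t) \<bullet> \<epsilon> 1) (at t within {0..s})"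
      using t by (simp add: has_real_derivative_iff_has_vector_derivative)
    then show "(Q has_vector_derivative fst (\<nu> t) \<bullet> \<epsilon> 1) (at t within {d..s})"
      by (rule has_vector_derivative_within_subset) (use d in auto)
  qed
  moreover have "Q s - Q d = fst (\<nu> s) \<bullet> (snd (\<xi> s) + (s - d) *\<^sub>R \<epsilon> 1) - snd (\<nu> s) \<bullet> fst (\<xi> s)"
    using \<open>P d = 0\<close> by (simp add: Q_def P_def inner_add_right)
  ultimately show ?thesis by simp
qed

text \<open>Initial integrals are differences of tail integrals, hence zero, and differentiating
  them recovers \<open>h\<close>.\<close>

lemma zero_if_tail_integrals_zero:
  fixes h :: "real \<Rightarrow> real"
  assumes cont: "continuous_on {0..s} h" and int: "\<And>d. d \<in> {0..s} \<Longrightarrow> (h has_integral 0) {d..s}"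
    and "0 < s" and t: "t \<in> {0..s}"
  shows "h t = 0"
proof (rule zero_derivative_on_subinterval[where f = "\<lambda>u. integral {0..u} h", OF _ \<open>0 < s\<close> order.refl t])
  show "integral {0..u} h = 0" if u: "u \<in> {0..s}" for u
  proof -
    have "integral {0..u} h + integral {u..s} h = integral {0..s} h"
      using u by (intro Henstock_Kurzweil_Integration.integral_combine integrable_continuous_real cont) auto
    then show ?thesis
      using integral_unique[OF int[OF u]] integral_unique[OF int[of 0]] \<open>0 < s\<close> by simp
  qed
  show "((\<lambda>u. integral {0..u} h) has_real_derivative h t) (at t within {0..s})"
    using integral_has_vector_derivative[OF cont t] by (simp add: has_real_derivative_iff_has_vector_derivative)
qed

text \<open>Unique continuation along the chain: the equation of motion of particle \<open>k\<close> determines particle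
  \<open>k + 1\<close> as long as the bond between them is active.\<close>

lemma adjoint_vanishes:
  assumes z: "motion w s z" and \<nu>: "variation z (\<lambda>t. 0) s \<nu>"
    and \<alpha>\<beta>: "0 \<le> \<alpha>" "\<alpha> < \<beta>" "\<beta> \<le> s"
    and active: "\<And>k t. k \<in> {1..<n} \<Longrightarrow> t \<in> {\<alpha>..\<beta>} \<Longrightarrow> \<psi>' (bond k \<bullet> fst (z t)) \<noteq> 0"
    and first: "\<And>t. t \<in> {\<alpha>..\<beta>} \<Longrightarrow> \<epsilon> 1 \<bullet> fst (\<nu> t) = 0"
  shows "\<nu> s = 0"
proof -
  have sub: "{\<alpha>..\<beta>} \<subseteq> {0..s}" using \<alpha>\<beta> by auto
  have D1: "((\<lambda>t. \<epsilon> k \<bullet> fst (\<nu> t)) has_real_derivative \<epsilon> k \<bullet> snd (\<nu> t)) (at t within {0..s})"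
    if "t \<in> {\<alpha>..\<beta>}" for k t
    using bounded_linear.has_vector_derivative[OF bounded_linear_inner_right variation_components(1)[OF \<nu>], of t "\<epsilon> k"] that sub
    by (auto simp: has_real_derivative_iff_has_vector_derivative)
  have D2: "((\<lambda>t. \<epsilon> k \<bullet> snd (\<nu> t)) has_real_derivative - (\<epsilon> k \<bullet> hess z t (fst (\<nu> t)))) (at t within {0..s})"
    if "t \<in> {\<alpha>..\<beta>}" for k t
    using bounded_linear.has_vector_derivative[OF bounded_linear_inner_right variation_components(2)[OF \<nu>], of t "\<epsilon> k"] that sub
    by (auto simp: has_real_derivative_iff_has_vector_derivative)
  have mom: "\<epsilon> k \<bullet> snd (\<nu> t) = 0" if "\<And>t. t \<in> {\<alpha>..\<beta>} \<Longrightarrow> \<epsilon> k \<bullet> fst (\<nu> t) = 0" "t \<in> {\<alpha>..\<beta>}" for k t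
    by (rule zero_derivative_on_subinterval[OF that(1) \<alpha>\<beta>(2) sub that(2) D1[OF that(2)]])
  \<comment> \<open>All particles up to \<open>k\<close> are carried along because the equation of
    particle \<open>k\<close> also involves bond \<open>k - 1\<close>.\<close>
  have pos: "k \<le> n \<Longrightarrow> \<forall>i\<in>{1..k}. \<forall>t\<in>{\<alpha>..\<beta>}. \<epsilon> i \<bullet> fst (\<nu> t) = 0" for k
  proof (induction k)
    case (Suc k)
    show ?case
    proof (cases "k = 0")
      case True
      then show ?thesis using first by simp
    next
      case False
      then have k: "k \<in> {1..<n}" "k \<in> {1..n}" using Suc.prems by auto
      have IH: "\<epsilon> i \<bullet> fst (\<nu> t) = 0" if "i \<in> {1..k}" "t \<in> {\<alpha>..\<beta>}" for i t
        using Suc that by simp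
      have "\<epsilon> (Suc k) \<bullet> fst (\<nu> t) = 0" if t: "t \<in> {\<alpha>..\<beta>}" for t
      proof -
        \<comment> \<open>Differentiating the vanishing component \<open>k\<close> twice leaves a
          relation between bonds \<open>k - 1\<close> and \<open>k\<close> alone.\<close>
        have "- (\<epsilon> k \<bullet> hess z t (fst (\<nu> t))) = 0"
          using IH[of k] k by (intro zero_derivative_on_subinterval[OF mom \<alpha>\<beta>(2) sub t D2[OF t]]) auto
        then have "\<psi>' (bond k \<bullet> fst (z t)) * (bond k \<bullet> fst (\<nu> t))
            = (if 1 < k then \<psi>' (bond (k - 1) \<bullet> fst (z t)) * (bond (k - 1) \<bullet> fst (\<nu> t)) else 0)"
          unfolding hess_def inner_chain[OF k(2)] using k(1) by simp
        also have "\<dots> = 0"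
          using IH[of k t] IH[of "k - 1" t] t by (auto simp: inner_bond)
        finally show ?thesis
          using active[OF k(1) t] IH[of k t] t k by (simp add: inner_bond)
      qed
      then show ?thesis using IH by (auto simp: le_Suc_eq)
    qed
  qed simp
  have \<alpha>: "\<alpha> \<in> {\<alpha>..\<beta>}" using \<alpha>\<beta> by simp
  have "fst (\<nu> \<alpha>) = 0" "snd (\<nu> \<alpha>) = 0"
    using pos[of n] mom[OF _ \<alpha>] \<alpha> by (auto intro!: complete)
  then have init: "\<nu> \<alpha> = 0" by (simp add: prod_eq_iff)
  \<comment> \<open>The active interval may end before \<open>s\<close>; the zero state at \<alpha>
    is propagated to \<open>s\<close> by Gronwall's inequality.\<close>
  have "norm (\<nu> s) \<le> 2 * (norm (\<nu> \<alpha>) + 0 * (s - \<alpha>)) * exp (2 * (1 + 4 * real n * L) * (s - \<alpha>))"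
  proof (rule gronwall[where y' = "\<lambda>t. (snd (\<nu> t), - hess z t (fst (\<nu> t)))" and b = s])
    fix t assume t: "t \<in> {\<alpha>..s}"
    have "(\<nu> has_vector_derivative (snd (\<nu> t), - hess z t (fst (\<nu> t)))) (at t within {0..s})"
      using \<nu> t \<alpha>\<beta> by (auto simp: variation_def)
    then show "(\<nu> has_vector_derivative (snd (\<nu> t), - hess z t (fst (\<nu> t)))) (at t within {\<alpha>..s})"
      by (rule has_vector_derivative_within_subset) (use \<alpha>\<beta> in auto)
    show "norm (snd (\<nu> t), - hess z t (fst (\<nu> t))) \<le> (1 + 4 * real n * L) * norm (\<nu> t) + 0"
      using variation_rhs_lipschitz[of "\<nu> t" 0 0 z t 0] hess_scaleR[of z t 0 0] by (simp add: zero_prod_def[symmetric])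
  qed (use \<alpha>\<beta> L_nonneg in auto)
  then show ?thesis using init by simp
qed

text \<open>Duality: the reachable end points form a subspace, and a vector orthogonal to it yields
  the final value of an adjoint solution, which has to vanish. Testing with ramps is enough, since
  their switching times produce all tail integrals.\<close>

lemma linearisation_controllable:
  assumes z: "motion w s z" and \<alpha>\<beta>: "0 \<le> \<alpha>" "\<alpha> < \<beta>" "\<beta> \<le> s"
    and active: "\<And>k t. k \<in> {1..<n} \<Longrightarrow> t \<in> {\<alpha>..\<beta>} \<Longrightarrow> \<psi>' (bond k \<bullet> fst (z t)) \<noteq> 0"
  shows "\<exists>\<omega> \<xi>. piecewise_affine \<omega> \<and> \<omega> 0 = 0 \<and> variation z \<omega> s \<xi> \<and> \<xi> 0 = 0 \<and> \<xi> s + (0, \<omega> s *\<^sub>R \<epsilon> 1) = x"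
proof -
  define R where "R = {\<xi> s + (0, \<omega> s *\<^sub>R \<epsilon> 1) | \<omega> \<xi>. piecewise_affine \<omega> \<and> \<omega> 0 = 0 \<and> variation z \<omega> s \<xi> \<and> \<xi> 0 = 0}"
  have R_I: "\<xi> s + (0, \<omega> s *\<^sub>R \<epsilon> 1) \<in> R"
    if "piecewise_affine \<omega>" "\<omega> 0 = 0" "variation z \<omega> s \<xi>" "\<xi> 0 = 0" for \<omega> \<xi>
    using that unfolding R_def by blast
  have s: "0 < s" using \<alpha>\<beta> by simp
  have comb: "c *\<^sub>R x + d *\<^sub>R y \<in> R" if x: "x \<in> R" and y: "y \<in> R" for c d x y
  proof -
    obtain \<omega>1 \<xi>1 where 1: "piecewise_affine \<omega>1" "\<omega>1 0 = 0" "variation z \<omega>1 s \<xi>1" "\<xi>1 0 = 0" "x = \<xi>1 s + (0, \<omega>1 s *\<^sub>R \<epsilon> 1)"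
      using x unfolding R_def by blast
    obtain \<omega>2 \<xi>2 where 2: "piecewise_affine \<omega>2" "\<omega>2 0 = 0" "variation z \<omega>2 s \<xi>2" "\<xi>2 0 = 0" "y = \<xi>2 s + (0, \<omega>2 s *\<^sub>R \<epsilon> 1)"
      using y unfolding R_def by blast
    \<comment> \<open>A sum over the two Boolean values specialises
      \<open>variation_superpose\<close> to two terms.\<close>
    have "variation z (\<lambda>t. \<Sum>b\<in>UNIV. (if b then c else d) * (if b then \<omega>1 else \<omega>2) t) s
        (\<lambda>t. \<Sum>b\<in>UNIV. (if b then c else d) *\<^sub>R (if b then \<xi>1 else \<xi>2) t)"
      by (rule variation_superpose) (use 1 2 in auto)
    then have "variation z (\<lambda>t. c * \<omega>1 t + d * \<omega>2 t) s (\<lambda>t. c *\<^sub>R \<xi>1 t + d *\<^sub>R \<xi>2 t)"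
      by (simp add: UNIV_bool add.commute)
    moreover have "piecewise_affine (\<lambda>t. c * \<omega>1 t + d * \<omega>2 t)"
      by (intro piecewise_affine_add piecewise_affine_scale 1 2)
    ultimately have "(c *\<^sub>R \<xi>1 s + d *\<^sub>R \<xi>2 s) + (0, (c * \<omega>1 s + d * \<omega>2 s) *\<^sub>R \<epsilon> 1) \<in> R"
      using R_I[of "\<lambda>t. c * \<omega>1 t + d * \<omega>2 t" "\<lambda>t. c *\<^sub>R \<xi>1 t + d *\<^sub>R \<xi>2 t"] 1 2 by simp
    moreover have "(c *\<^sub>R \<xi>1 s + d *\<^sub>R \<xi>2 s) + (0, (c * \<omega>1 s + d * \<omega>2 s) *\<^sub>R \<epsilon> 1) = c *\<^sub>R x + d *\<^sub>R y"
      by (simp add: 1(5) 2(5) prod_eq_iff algebra_simps)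
    ultimately show ?thesis by metis
  qed
  have "\<exists>\<xi>. variation z (\<lambda>t. max 0 (t - d)) s \<xi> \<and> \<xi> 0 = 0" for d
    by (rule variation_exists[OF z piecewise_affine_continuous[OF piecewise_affine_ramp] less_imp_le[OF s]]) blast
  then obtain \<xi>0 where \<xi>0: "\<And>d. variation z (\<lambda>t. max 0 (t - d)) s (\<xi>0 d)" "\<And>d. \<xi>0 d 0 = 0"
    by metis
  have ramp: "\<xi>0 d s + (0, (s - d) *\<^sub>R \<epsilon> 1) \<in> R" if "d \<in> {0..s}" for d
    using R_I[OF piecewise_affine_ramp _ \<xi>0(1)[of d] \<xi>0(2)[of d]] that by simp
  have "0 \<in> R"
    using comb[OF ramp ramp, of s s 0 0] s by simp
  then have "subspace R"
    using comb[of _ _ 1 1] comb[of _ 0 _ 0] by (auto simp: subspace_def)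
  have "span R = UNIV"
  proof (rule ccontr)
    assume "span R \<noteq> UNIV"
    then obtain a where a: "a \<noteq> 0" "\<And>x. x \<in> R \<Longrightarrow> a \<bullet> x = 0"
      using span_not_UNIV_orthogonal[of R] by (metis span_base)
    have zero_cont: "continuous_on {0..s} (\<lambda>t. 0)" by simp
    \<comment> \<open>The final value is \<open>a\<close> with components swapped and one sign
      changed, which turns the pairing at time \<open>s\<close> into the inner product with
      \<open>a\<close>.\<close>
    obtain \<nu> where \<nu>: "variation z (\<lambda>t. 0) s \<nu>" "\<nu> s = (snd a, - fst a)"
      by (rule variation_exists_backward[OF z zero_cont less_imp_le[OF s]])
    have "((\<lambda>t. fst (\<nu> t) \<bullet> \<epsilon> 1) has_integral 0) {d..s}" if d: "d \<in> {0..s}" for d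
    proof -
      have "fst (\<nu> s) \<bullet> (snd (\<xi>0 d s) + (s - d) *\<^sub>R \<epsilon> 1) - snd (\<nu> s) \<bullet> fst (\<xi>0 d s)
          = a \<bullet> (\<xi>0 d s + (0, (s - d) *\<^sub>R \<epsilon> 1))"
        by (simp add: \<nu>(2) inner_prod_def)
      with ramp_response[OF z \<nu>(1) \<xi>0(1)[of d] \<xi>0(2)[of d]] a(2)[OF ramp[OF d]] d show ?thesis
        by simp
    qed
    moreover have "continuous_on {0..s} (\<lambda>t. fst (\<nu> t) \<bullet> \<epsilon> 1)"
      by (intro continuous_on_inner continuous_on_fst continuous_on_const variation_continuous[OF \<nu>(1)])
    ultimately have "fst (\<nu> t) \<bullet> \<epsilon> 1 = 0" if "t \<in> {0..s}" for t
      using that s zero_if_tail_integrals_zero[where h = "\<lambda>t. fst (\<nu> t) \<bullet> \<epsilon> 1"] by blast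
    then have "\<nu> s = 0"
      using \<alpha>\<beta> by (intro adjoint_vanishes[OF z \<nu>(1) \<alpha>\<beta> active]) (auto simp: inner_commute)
    with \<nu>(2) a(1) show False
      by (auto simp: prod_eq_iff)
  qed
  then have "x \<in> R"
    using \<open>subspace R\<close> by (simp add: span_eq_iff[THEN iffD2])
  then show ?thesis unfolding R_def by blast
qed

section \<open>Quadratic error of the linearisation and openness of the endpoint map\<close>

lemma taylor_remainder: "\<bar>\<psi> y - \<psi> x - \<psi>' x * (y - x)\<bar> \<le> M * (y - x)\<^sup>2"
proof -
  have *: "\<exists>c. \<bar>c - x\<bar> \<le> \<bar>y - x\<bar> \<and> \<psi> y - \<psi> x = (y - x) * \<psi>' c"
  proof (cases x y rule: linorder_cases)
    case less
    from MVT2[OF this, of \<psi> \<psi>'] deriv obtain c where "x < c" "c < y" "\<psi> y - \<psi> x = (y - x) * \<psi>' c"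
      by blast
    then show ?thesis by (intro exI[of _ c]) auto
  next
    case greater
    from MVT2[OF this, of \<psi> \<psi>'] deriv obtain c where "y < c" "c < x" "\<psi> x - \<psi> y = (x - y) * \<psi>' c"
      by blast
    then show ?thesis by (intro exI[of _ c]) (auto simp: algebra_simps)
  qed auto
  then obtain c where c: "\<bar>c - x\<bar> \<le> \<bar>y - x\<bar>" "\<psi> y - \<psi> x = (y - x) * \<psi>' c" by blast
  have "\<bar>\<psi> y - \<psi> x - \<psi>' x * (y - x)\<bar> = \<bar>\<psi>' c - \<psi>' x\<bar> * \<bar>y - x\<bar>"
    unfolding c(2) by (simp add: abs_mult[symmetric] algebra_simps)
  also have "\<dots> \<le> (M * \<bar>y - x\<bar>) * \<bar>y - x\<bar>"
    using deriv_lipschitz[of c x] mult_left_mono[OF c(1) M_nonneg] by (intro mult_right_mono) auto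
  finally show ?thesis by (simp add: power2_eq_square mult.assoc abs_mult[symmetric])
qed

text \<open>Two errors are kept apart: the quadratic Taylor remainder at the true displacement
  \<open>q - fst (z t)\<close>, and the linear effect of \<open>v\<close> differing from it. When
  \<open>v\<close> is the variation, Gronwall's inequality absorbs the second.\<close>

lemma force_remainder:
  "norm (force \<psi> q - force \<psi> (fst (z t)) + hess z t v)
    \<le> 8 * real n * M * (norm (q - fst (z t)))\<^sup>2 + 4 * real n * L * norm (q - fst (z t) - v)"
proof -
  let ?x = "fst (z t)"
  let ?c = "\<lambda>k. \<psi> (bond k \<bullet> q) - \<psi> (bond k \<bullet> ?x) - \<psi>' (bond k \<bullet> ?x) * (bond k \<bullet> v)"
  have "force \<psi> q - force \<psi> ?x + hess z t v = - (\<Sum>k=1..<n. ?c k *\<^sub>R bond k)"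
    by (simp add: force_def hess_def scaleR_diff_left sum_subtractf)
  also have "norm \<dots> \<le> (\<Sum>k=1..<n. (M * (2 * norm (q - ?x))\<^sup>2 + L * (2 * norm (q - ?x - v))) * 2)"
    unfolding norm_minus_cancel
  proof (rule sum_norm_le)
    fix k assume k: "k \<in> {1..<n}"
    have "?c k = (\<psi> (bond k \<bullet> q) - \<psi> (bond k \<bullet> ?x) - \<psi>' (bond k \<bullet> ?x) * (bond k \<bullet> q - bond k \<bullet> ?x))
        + \<psi>' (bond k \<bullet> ?x) * (bond k \<bullet> (q - ?x - v))"
      by (simp add: inner_diff_right algebra_simps)
    then have "\<bar>?c k\<bar> \<le> \<bar>\<psi> (bond k \<bullet> q) - \<psi> (bond k \<bullet> ?x) - \<psi>' (bond k \<bullet> ?x) * (bond k \<bullet> q - bond k \<bullet> ?x)\<bar>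
        + \<bar>\<psi>' (bond k \<bullet> ?x)\<bar> * \<bar>bond k \<bullet> (q - ?x - v)\<bar>"
      by (metis abs_mult abs_triangle_ineq)
    also have "\<dots> \<le> M * (bond k \<bullet> q - bond k \<bullet> ?x)\<^sup>2 + L * (2 * norm (q - ?x - v))"
      using L_nonneg by (intro add_mono taylor_remainder mult_mono deriv_bound abs_inner_bond_le k) auto
    also have "(bond k \<bullet> q - bond k \<bullet> ?x)\<^sup>2 \<le> (2 * norm (q - ?x))\<^sup>2"
      using abs_inner_bond_le[OF k, of "q - ?x"]
      by (subst abs_le_square_iff[symmetric]) (simp add: inner_diff_right)
    finally have "\<bar>?c k\<bar> \<le> M * (2 * norm (q - ?x))\<^sup>2 + L * (2 * norm (q - ?x - v))"
      using M_nonneg by (simp add: mult_left_mono)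
    then show "norm (?c k *\<^sub>R bond k) \<le> (M * (2 * norm (q - ?x))\<^sup>2 + L * (2 * norm (q - ?x - v))) * 2"
      unfolding norm_scaleR real_norm_def using norm_bond[OF k] L_nonneg M_nonneg by (intro mult_mono) auto
  qed
  also have "\<dots> = real (n - 1) * ((M * (2 * norm (q - ?x))\<^sup>2 + L * (2 * norm (q - ?x - v))) * 2)"
    by simp
  also have "\<dots> \<le> real n * ((M * (2 * norm (q - ?x))\<^sup>2 + L * (2 * norm (q - ?x - v))) * 2)"
    using L_nonneg M_nonneg by (intro mult_right_mono) auto
  finally show ?thesis by (simp add: algebra_simps power2_eq_square)
qed

text \<open>\<open>C\<close> is fixed before the perturbation, so the error is quadratic uniformly;
  this makes the variation the derivative of the end point.\<close>

lemma linearisation_error: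
  obtains C where "0 \<le> C" "\<And>\<omega> z' \<xi> \<kappa>. motion (\<lambda>t. w t + \<omega> t) s z' \<Longrightarrow> z' 0 = z 0 \<Longrightarrow> variation z \<omega> s \<xi> \<Longrightarrow> \<xi> 0 = 0 \<Longrightarrow>
    motion w s z \<Longrightarrow> 0 \<le> s \<Longrightarrow> (\<And>t. t \<in> {0..s} \<Longrightarrow> norm (z' t - z t) \<le> \<kappa>) \<Longrightarrow> norm (z' s - z s - \<xi> s) \<le> C * \<kappa>\<^sup>2"
proof
  let ?C = "2 * (8 * real n * M * \<bar>s\<bar>) * exp (2 * (1 + 4 * real n * L) * s)"
  show "0 \<le> ?C" using M_nonneg by simp
  fix \<omega> z' \<xi> \<kappa>
  assume z': "motion (\<lambda>t. w t + \<omega> t) s z'" "z' 0 = z 0" and \<xi>: "variation z \<omega> s \<xi>" "\<xi> 0 = 0"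
    and z: "motion w s z" and s: "0 \<le> s" and \<kappa>: "\<And>t. t \<in> {0..s} \<Longrightarrow> norm (z' t - z t) \<le> \<kappa>"
  have "0 \<le> \<kappa>" using order.trans[OF norm_ge_zero \<kappa>[of 0]] s by simp
  define D where "D t = z' t - z t - \<xi> t" for t
  let ?D' = "\<lambda>t. (snd (D t), force \<psi> (fst (z' t)) - force \<psi> (fst (z t)) + hess z t (fst (\<xi> t)))"
  have "norm (D s) \<le> 2 * (norm (D 0) + (8 * real n * M * \<kappa>\<^sup>2) * (s - 0)) * exp (2 * (1 + 4 * real n * L) * (s - 0))"
  proof (rule gronwall[where y' = ?D' and b = s])
    fix t assume t: "t \<in> {0..s}"
    have "(D has_vector_derivative (snd (z' t) + (w t + \<omega> t) *\<^sub>R \<epsilon> 1, force \<psi> (fst (z' t)))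
        - (snd (z t) + w t *\<^sub>R \<epsilon> 1, force \<psi> (fst (z t)))
        - (snd (\<xi> t) + \<omega> t *\<^sub>R \<epsilon> 1, - hess z t (fst (\<xi> t)))) (at t within {0..s})"
      unfolding D_def using z' z \<xi> t
      by (intro has_vector_derivative_diff) (auto simp: controlled_path_def variation_def)
    then show "(D has_vector_derivative ?D' t) (at t within {0..s})"
      by (simp add: D_def scaleR_add_left algebra_simps)
    have "norm (?D' t) \<le> norm (snd (D t)) + norm (force \<psi> (fst (z' t)) - force \<psi> (fst (z t)) + hess z t (fst (\<xi> t)))"
      by (rule norm_Pair_le)
    also have "\<dots> \<le> norm (D t) + (8 * real n * M * (norm (fst (z' t) - fst (z t)))\<^sup>2 + 4 * real n * L * norm (fst (z' t) - fst (z t) - fst (\<xi> t)))"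
      by (intro add_mono norm_snd_bound force_remainder)
    also have "\<dots> \<le> norm (D t) + (8 * real n * M * \<kappa>\<^sup>2 + 4 * real n * L * norm (D t))"
    proof (intro add_left_mono add_mono mult_left_mono power_mono)
      show "norm (fst (z' t) - fst (z t)) \<le> \<kappa>"
        using norm_fst_bound[of "z' t - z t"] \<kappa>[OF t] by simp
      show "norm (fst (z' t) - fst (z t) - fst (\<xi> t)) \<le> norm (D t)"
        using norm_fst_bound[of "D t"] by (simp add: D_def)
    qed (use L_nonneg M_nonneg in auto)
    finally show "norm (?D' t) \<le> (1 + 4 * real n * L) * norm (D t) + 8 * real n * M * \<kappa>\<^sup>2"
      by (simp add: algebra_simps)
  qed (use s L_nonneg M_nonneg in auto)
  then show "norm (z' s - z s - \<xi> s) \<le> ?C * \<kappa>\<^sup>2"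
    using z'(2) \<xi>(2) s by (simp add: D_def algebra_simps)
qed

text \<open>One control variation per basis vector gives a finite-dimensional family of controls
  whose endpoint map has the identity as derivative at 0. \<open>sussmann_open_mapping\<close> works
  from continuity and the derivative at this one point.\<close>

lemma endpoint_interior:
  assumes w: "piecewise_affine w" and z: "motion w s z" and \<alpha>\<beta>: "0 \<le> \<alpha>" "\<alpha> < \<beta>" "\<beta> \<le> s"
    and active: "\<And>k t. k \<in> {1..<n} \<Longrightarrow> t \<in> {\<alpha>..\<beta>} \<Longrightarrow> \<psi>' (bond k \<bullet> fst (z t)) \<noteq> 0"
    and "0 < \<delta>"
  shows "z s + (0, w s *\<^sub>R \<epsilon> 1) \<in> interior {z' s + (0, w' s *\<^sub>R \<epsilon> 1) | w' z'. piecewise_affine w' \<and> w' 0 = w 0 \<and>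
    motion w' s z' \<and> z' 0 = z 0 \<and> (\<forall>t\<in>{0..s}. \<bar>w' t - w t\<bar> \<le> \<delta> \<and> norm (z' t - z t) \<le> \<delta>)}"
proof -
  have s: "0 \<le> s" using \<alpha>\<beta> by simp
  have "\<forall>b. \<exists>\<omega> \<xi>. piecewise_affine \<omega> \<and> \<omega> 0 = 0 \<and> variation z \<omega> s \<xi> \<and> \<xi> 0 = 0 \<and> \<xi> s + (0, \<omega> s *\<^sub>R \<epsilon> 1) = b"
    using linearisation_controllable[OF z \<alpha>\<beta> active] by blast
  then obtain \<omega> \<xi> where \<omega>: "\<And>b. piecewise_affine (\<omega> b)" "\<And>b. \<omega> b 0 = 0"
    and \<xi>: "\<And>b. variation z (\<omega> b) s (\<xi> b)" "\<And>b. \<xi> b 0 = 0" "\<And>b. \<xi> b s + (0, \<omega> b s *\<^sub>R \<epsilon> 1) = b"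
    by metis
  \<comment> \<open>Superpositions weighted by the coordinates of \<open>h\<close>: the linearised
    end point, with the momentum shift restored, is \<open>h\<close> itself.\<close>
  define W where "W h t = (\<Sum>b\<in>Basis. (h \<bullet> b) * \<omega> b t)" for h :: "'v \<times> 'v" and t
  define \<Xi> where "\<Xi> h t = (\<Sum>b\<in>Basis. (h \<bullet> b) *\<^sub>R \<xi> b t)" for h :: "'v \<times> 'v" and t
  have W_pa: "piecewise_affine (W h)" for h
    unfolding W_def by (intro piecewise_affine_sum piecewise_affine_scale \<omega>)
  have W_0: "W h 0 = 0" for h by (simp add: W_def \<omega>)
  have W_diff: "W h t - W h' t = W (h - h') t" for h h' t
    by (simp add: W_def inner_diff_left left_diff_distrib sum_subtractf)
  have \<Xi>: "variation z (W h) s (\<Xi> h)" "\<Xi> h 0 = 0" for h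
    using variation_superpose[of Basis z \<omega> s \<xi> "\<lambda>b. h \<bullet> b"] \<xi> by (simp_all add: W_def[abs_def] \<Xi>_def[abs_def])
  have \<Xi>_end: "\<Xi> h s + (0, W h s *\<^sub>R \<epsilon> 1) = h" for h
  proof -
    have "\<Xi> h s + (0, W h s *\<^sub>R \<epsilon> 1) = (\<Sum>b\<in>Basis. (h \<bullet> b) *\<^sub>R (\<xi> b s + (0, \<omega> b s *\<^sub>R \<epsilon> 1)))"
      by (rule prod_eqI) (simp_all add: \<Xi>_def W_def fst_sum snd_sum scaleR_add_right sum.distrib scaleR_sum_left)
    then show ?thesis by (simp only: \<xi>(3) euclidean_representation)
  qed
  have "\<exists>c. \<forall>t\<in>{0..s}. \<bar>\<omega> b t\<bar> \<le> c" for b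
    using compact_imp_bounded[OF compact_continuous_image[OF piecewise_affine_continuous[OF \<omega>(1)[of b]] compact_Icc[of 0 s]]]
    by (auto simp: bounded_iff)
  then obtain c where c: "\<And>b t. t \<in> {0..s} \<Longrightarrow> \<bar>\<omega> b t\<bar> \<le> c b" by metis
  define K where "K = (\<Sum>b\<in>(Basis :: ('v \<times> 'v) set). c b)"
  have c_nonneg: "0 \<le> c b" for b using c[of 0 b] s by (simp add: \<omega>)
  then have K: "0 \<le> K" unfolding K_def by (intro sum_nonneg)
  have W_le: "\<bar>W h t\<bar> \<le> K * norm h" if "t \<in> {0..s}" for h t
  proof -
    have "\<bar>W h t\<bar> \<le> (\<Sum>b\<in>Basis. \<bar>(h \<bullet> b) * \<omega> b t\<bar>)"
      unfolding W_def by (rule sum_abs)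
    also have "\<dots> \<le> (\<Sum>b\<in>Basis. norm h * c b)"
      unfolding abs_mult using that by (intro sum_mono mult_mono c Basis_le_norm) auto
    finally show ?thesis by (simp add: K_def sum_distrib_left mult.commute)
  qed
  have "\<exists>z'. motion (\<lambda>t. w t + W h t) s z' \<and> z' 0 = z 0" for h
    by (rule path_exists[OF piecewise_affine_continuous[OF piecewise_affine_add[OF w W_pa]] s]) blast
  then obtain Z where Z: "\<And>h. motion (\<lambda>t. w t + W h t) s (Z h)" "\<And>h. Z h 0 = z 0"
    by metis
  obtain C where C: "0 \<le> C" "\<And>w w' z z' \<delta> t. motion w s z \<Longrightarrow> motion w' s z' \<Longrightarrow> z 0 = z' 0 \<Longrightarrow>
      (\<And>t. t \<in> {0..s} \<Longrightarrow> \<bar>w t - w' t\<bar> \<le> \<delta>) \<Longrightarrow> t \<in> {0..s} \<Longrightarrow> norm (z t - z' t) \<le> C * \<delta>"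
    using path_lipschitz by blast
  have ZZ: "norm (Z h t - Z h' t) \<le> C * (K * norm (h - h'))" if "t \<in> {0..s}" for h h' t
    by (rule C(2)[OF Z(1) Z(1)]) (use Z W_le that in \<open>auto simp: W_diff\<close>)
  have Zz: "norm (Z h t - z t) \<le> C * (K * norm h)" if "t \<in> {0..s}" for h t
    by (rule C(2)[OF Z(1) z]) (use Z W_le that in auto)
  obtain B where B: "0 \<le> B" "\<And>\<omega> z' \<xi> \<kappa>. motion (\<lambda>t. w t + \<omega> t) s z' \<Longrightarrow> z' 0 = z 0 \<Longrightarrow> variation z \<omega> s \<xi> \<Longrightarrow> \<xi> 0 = 0 \<Longrightarrow>
    motion w s z \<Longrightarrow> 0 \<le> s \<Longrightarrow> (\<And>t. t \<in> {0..s} \<Longrightarrow> norm (z' t - z t) \<le> \<kappa>) \<Longrightarrow> norm (z' s - z s - \<xi> s) \<le> B * \<kappa>\<^sup>2"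
    using linearisation_error[of w s z] by blast
  define E where "E h = Z h s + (0, (w s + W h s) *\<^sub>R \<epsilon> 1)" for h
  have end_s: "s \<in> {0..s}" using s by simp
  have E_0: "E 0 = z s + (0, w s *\<^sub>R \<epsilon> 1)"
    using Zz[OF end_s, of 0] by (simp add: E_def W_def)
  have E_cont: "continuous_on UNIV E"
  proof (rule lipschitz_on_continuous_on)
    show "(C * K + K)-lipschitz_on UNIV E"
    proof (rule lipschitz_onI)
      fix h h' :: "'v \<times> 'v"
      have "E h - E h' = (Z h s - Z h' s) + (0, W (h - h') s *\<^sub>R \<epsilon> 1)"
        by (simp add: E_def W_diff[symmetric] algebra_simps)
      also have "norm \<dots> \<le> C * (K * norm (h - h')) + K * norm (h - h')"
        using ZZ[OF end_s, of h h'] W_le[OF end_s, of "h - h'"] norm_unit[of 1] two_le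
        by (intro order.trans[OF norm_triangle_ineq] add_mono) (auto simp: norm_Pair)
      finally show "dist (E h) (E h') \<le> (C * K + K) * dist h h'"
        by (simp add: dist_norm algebra_simps)
    qed (use C(1) K in simp)
  qed
  have E_deriv: "(E has_derivative (\<lambda>h. h)) (at 0)"
  \<comment> \<open>The error bound holds for every \<open>h\<close>, so the radius 1 is
    arbitrary.\<close>
  proof (rule has_derivativeI_sandwich[where e = 1 and H = "\<lambda>h. B * (C * K)\<^sup>2 * norm h"])
    fix h :: "'v \<times> 'v"
    have "E h - E 0 - (h - 0) = Z h s - z s - \<Xi> h s"
      using \<Xi>_end[of h] unfolding E_0 by (simp add: E_def prod_eq_iff algebra_simps)
    also have "norm \<dots> \<le> B * (C * (K * norm h))\<^sup>2"
      by (rule B(2)[OF Z(1,2) \<Xi> z s Zz])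
    also have "\<dots> = B * (C * K)\<^sup>2 * norm h * norm h"
      by (simp add: power2_eq_square algebra_simps)
    finally show "norm (E h - E 0 - (h - 0)) / norm (h - 0) \<le> B * (C * K)\<^sup>2 * norm h" if "h \<noteq> 0"
      using that by (simp add: pos_divide_le_eq)
    show "((\<lambda>h. B * (C * K)\<^sup>2 * norm h) \<longlongrightarrow> 0) (at 0)"
      by (auto intro!: tendsto_eq_intros)
  qed (auto intro: bounded_linear_ident)
  \<comment> \<open>Chosen so that on the ball both \<open>K * norm h\<close>, bounding the control
    change, and \<open>C * (K * norm h)\<close>, bounding the path change, stay within
    \<delta>.\<close>
  define r where "r = \<delta> / (C * K + K + 1)"
  have CK: "0 \<le> C * K" using C(1) K by simp
  have r: "0 < r" using \<open>0 < \<delta>\<close> CK K by (simp add: r_def)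
  have r_le: "(C * K + K + 1) * r = \<delta>"
    using CK K by (simp add: r_def)
  let ?S = "{z' s + (0, w' s *\<^sub>R \<epsilon> 1) | w' z'. piecewise_affine w' \<and> w' 0 = w 0 \<and>
    motion w' s z' \<and> z' 0 = z 0 \<and> (\<forall>t\<in>{0..s}. \<bar>w' t - w t\<bar> \<le> \<delta> \<and> norm (z' t - z t) \<le> \<delta>)}"
  have "E ` ball 0 r \<subseteq> ?S"
  proof
    fix x assume "x \<in> E ` ball 0 r"
    then obtain h where h: "norm h < r" "x = E h" by auto
    have small: "K * norm h \<le> \<delta>" "C * (K * norm h) \<le> \<delta>"
    proof -
      have *: "(C * K + K + 1) * norm h \<le> \<delta>"
        unfolding r_le[symmetric] using h(1) CK K by (intro mult_left_mono) auto
      have "0 \<le> C * K * norm h" "0 \<le> K * norm h" using CK K by simp_all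
      with * show "K * norm h \<le> \<delta>" "C * (K * norm h) \<le> \<delta>"
        by (simp_all add: algebra_simps) (use norm_ge_zero[of h] in linarith)+
    qed
    have "\<forall>t\<in>{0..s}. \<bar>(w t + W h t) - w t\<bar> \<le> \<delta> \<and> norm (Z h t - z t) \<le> \<delta>"
      using order.trans[OF W_le small(1)] order.trans[OF Zz small(2)] by simp
    then show "x \<in> ?S"
      using piecewise_affine_add[OF w W_pa[of h]] W_0[of h] Z[of h] unfolding h(2) E_def
      by (intro CollectI exI[of _ "\<lambda>t. w t + W h t"] exI[of _ "Z h"]) simp
  qed
  moreover have "E 0 \<in> interior (E ` ball 0 r)"
    by (rule sussmann_open_mapping[OF open_UNIV E_cont UNIV_I E_deriv bounded_linear_ident])
      (use r in \<open>auto simp: interior_open\<close>)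
  ultimately show ?thesis
    unfolding E_0 using interior_mono by blast
qed

text \<open>The given motion may be degenerate, so an interior point is obtained only near its end
  point: half of \<delta> activates all \<open>n - 1\<close> bonds, the other half goes into the
  open mapping argument.\<close>

lemma perturbed_endpoints:
  assumes w: "piecewise_affine w" and z: "motion w s z" and "0 < s" "0 < \<delta>"
  obtains y where "norm (y - (z s + (0, w s *\<^sub>R \<epsilon> 1))) \<le> \<delta>"
    "y \<in> interior {z' s + (0, w' s *\<^sub>R \<epsilon> 1) | w' z'. piecewise_affine w' \<and> w' 0 = w 0 \<and>
      motion w' s z' \<and> z' 0 = z 0 \<and> (\<forall>t\<in>{0..s}. norm (z' t - z t) \<le> \<delta>)}"
proof -
  have "n - 1 < n" "0 < \<delta> / 2" using two_le \<open>0 < \<delta>\<close> by auto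
  from activate_bonds[OF w z \<open>0 < s\<close> this]
  obtain w1 z1 \<alpha> \<beta> where w1: "piecewise_affine w1" "w1 0 = w 0" and z1: "motion w1 s z1" "z1 0 = z 0"
    and near: "\<And>t. t \<in> {0..s} \<Longrightarrow> \<bar>w1 t - w t\<bar> \<le> \<delta> / 2 \<and> norm (z1 t - z t) \<le> \<delta> / 2"
    and \<alpha>\<beta>: "0 \<le> \<alpha>" "\<alpha> < \<beta>" "\<beta> \<le> s"
    and active: "\<And>k t. k \<in> {1..n - 1} \<Longrightarrow> t \<in> {\<alpha>..\<beta>} \<Longrightarrow> \<psi>' (bond k \<bullet> fst (z1 t)) \<noteq> 0"
    by blast
  have active': "\<psi>' (bond k \<bullet> fst (z1 t)) \<noteq> 0" if "k \<in> {1..<n}" "t \<in> {\<alpha>..\<beta>}" for k t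
    using that by (intro active) auto
  note int = endpoint_interior[OF w1(1) z1(1) \<alpha>\<beta> active' \<open>0 < \<delta> / 2\<close>]
  show ?thesis
  proof (rule that)
    have "z1 s + (0, w1 s *\<^sub>R \<epsilon> 1) - (z s + (0, w s *\<^sub>R \<epsilon> 1)) = (z1 s - z s) + (0, (w1 s - w s) *\<^sub>R \<epsilon> 1)"
      by (rule prod_eqI) (simp_all add: scaleR_diff_left)
    also have "norm \<dots> \<le> norm (z1 s - z s) + \<bar>w1 s - w s\<bar>"
      using norm_unit[of 1] two_le by (intro order.trans[OF norm_triangle_ineq]) (simp add: norm_Pair)
    finally show "norm (z1 s + (0, w1 s *\<^sub>R \<epsilon> 1) - (z s + (0, w s *\<^sub>R \<epsilon> 1))) \<le> \<delta>"
      using near[of s] \<open>0 < s\<close> by simp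
    have "norm (z' t - z t) \<le> \<delta>" if "norm (z' t - z1 t) \<le> \<delta> / 2" "t \<in> {0..s}" for z' t
      using norm_triangle_ineq[of "z' t - z1 t" "z1 t - z t"] that(1) near[OF that(2)] by simp
    then show "z1 s + (0, w1 s *\<^sub>R \<epsilon> 1) \<in> interior {z' s + (0, w' s *\<^sub>R \<epsilon> 1) | w' z'. piecewise_affine w' \<and> w' 0 = w 0 \<and>
      motion w' s z' \<and> z' 0 = z 0 \<and> (\<forall>t\<in>{0..s}. norm (z' t - z t) \<le> \<delta>)}"
      using w1(2) z1(2) by (intro subsetD[OF interior_mono int]) force
  qed
qed

end

section \<open>From globally Lipschitz forces to potentials\<close>

text \<open>The consequences of analyticity and growth are recorded in a form invariant under
  reflection of the argument, so that the chain read from its other end is an instance too; growth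
  at +infinity is not invariant.\<close>

locale potential_chain = chain \<epsilon> n for \<epsilon> :: "nat \<Rightarrow> 'v::euclidean_space" and n +
  fixes \<Phi> \<phi> \<phi>' \<phi>'' :: "real \<Rightarrow> real" and m :: real
  assumes potential: "(\<Phi> has_real_derivative \<phi> y) (at y)"
    and deriv1: "(\<phi> has_real_derivative \<phi>' y) (at y)"
    and deriv2: "(\<phi>' has_real_derivative \<phi>'' y) (at y)"
    and continuous_deriv2: "continuous_on UNIV \<phi>''"
    and bounded_below: "m \<le> \<Phi> y"
    and deriv1_nonzero: "u < v \<Longrightarrow> \<exists>y. u < y \<and> y < v \<and> \<phi>' y \<noteq> 0"
begin

text \<open>Outside \<open>[A, B]\<close> the interaction is continued affinely; choosing \<open>\<phi>' A\<close> and \<open>\<phi>' B\<close> nonzero keeps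
  the derivative from vanishing on an interval.\<close>

lemma truncation:
  obtains \<psi> \<psi>' L M where "smooth_chain \<epsilon> n \<psi> \<psi>' L M" "\<And>y. \<bar>y\<bar> \<le> R \<Longrightarrow> \<psi> y = \<phi> y"
proof -
  obtain A where A: "- \<bar>R\<bar> - 2 < A" "A < - \<bar>R\<bar> - 1" "\<phi>' A \<noteq> 0"
    using deriv1_nonzero[of "- \<bar>R\<bar> - 2" "- \<bar>R\<bar> - 1"] by auto
  obtain B where B: "\<bar>R\<bar> + 1 < B" "B < \<bar>R\<bar> + 2" "\<phi>' B \<noteq> 0"
    using deriv1_nonzero[of "\<bar>R\<bar> + 1" "\<bar>R\<bar> + 2"] by auto
  have "A < B" using A B by linarith
  define clip where "clip y = max A (min B y)" for y
  have clip: "clip y \<in> {A..B}" for y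
    using \<open>A < B\<close> by (auto simp: clip_def)
  have clip_lipschitz: "\<bar>clip x - clip y\<bar> \<le> \<bar>x - y\<bar>" for x y
    by (simp add: clip_def max_def min_def)
  have cont1: "continuous_on S \<phi>'" for S
    using deriv2 by (meson DERIV_continuous_on has_field_derivative_at_within)
  have bound: "\<exists>c. \<forall>y\<in>{A..B}. \<bar>h y\<bar> \<le> c" if "continuous_on {A..B} h" for h :: "real \<Rightarrow> real"
    using compact_imp_bounded[OF compact_continuous_image[OF that compact_Icc]] by (auto simp: bounded_iff)
  obtain L where L: "\<And>y. y \<in> {A..B} \<Longrightarrow> \<bar>\<phi>' y\<bar> \<le> L"
    using bound[OF cont1] by blast
  obtain M where M: "\<And>y. y \<in> {A..B} \<Longrightarrow> \<bar>\<phi>'' y\<bar> \<le> M"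
    using bound[OF continuous_on_subset[OF continuous_deriv2 subset_UNIV]] by blast
  have "0 \<le> M" using M[of A] \<open>A < B\<close> by auto
  have lip: "\<bar>\<phi>' x - \<phi>' y\<bar> \<le> M * \<bar>x - y\<bar>" if "x \<in> {A..B}" "y \<in> {A..B}" for x y
    using field_differentiable_bound[of "{A..B}" \<phi>' \<phi>'' M x y] that M has_field_derivative_at_within[OF deriv2]
    by simp
  \<comment> \<open>Clipping is applied to the argument of the derivative, which makes \<psi>'
    bounded and Lipschitz on the whole line; \<psi> is recovered as its antiderivative, normalised
    at \<open>A\<close>.\<close>
  define \<psi>' where "\<psi>' y = \<phi>' (clip y)" for y
  have "isCont \<psi>' y" for y
  proof -
    have "continuous_on UNIV \<psi>'"
      unfolding \<psi>'_def clip_def by (intro continuous_on_compose2[OF cont1[of UNIV]] continuous_intros) auto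
    then show ?thesis by (simp add: continuous_on_eq_continuous_at)
  qed
  then have "\<exists>F. \<forall>x. (F has_vector_derivative \<psi>' x) (at x)"
    using einterval_antiderivative[of "-\<infinity>" "\<infinity>" \<psi>'] by auto
  then obtain F where F: "\<And>x. (F has_real_derivative \<psi>' x) (at x)"
    by (auto simp: has_real_derivative_iff_has_vector_derivative)
  define \<psi> where "\<psi> y = F y - F A + \<phi> A" for y
  have \<psi>_deriv: "(\<psi> has_real_derivative \<psi>' y) (at y)" for y
    unfolding \<psi>_def by (auto intro!: derivative_eq_intros F)
  have \<psi>_eq: "\<psi> y = \<phi> y" if "y \<in> {A..B}" for y
  proof -
    have "((\<lambda>y. \<psi> y - \<phi> y) has_real_derivative \<psi>' x - \<phi>' x) (at x)" for x
      by (intro DERIV_diff \<psi>_deriv deriv1)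
    then have d: "((\<lambda>y. \<psi> y - \<phi> y) has_real_derivative 0) (at x)" if "x \<in> {A..B}" for x
      using that by (metis \<psi>'_def atLeastAtMost_iff clip_def diff_self max.absorb2 min.absorb2)
    have "\<exists>c. \<forall>y\<in>{A..B}. \<psi> y - \<phi> y = c"
      by (rule has_field_derivative_zero_constant) (use d in \<open>auto intro: has_field_derivative_at_within\<close>)
    then have "\<psi> y - \<phi> y = \<psi> A - \<phi> A" using that \<open>A < B\<close> by auto
    then show ?thesis by (simp add: \<psi>_def)
  qed
  have "smooth_chain \<epsilon> n \<psi> \<psi>' L M"
  proof
    show "(\<psi> has_real_derivative \<psi>' y) (at y)" for y by (rule \<psi>_deriv)
    show "\<bar>\<psi>' y\<bar> \<le> L" for y unfolding \<psi>'_def by (rule L[OF clip])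
    show "\<bar>\<psi>' x - \<psi>' y\<bar> \<le> M * \<bar>x - y\<bar>" for x y
      unfolding \<psi>'_def using order.trans[OF lip[OF clip clip] mult_left_mono[OF clip_lipschitz \<open>0 \<le> M\<close>]] .
    show "\<exists>y. u < y \<and> y < v \<and> \<psi>' y \<noteq> 0" if "u < v" for u v
    proof -
      consider "v \<le> A" | "B \<le> u" | "max u A < min v B"
        using \<open>u < v\<close> \<open>A < B\<close> by linarith
      then show ?thesis
      proof cases
        case 1
        then have "clip ((u + v) / 2) = A" using \<open>u < v\<close> \<open>A < B\<close> by (simp add: clip_def)
        then show ?thesis using \<open>u < v\<close> A(3) by (intro exI[of _ "(u + v) / 2"]) (simp add: \<psi>'_def)
      next
        case 2
        then have "clip ((u + v) / 2) = B" using \<open>u < v\<close> \<open>A < B\<close> by (simp add: clip_def)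
        then show ?thesis using \<open>u < v\<close> B(3) by (intro exI[of _ "(u + v) / 2"]) (simp add: \<psi>'_def)
      next
        case 3
        from deriv1_nonzero[OF this] obtain y where y: "max u A < y" "y < min v B" "\<phi>' y \<noteq> 0" by blast
        then have "clip y = y" by (simp add: clip_def)
        with y show ?thesis by (intro exI[of _ y]) (simp add: \<psi>'_def)
      qed
    qed
  qed
  moreover have "\<psi> y = \<phi> y" if "\<bar>y\<bar> \<le> R" for y
    using that A B by (intro \<psi>_eq) auto
  ultimately show ?thesis by (rule that)
qed

lemma force_cong:
  "(\<And>k. k \<in> {1..<n} \<Longrightarrow> \<psi> (bond k \<bullet> q) = \<phi> (bond k \<bullet> q)) \<Longrightarrow> force \<psi> q = force \<phi> q"
  by (simp add: force_def)

section \<open>Conservation of energy and completeness of the drift\<close>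

definition energy :: "'v \<times> 'v \<Rightarrow> real" where
  "energy x = (snd x \<bullet> snd x) / 2 + (\<Sum>k=1..<n. \<Phi> (bond k \<bullet> fst x))"

text \<open>The potential energy is at least \<open>real (n - 1) * m\<close>, so the energy alone
  bounds the speed, and thereby how far the particles travel in a given time.\<close>

lemma norm_momentum_le: "norm (snd x) \<le> sqrt (2 * (energy x - real (n - 1) * m))"
proof (rule real_le_rsqrt)
  have "(\<Sum>k=1..<n. m) \<le> (\<Sum>k=1..<n. \<Phi> (bond k \<bullet> fst x))"
    by (intro sum_mono bounded_below)
  then show "(norm (snd x))\<^sup>2 \<le> 2 * (energy x - real (n - 1) * m)"
    by (simp add: energy_def power2_norm_eq_inner)
qed

lemma energy_derivative:
  assumes "(z has_vector_derivative (snd (z t), force \<phi> (fst (z t)))) (at t)"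
  shows "((\<lambda>t. energy (z t)) has_real_derivative 0) (at t)"
proof -
  have q: "((\<lambda>t. fst (z t)) has_vector_derivative snd (z t)) (at t)"
    using bounded_linear.has_vector_derivative[OF bounded_linear_fst assms] by simp
  have p: "((\<lambda>t. snd (z t)) has_vector_derivative force \<phi> (fst (z t))) (at t)"
    using bounded_linear.has_vector_derivative[OF bounded_linear_snd assms] by simp
  have "((\<lambda>t. snd (z t) \<bullet> snd (z t)) has_real_derivative
      snd (z t) \<bullet> force \<phi> (fst (z t)) + force \<phi> (fst (z t)) \<bullet> snd (z t)) (at t)"
    using bounded_bilinear.has_vector_derivative[OF bounded_bilinear_inner p p]
    by (simp add: has_real_derivative_iff_has_vector_derivative)
  moreover have "((\<lambda>t. \<Phi> (bond k \<bullet> fst (z t))) has_real_derivative \<phi> (bond k \<bullet> fst (z t)) * (bond k \<bullet> snd (z t))) (at t)" for k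
  proof -
    have "((\<lambda>t. bond k \<bullet> fst (z t)) has_real_derivative bond k \<bullet> snd (z t)) (at t)"
      using bounded_linear.has_vector_derivative[OF bounded_linear_inner_right q]
      by (simp add: has_real_derivative_iff_has_vector_derivative)
    from DERIV_chain2[OF potential this] show ?thesis .
  qed
  ultimately have "((\<lambda>t. energy (z t)) has_real_derivative
      (snd (z t) \<bullet> force \<phi> (fst (z t)) + force \<phi> (fst (z t)) \<bullet> snd (z t)) / 2
      + (\<Sum>k=1..<n. \<phi> (bond k \<bullet> fst (z t)) * (bond k \<bullet> snd (z t)))) (at t)"
    unfolding energy_def by (intro DERIV_add DERIV_sum DERIV_cdivide)
  moreover have "force \<phi> (fst (z t)) \<bullet> snd (z t) = - (\<Sum>k=1..<n. \<phi> (bond k \<bullet> fst (z t)) * (bond k \<bullet> snd (z t)))"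
    by (simp add: force_def inner_sum_left)
  ultimately show ?thesis
    by (simp add: inner_commute)
qed

text \<open>A truncated solution cannot leave the region where the truncation is exact: up to the
  first exit time it obeys the true equation, so conserved energy keeps the displacement too small
  for an exit.\<close>

lemma free_path_exists:
  assumes "0 < T"
  obtains z where "controlled_path (force \<phi>) (\<epsilon> 1) (\<lambda>t. 0) T z" "z 0 = x"
proof -
  define c where "c = sqrt (2 * (energy x - real (n - 1) * m))"
  have "0 \<le> c" using order.trans[OF norm_ge_zero norm_momentum_le[of x]] by (simp add: c_def)
  \<comment> \<open>Positions stay within \<open>norm (fst x) + c * T\<close>; the factor 2 passes
    to bond lengths, and the summand 1 makes the contradiction at the exit time strict.\<close>
  define R where "R = 2 * (norm (fst x) + c * T) + 1"
  obtain \<psi> \<psi>' L M where "smooth_chain \<epsilon> n \<psi> \<psi>' L M" and \<psi>: "\<And>y. \<bar>y\<bar> \<le> R \<Longrightarrow> \<psi> y = \<phi> y"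
    by (rule truncation[of R]) blast
  then interpret smooth_chain \<epsilon> n \<psi> \<psi>' L M by simp
  have "continuous_on {0..T} (\<lambda>t::real. 0 :: real)" by simp
  from path_exists[OF this less_imp_le[OF \<open>0 < T\<close>]]
  obtain z where z: "motion (\<lambda>t. 0) T z" "z 0 = x" by blast
  have bond_cont: "continuous_on {0..T} (\<lambda>t. \<bar>bond k \<bullet> fst (z t)\<bar>)" for k
    by (intro continuous_intros continuous_bond[OF z(1) order.refl])
  have inside: "\<bar>bond k \<bullet> fst (z t)\<bar> < R" if "t \<in> {0..T}" "k \<in> {1..<n}" for k t
  proof (rule ccontr)
    \<comment> \<open>Times at which some bond has reached the level \<open>R\<close>; compactness
      provides a first one.\<close>
    define S where "S = (\<Union>k\<in>{1..<n}. {t \<in> {0..T}. R \<le> \<bar>bond k \<bullet> fst (z t)\<bar>})"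
    assume "\<not> \<bar>bond k \<bullet> fst (z t)\<bar> < R"
    then have "S \<noteq> {}" using that unfolding S_def by force
    moreover have "compact S"
      unfolding S_def
    proof (intro compact_UN finite_atLeastLessThan)
      fix k
      have "closed {t \<in> {0..T}. R \<le> \<bar>bond k \<bullet> fst (z t)\<bar>}"
        by (rule continuous_on_closed_Collect_le[OF continuous_on_const bond_cont closed_atLeastAtMost])
      moreover have "bounded {t \<in> {0..T}. R \<le> \<bar>bond k \<bullet> fst (z t)\<bar>}"
        by (rule bounded_subset[OF bounded_closed_interval[of 0 T]]) auto
      ultimately show "compact {t \<in> {0..T}. R \<le> \<bar>bond k \<bullet> fst (z t)\<bar>}"
        by (simp add: compact_eq_bounded_closed)
    qed
    ultimately obtain \<tau> where \<tau>: "\<tau> \<in> S" "\<And>t. t \<in> S \<Longrightarrow> \<tau> \<le> t"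
      using compact_attains_inf[of S] by blast
    then have \<tau>T: "\<tau> \<in> {0..T}" unfolding S_def by auto
    obtain j where j: "j \<in> {1..<n}" "R \<le> \<bar>bond j \<bullet> fst (z \<tau>)\<bar>"
      using \<tau>(1) unfolding S_def by auto
    have before: "force \<psi> (fst (z t)) = force \<phi> (fst (z t))" if "t \<in> {0..<\<tau>}" for t
    proof (rule force_cong, rule \<psi>)
      fix k assume "k \<in> {1..<n}"
      then show "\<bar>bond k \<bullet> fst (z t)\<bar> \<le> R"
        using \<tau>(2)[of t] that \<tau>T unfolding S_def by force
    qed
    have "energy (z t) = energy x" if t: "t \<in> {0..\<tau>}" for t
    proof (cases "t = 0")
      case False
      then have "0 < t" using t by simp
      have "energy (z t) = energy (z 0)"
      \<comment> \<open>The derivative is taken strictly before \<open>t\<close>, where the true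
        force acts; continuity carries the energy up to the exit time itself.\<close>
      proof (rule DERIV_isconst_end[OF \<open>0 < t\<close>])
        have \<Phi>_cont: "continuous_on UNIV \<Phi>"
          using potential by (meson DERIV_continuous_on has_field_derivative_at_within)
        have "continuous_on {0..t} z"
          by (rule continuous_on_subset[OF controlled_path_continuous[OF z(1)]]) (use t \<tau>T in auto)
        then show "continuous_on {0..t} (\<lambda>t. energy (z t))"
          unfolding energy_def by (intro continuous_intros continuous_on_compose2[OF \<Phi>_cont]) auto
        fix r assume r: "0 < r" "r < t"
        then have "at r within {0..T} = at r"
          using t \<tau>T by (intro at_within_interior) simp
        moreover have "r \<in> {0..T}" "r \<in> {0..<\<tau>}" using r t \<tau>T by auto
        ultimately have "(z has_vector_derivative (snd (z r), force \<phi> (fst (z r)))) (at r)"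
          using bspec[OF z(1)[unfolded controlled_path_def], of r] before[of r] by simp
        then show "((\<lambda>t. energy (z t)) has_real_derivative 0) (at r)"
          by (rule energy_derivative)
      qed
      then show ?thesis by (simp add: z)
    qed (simp add: z)
    then have speed: "norm (snd (z t)) \<le> c" if "t \<in> {0..\<tau>}" for t
      using norm_momentum_le[of "z t"] that by (simp add: c_def)
    have "((\<lambda>t. snd (z t)) has_integral (fst (z \<tau>) - fst (z 0))) {0..\<tau>}"
    proof (rule fundamental_theorem_of_calculus)
      fix t assume t: "t \<in> {0..\<tau>}"
      have "(z has_vector_derivative (snd (z t), force \<psi> (fst (z t)))) (at t within {0..T})"
        using z(1) t \<tau>T by (auto simp: controlled_path_def)
      from bounded_linear.has_vector_derivative[OF bounded_linear_fst this]
      have "((\<lambda>t. fst (z t)) has_vector_derivative snd (z t)) (at t within {0..T})"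
        by simp
      then show "((\<lambda>t. fst (z t)) has_vector_derivative snd (z t)) (at t within {0..\<tau>})"
        by (rule has_vector_derivative_within_subset) (use \<tau>T in auto)
    qed (use \<tau>T in simp)
    from has_integral_bound_real[OF \<open>0 \<le> c\<close> finite.emptyI this] speed
    have "norm (fst (z \<tau>) - fst x) \<le> c * \<tau>"
      using \<tau>T z(2) by simp
    also have "c * \<tau> \<le> c * T"
      using \<tau>T \<open>0 \<le> c\<close> by (intro mult_left_mono) auto
    finally have "norm (fst (z \<tau>)) \<le> norm (fst x) + c * T"
      using norm_triangle_ineq2[of "fst (z \<tau>)" "fst x"] by linarith
    then show False
      using abs_inner_bond_le[OF j(1), of "fst (z \<tau>)"] j(2) by (simp add: R_def)
  qed
  have "controlled_path (force \<phi>) (\<epsilon> 1) (\<lambda>t. 0) T z"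
    by (rule controlled_path_cong[OF z(1)], rule force_cong[symmetric], rule \<psi>) (use inside in \<open>simp add: less_imp_le\<close>)
  then show ?thesis using z(2) by (rule that)
qed

section \<open>Nonemptiness of the attainable set and density of its interior\<close>

abbreviation "drift_field \<equiv> \<lambda>x :: 'v \<times> 'v. (snd x, force \<phi> (fst x))"
abbreviation "control_field \<equiv> \<lambda>x :: 'v \<times> 'v. (0 :: 'v, \<epsilon> 1)"

text \<open>The density statement holds vacuously for an empty set, so accessibility also calls for
  one motion of arbitrary duration, supplied by the zero control.\<close>

lemma attainable_nonempty:
  assumes "0 < T"
  shows "attainable drift_field control_field T x \<noteq> {}"
proof -
  obtain z where "controlled_path (force \<phi>) (\<epsilon> 1) (\<lambda>t. 0) T z" "z 0 = x"
    by (rule free_path_exists[OF assms])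
  then show ?thesis
    using controlled_path_attainable[of "force \<phi>" "\<epsilon> 1" "\<lambda>t. 0 * t" T z 0 T] piecewise_affine_linear[of 0] assms
    by (auto simp: zero_prod_def[symmetric])
qed

text \<open>The last piece of a given trajectory is bounded, so it is also a motion of a suitable
  truncation, and the truncated motions close to it are motions of the true system.\<close>

lemma attainable_subset_closure_interior:
  assumes "0 < T"
  shows "attainable drift_field control_field T x \<subseteq> closure (interior (attainable drift_field control_field T x))"
proof
  fix y assume "y \<in> attainable drift_field control_field T x"
  then obtain s c x0 where s: "0 < s" and flow: "(x0, y) \<in> flow (ctrl_field drift_field control_field c) s"
    and sub: "attainable drift_field control_field s x0 \<subseteq> attainable drift_field control_field T x"
    by (rule attainable_last_piece[OF _ assms])
  obtain z where z: "controlled_path (force \<phi>) (\<epsilon> 1) (\<lambda>t. c * t) s z" "z 0 = x0" "z s + (0, (c * s) *\<^sub>R \<epsilon> 1) = y"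
    by (rule flow_controlled_path[OF flow])
  have "bounded (z ` {0..s})"
    by (intro compact_imp_bounded compact_continuous_image controlled_path_continuous[OF z(1)] compact_Icc)
  then obtain N where N: "\<And>t. t \<in> {0..s} \<Longrightarrow> norm (z t) \<le> N"
    unfolding bounded_iff by blast
  \<comment> \<open>Perturbed motions stay within distance 1 of \<open>z\<close>, hence in the ball
    of radius \<open>N + 1\<close>, where bond lengths are at most
    \<open>2 * (N + 1)\<close>.\<close>
  obtain \<psi> \<psi>' L M where "smooth_chain \<epsilon> n \<psi> \<psi>' L M" and \<psi>: "\<And>y. \<bar>y\<bar> \<le> 2 * (N + 1) \<Longrightarrow> \<psi> y = \<phi> y"
    by (rule truncation[of "2 * (N + 1)"]) blast
  then interpret smooth_chain \<epsilon> n \<psi> \<psi>' L M by simp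
  have same_force: "force \<psi> (fst u) = force \<phi> (fst u)" if "norm u \<le> N + 1" for u :: "'v \<times> 'v"
  proof (rule force_cong, rule \<psi>)
    show "\<bar>bond k \<bullet> fst u\<bar> \<le> 2 * (N + 1)" if "k \<in> {1..<n}" for k
      using abs_inner_bond_le[OF that, of "fst u"] order.trans[OF norm_fst_bound \<open>norm u \<le> N + 1\<close>] by simp
  qed
  have motion: "motion (\<lambda>t. c * t) s z"
    using N by (intro controlled_path_cong[OF z(1)] same_force) force
  show "y \<in> closure (interior (attainable drift_field control_field T x))"
    unfolding closure_approachable
  proof (intro allI impI)
    fix e :: real assume "0 < e"
    define \<delta> where "\<delta> = min 1 (e / 2)"
    have \<delta>: "0 < \<delta>" "\<delta> \<le> 1" "\<delta> < e" using \<open>0 < e\<close> by (auto simp: \<delta>_def)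
    define E where "E = {z' s + (0, w' s *\<^sub>R \<epsilon> 1) | w' z'. piecewise_affine w' \<and> w' 0 = c * 0 \<and>
      motion w' s z' \<and> z' 0 = z 0 \<and> (\<forall>t\<in>{0..s}. norm (z' t - z t) \<le> \<delta>)}"
    obtain y' where y': "norm (y' - y) \<le> \<delta>" "y' \<in> interior E"
      using perturbed_endpoints[OF piecewise_affine_linear motion s \<delta>(1)] unfolding z(3) E_def by blast
    have "E \<subseteq> attainable drift_field control_field s x0"
    proof
      fix u assume "u \<in> E"
      then obtain w' z' where w': "piecewise_affine w'" "w' 0 = 0" and z': "motion w' s z'" "z' 0 = z 0"
        and near: "\<And>t. t \<in> {0..s} \<Longrightarrow> norm (z' t - z t) \<le> \<delta>" and u: "u = z' s + (0, w' s *\<^sub>R \<epsilon> 1)"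
        unfolding E_def by auto
      have "norm (z' t) \<le> N + 1" if "t \<in> {0..s}" for t
        using norm_triangle_ineq2[of "z' t" "z t"] near[OF that] N[OF that] \<delta>(2) by linarith
      then have "controlled_path (force \<phi>) (\<epsilon> 1) w' s z'"
        using same_force[symmetric] by (intro controlled_path_cong[OF z'(1)]) blast
      from controlled_path_attainable[OF this w'(1) order.refl s order.refl]
      show "u \<in> attainable drift_field control_field s x0"
        using w'(2) z'(2) z(2) u by (simp add: zero_prod_def[symmetric])
    qed
    then have "y' \<in> interior (attainable drift_field control_field T x)"
      using interior_mono[OF order.trans[OF _ sub]] y'(2) by blast
    moreover have "dist y' y < e"
      using y'(1) \<delta>(3) by (simp add: dist_norm)
    ultimately show "\<exists>u\<in>interior (attainable drift_field control_field T x). dist u y < e" by blast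
  qed
qed

lemma attainable_accessible:
  assumes "0 < T"
  shows "accessible_from drift_field control_field T x"
  using attainable_nonempty[OF assms, of x] attainable_subset_closure_interior[OF assms, of x]
  unfolding accessible_from_def by (metis closure_empty subset_empty)

end

section \<open>Real analytic functions\<close>

text \<open>Termwise differentiation, with \<open>diffs a\<close> the differentiated coefficients.
  Derivative and expansion hold on the same interval, so the derivative is again analytic.\<close>

lemma real_analytic_has_derivative:
  assumes "real_analytic F"
  shows "(F has_real_derivative deriv F y) (at y)"
    and "real_analytic (deriv F)"
proof -
  have *: "\<exists>r>0. \<exists>a. \<forall>y. \<bar>y - y0\<bar> < r \<longrightarrow>
      (F has_real_derivative deriv F y) (at y) \<and> (\<lambda>k. a k * (y - y0) ^ k) sums deriv F y" for y0
  proof -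
    obtain r a where r: "0 < r" and a: "\<And>y. \<bar>y - y0\<bar> < r \<Longrightarrow> (\<lambda>k. a k * (y - y0) ^ k) sums F y"
      using assms unfolding real_analytic_def by blast
    have summable: "summable (\<lambda>k. a k * x ^ k)" if "norm x < r" for x
      using sums_summable[OF a[of "y0 + x"]] that by simp
    define G where "G x = (\<Sum>k. a k * x ^ k)" for x
    have F_eq: "F y = G (y - y0)" if "\<bar>y - y0\<bar> < r" for y
      using sums_unique[OF a[OF that]] by (simp add: G_def)
    have D: "(F has_real_derivative (\<Sum>k. diffs a k * (y - y0) ^ k)) (at y)" if y: "\<bar>y - y0\<bar> < r" for y
    proof -
      have "(G has_real_derivative (\<Sum>k. diffs a k * (y - y0) ^ k)) (at (y - y0))"
        unfolding G_def using y by (intro termdiffs_strong'[of r] summable) auto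
      then have "((\<lambda>y. G (y - y0)) has_real_derivative (\<Sum>k. diffs a k * (y - y0) ^ k)) (at y)"
        using DERIV_shift[of G _ y "- y0"] by simp
      moreover have "open (ball y0 r)" "y \<in> ball y0 r"
        using y by (auto simp: dist_real_def)
      ultimately show ?thesis
        by (rule has_field_derivative_transform_within_open) (auto simp: F_eq dist_real_def)
    qed
    have "(F has_real_derivative deriv F y) (at y) \<and> (\<lambda>k. diffs a k * (y - y0) ^ k) sums deriv F y"
      if y: "\<bar>y - y0\<bar> < r" for y
    proof -
      have "summable (\<lambda>k. diffs a k * (y - y0) ^ k)"
        using y by (intro termdiff_converges[of _ r] summable) auto
      then show ?thesis
        using D[OF y] DERIV_imp_deriv[OF D[OF y]] by (simp add: summable_sums)
    qed
    then show ?thesis using r by blast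
  qed
  show "(F has_real_derivative deriv F y) (at y)"
    using *[of y] by auto
  show "real_analytic (deriv F)"
    unfolding real_analytic_def using * by blast
qed

lemma real_analytic_punctured_nonzero:
  assumes "real_analytic F"
  shows "(\<exists>d>0. \<forall>y. \<bar>y - y0\<bar> < d \<longrightarrow> F y = 0) \<or> (\<exists>d>0. \<forall>y. 0 < \<bar>y - y0\<bar> \<and> \<bar>y - y0\<bar> < d \<longrightarrow> F y \<noteq> 0)"
proof -
  obtain r a where r: "0 < r" and a: "\<And>y. norm (y - y0) < r \<Longrightarrow> (\<lambda>k. a k * (y - y0) ^ k) sums F y"
    using assms unfolding real_analytic_def real_norm_def by blast
  have a0: "a 0 = F y0"
    using a[of y0] r by simp
  \<comment> \<open>\<open>powser_0_nonzero\<close> treats a zero at the centre with a nonvanishing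
    higher coefficient; a nonzero value at the centre is left to continuity.\<close>
  consider "\<forall>k. a k = 0" | "F y0 \<noteq> 0" | k where "F y0 = 0" "a k \<noteq> 0" "0 < k"
    using a0 by (metis gr0I)
  then show ?thesis
  proof cases
    case 1
    then have "F y = 0" if "\<bar>y - y0\<bar> < r" for y
      using a[of y] that sums_unique2[OF sums_zero] by fastforce
    then show ?thesis using r by blast
  next
    case 2
    have "isCont F y0"
      by (rule DERIV_isCont[OF real_analytic_has_derivative(1)[OF assms]])
    then obtain d where "0 < d" "\<And>y. \<bar>y - y0\<bar> < d \<Longrightarrow> \<bar>F y - F y0\<bar> < \<bar>F y0\<bar>"
      using 2 unfolding continuous_at_eps_delta dist_real_def by (metis zero_less_abs_iff)
    then have "\<exists>d>0. \<forall>y. 0 < \<bar>y - y0\<bar> \<and> \<bar>y - y0\<bar> < d \<longrightarrow> F y \<noteq> 0"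
      by (intro exI[of _ d]) force
    then show ?thesis ..
  next
    case 3
    have "\<exists>d>0. \<forall>y. 0 < \<bar>y - y0\<bar> \<and> \<bar>y - y0\<bar> < d \<longrightarrow> F y \<noteq> 0"
    proof (rule powser_0_nonzero[OF r a 3])
      fix s :: real assume "0 < s" "\<And>z. z \<in> cball y0 s - {y0} \<Longrightarrow> F z \<noteq> 0"
      then show ?thesis
        by (intro exI[of _ s]) (auto simp: dist_real_def)
    qed
    then show ?thesis ..
  qed
qed

text \<open>The set of points near which \<open>F\<close> vanishes identically is open, and closed
  by isolation of zeros; the line is connected.\<close>

lemma real_analytic_identity:
  assumes F: "real_analytic F" and "u < v" and zero: "\<And>y. u < y \<Longrightarrow> y < v \<Longrightarrow> F y = 0"
  shows "F y = 0"
proof -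
  define Z where "Z = {y. \<exists>d>0. \<forall>x. \<bar>x - y\<bar> < d \<longrightarrow> F x = 0}"
  have mid: "(u + v) / 2 \<in> Z"
    unfolding Z_def using \<open>u < v\<close> by (auto intro!: exI[of _ "(v - u) / 2"] zero simp: abs_if field_simps split: if_splits)
  have "open Z"
    unfolding open_dist
  proof
    fix y assume "y \<in> Z"
    then obtain d where d: "0 < d" "\<And>x. \<bar>x - y\<bar> < d \<Longrightarrow> F x = 0" unfolding Z_def by blast
    have "x \<in> Z" if "\<bar>x - y\<bar> < d / 2" for x
    proof -
      have "F x' = 0" if "\<bar>x' - x\<bar> < d / 2" for x'
        using that \<open>\<bar>x - y\<bar> < d / 2\<close> by (intro d(2)) linarith
      then show ?thesis unfolding Z_def using d(1) half_gt_zero by blast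
    qed
    then show "\<exists>e>0. \<forall>x. dist x y < e \<longrightarrow> x \<in> Z"
      using d(1) by (intro exI[of _ "d / 2"]) (simp add: dist_real_def)
  qed
  moreover have "open (- Z)"
    unfolding open_dist
  proof
    fix y assume "y \<in> - Z"
    then have "\<not> (\<exists>d>0. \<forall>x. \<bar>x - y\<bar> < d \<longrightarrow> F x = 0)" by (simp add: Z_def)
    then obtain d where d: "0 < d" "\<And>x. 0 < \<bar>x - y\<bar> \<Longrightarrow> \<bar>x - y\<bar> < d \<Longrightarrow> F x \<noteq> 0"
      using real_analytic_punctured_nonzero[OF F, of y] by blast
    have "x \<in> - Z" if "\<bar>x - y\<bar> < d" for x
    proof (cases "x = y")
      case False
      then have "F x \<noteq> 0" using d(2)[of x] that by simp
      then show ?thesis by (force simp: Z_def)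
    qed (use \<open>y \<in> - Z\<close> in simp)
    then show "\<exists>e>0. \<forall>x. dist x y < e \<longrightarrow> x \<in> - Z"
      using d(1) by (intro exI[of _ d]) (simp add: dist_real_def)
  qed
  ultimately have "Z = UNIV"
    using clopen[of Z] mid by (auto simp: closed_def)
  then have "y \<in> Z" by simp
  then show ?thesis by (force simp: Z_def)
qed

text \<open>Otherwise \<Phi> is affine by the identity theorem: a slope \<le> 0 contradicts growth
  at +infinity, a positive slope the lower bound.\<close>

lemma second_derivative_nonzero:
  assumes \<Phi>: "real_analytic \<Phi>" "bdd_below (range \<Phi>)" "filterlim \<Phi> at_top at_top" and "u < v"
  shows "\<exists>y. u < y \<and> y < v \<and> deriv (deriv \<Phi>) y \<noteq> 0"
proof (rule ccontr)
  assume "\<not> ?thesis"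
  then have zero: "deriv (deriv \<Phi>) y = 0" for y
    using real_analytic_identity[OF real_analytic_has_derivative(2)[OF real_analytic_has_derivative(2)[OF \<Phi>(1)]] \<open>u < v\<close>]
    by blast
  have "(deriv \<Phi> has_real_derivative 0) (at y)" for y
    using real_analytic_has_derivative(1)[OF real_analytic_has_derivative(2)[OF \<Phi>(1)], of y] by (simp add: zero)
  then obtain b where b: "deriv \<Phi> y = b" for y
    using has_field_derivative_zero_constant[of UNIV "deriv \<Phi>"] by auto
  have "((\<lambda>y. \<Phi> y - b * y) has_real_derivative 0) (at y)" for y
    using real_analytic_has_derivative(1)[OF \<Phi>(1), of y] by (auto intro!: derivative_eq_intros simp: b)
  then obtain c where c: "\<Phi> y - b * y = c" for y
    using has_field_derivative_zero_constant[of UNIV "\<lambda>y. \<Phi> y - b * y"] by auto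
  then have \<Phi>_eq: "\<Phi> y = b * y + c" for y
    using c[of y] by linarith
  obtain m where m: "m \<le> \<Phi> y" for y
    using \<Phi>(2) by (auto simp: bdd_below_def)
  show False
  proof (cases "b \<le> 0")
    case True
    have "eventually (\<lambda>y. c + 1 \<le> \<Phi> y) at_top"
      using \<Phi>(3) by (simp add: filterlim_at_top)
    then obtain N where N: "\<And>y. N \<le> y \<Longrightarrow> c + 1 \<le> \<Phi> y"
      by (auto simp: eventually_at_top_linorder)
    have "b * max N 0 \<le> 0"
      using True by (intro mult_nonpos_nonneg) auto
    then show False using N[of "max N 0"] by (simp add: \<Phi>_eq)
  next
    case False
    \<comment> \<open>At this point \<Phi> takes the value \<open>m - 1\<close>.\<close>
    then show False using m[of "(m - c - 1) / b"] by (simp add: \<Phi>_eq)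
  qed
qed

section \<open>The particle system\<close>

text \<open>Brings the drift, in which the end particles have terms of their own, into the uniform
  guarded form of \<open>inner_force\<close>.\<close>

lemma drift_components:
  fixes e :: "nat \<Rightarrow> 'n::finite"
  assumes n: "CARD('n) \<ge> 2" and e: "bij_betw e {1..CARD('n)} UNIV" and j: "j \<in> {1..CARD('n)}"
  shows "fst (drift e \<phi> x) $ e j = snd x $ e j"
    and "snd (drift e \<phi> x) $ e j =
      (if 1 < j then \<phi> (pos e x (j - 1) - pos e x j) else 0) - (if j < CARD('n) then \<phi> (pos e x j - pos e x (j + 1)) else 0)"
proof -
  have inj: "e k = e j \<longleftrightarrow> k = j" if "k \<in> {1..CARD('n)}" for k
    using inj_on_eq_iff[OF bij_betw_imp_inj_on[OF e] that j] .
  have axis: "axis (e k) (1::real) $ e j = (if k = j then 1 else 0)" if "k \<in> {1..CARD('n)}" for k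
    using inj[OF that] by (auto simp: axis_def)
  have sum_axis: "(\<Sum>k\<in>K. c k *\<^sub>R axis (e k) (1::real)) $ e j = (if j \<in> K then c j else 0)" if "K \<subseteq> {1..CARD('n)}" for K c
  proof -
    have "finite K" using that by (rule finite_subset) simp
    have "(\<Sum>k\<in>K. c k *\<^sub>R axis (e k) (1::real)) $ e j = (\<Sum>k\<in>K. if k = j then c k else 0)"
      unfolding sum_component using that by (intro sum.cong) (auto simp: axis subset_iff)
    then show ?thesis using \<open>finite K\<close> by simp
  qed
  show "fst (drift e \<phi> x) $ e j = snd x $ e j"
    using sum_axis[of "{1..CARD('n)}" "mom e x"] j
    by (simp add: drift_def Let_def d_pos_def d_mom_def fst_sum mom_def)
  show "snd (drift e \<phi> x) $ e j =
      (if 1 < j then \<phi> (pos e x (j - 1) - pos e x j) else 0) - (if j < CARD('n) then \<phi> (pos e x j - pos e x (j + 1)) else 0)"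
    using sum_axis[of "{2..CARD('n) - 1}" "\<lambda>k. \<phi> (pos e x (k - 1) - pos e x k) - \<phi> (pos e x k - pos e x (k + 1))"]
      axis[of 1] axis[of "CARD('n)"] j n
    by (auto simp: drift_def Let_def d_pos_def d_mom_def snd_sum numeral_2_eq_2)
qed

lemma chain_of_axes:
  fixes e :: "nat \<Rightarrow> 'n::finite"
  assumes "CARD('n) \<ge> 2" and e: "bij_betw e {1..CARD('n)} UNIV"
  shows "chain (\<lambda>k. axis (e k) 1 :: real ^ 'n) CARD('n)"
proof
  show "axis (e i) 1 \<bullet> (axis (e j) 1 :: real ^ 'n) = (if i = j then 1 else 0)"
    if "i \<in> {1..CARD('n)}" "j \<in> {1..CARD('n)}" for i j
    using inj_on_eq_iff[OF bij_betw_imp_inj_on[OF e] that] by (simp add: inner_axis_axis)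
  show "v = 0" if "\<And>k. k \<in> {1..CARD('n)} \<Longrightarrow> axis (e k) 1 \<bullet> v = 0" for v :: "real ^ 'n"
  proof -
    have "v $ i = 0" for i
    proof -
      obtain k where "k \<in> {1..CARD('n)}" "i = e k"
        using e unfolding bij_betw_def by blast
      with that[of k] show ?thesis by (simp add: inner_axis')
    qed
    then show ?thesis by (simp add: vec_eq_iff)
  qed
qed fact

lemma reversed_numbering:
  assumes "bij_betw e {1..n} S"
  shows "bij_betw (\<lambda>k. e (Suc n - k)) {1..n} S"
proof -
  have "bij_betw (\<lambda>k. Suc n - k) {1..n} {1..n}"
    by (rule bij_betw_byWitness[where f' = "\<lambda>k. Suc n - k"]) auto
  from bij_betw_trans[OF this assms] show ?thesis by (simp add: o_def)
qed


theorem theorem2p3: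
  fixes \<Phi> :: "real \<Rightarrow> real"
    and e :: "nat \<Rightarrow> 'n::finite"
    and f g :: "'n phase \<Rightarrow> 'n phase"
  assumes "CARD('n) \<ge> 2"
    and "bij_betw e {1..CARD('n)} UNIV"
    and "real_analytic \<Phi>"
    and "bdd_below (range \<Phi>)"
    and "filterlim \<Phi> at_top at_top"
    and "f = drift e (deriv \<Phi>)"
    and "g = (\<lambda>x. d_mom e 1) \<or> g = (\<lambda>x. d_mom e CARD('n))"
  shows "(\<forall>T>0. \<forall>x. accessible_from f g T x) \<and>
         (\<forall>x. \<forall>T>0. attainable f g T x \<subseteq> closure (interior (attainable f g T x)))"
proof -
  let ?n = "CARD('n)"
  note e = assms(2)
  define \<phi> where "\<phi> = deriv \<Phi>"
  note D1 = real_analytic_has_derivative[OF assms(3)]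
  note D2 = real_analytic_has_derivative[OF D1(2)]
  note D3 = real_analytic_has_derivative[OF D2(2)]
  have cont: "continuous_on UNIV (deriv (deriv (deriv \<Phi>)))"
    using real_analytic_has_derivative(1)[OF D3(2)] by (meson DERIV_continuous_on has_field_derivative_at_within)
  obtain m where m: "m \<le> \<Phi> y" for y
    using assms(4) by (auto simp: bdd_below_def)
  from assms(7) show ?thesis
  proof
    assume g: "g = (\<lambda>x. d_mom e 1)"
    define \<epsilon> :: "nat \<Rightarrow> real ^ 'n" where "\<epsilon> k = axis (e k) 1" for k
    have "chain \<epsilon> ?n"
      unfolding \<epsilon>_def by (rule chain_of_axes[OF assms(1,2)])
    then interpret chain \<epsilon> ?n .
    interpret potential_chain \<epsilon> ?n \<Phi> \<phi> "deriv \<phi>" "deriv (deriv \<phi>)" m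
      unfolding \<phi>_def using D1 D2 D3 cont m second_derivative_nonzero[OF assms(3-5)]
      by unfold_locales auto
    have "f x = drift_field x" for x
    proof (rule prod_eqI)
      have components: "fst (f x) $ e j = snd x $ e j \<and> snd (f x) $ e j = force \<phi> (fst x) $ e j" if "j \<in> {1..?n}" for j
        using drift_components[OF assms(1) e that, of \<phi> x] inner_force[OF that, of \<phi> "fst x"] that
        by (auto simp: assms(6) \<phi>_def[symmetric] \<epsilon>_def inner_axis' bond_def inner_diff_left pos_def)
      have *: "fst (f x) $ i = snd x $ i \<and> snd (f x) $ i = force \<phi> (fst x) $ i" for i
      proof -
        obtain j where "j \<in> {1..?n}" "i = e j"
          using e unfolding bij_betw_def by blast
        then show ?thesis using components by simp
      qed
      show "fst (f x) = fst (drift_field x)" "snd (f x) = snd (drift_field x)"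
        using * by (simp_all add: vec_eq_iff)
    qed
    moreover have "g = control_field"
      by (simp add: g d_mom_def \<epsilon>_def)
    ultimately show ?thesis
      using attainable_accessible attainable_subset_closure_interior by (simp add: ext[of f drift_field])
  next
    assume g: "g = (\<lambda>x. d_mom e ?n)"
    \<comment> \<open>Numbering from the far end makes the controlled particle the first
      one.\<close>
    define e' where "e' k = e (Suc ?n - k)" for k
    have e': "bij_betw e' {1..?n} UNIV"
      unfolding e'_def by (rule reversed_numbering[OF e])
    define \<epsilon> :: "nat \<Rightarrow> real ^ 'n" where "\<epsilon> k = axis (e' k) 1" for k
    have "chain \<epsilon> ?n"
      unfolding \<epsilon>_def by (rule chain_of_axes[OF assms(1) e'])
    then interpret chain \<epsilon> ?n .
    \<comment> \<open>Reversal changes the sign of every difference of neighbouring positions, so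
      the potential becomes \<open>\<Phi> (- y)\<close> and the force law its derivative
      \<open>- \<phi> (- y)\<close>.\<close>
    interpret potential_chain \<epsilon> ?n "\<lambda>y. \<Phi> (- y)" "\<lambda>y. - \<phi> (- y)" "\<lambda>y. deriv \<phi> (- y)" "\<lambda>y. - deriv (deriv \<phi>) (- y)" m
    proof
      show "((\<lambda>y. \<Phi> (- y)) has_real_derivative - \<phi> (- y)) (at y)" for y
        using D1(1)[of "- y"] unfolding \<phi>_def by (simp add: DERIV_mirror)
      show "((\<lambda>y. - \<phi> (- y)) has_real_derivative deriv \<phi> (- y)) (at y)" for y
        using DERIV_minus[of "\<lambda>y. \<phi> (- y)" "- deriv \<phi> (- y)"] D2(1)[of "- y"] unfolding \<phi>_def by (simp add: DERIV_mirror)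
      show "((\<lambda>y. deriv \<phi> (- y)) has_real_derivative - deriv (deriv \<phi>) (- y)) (at y)" for y
        using D3(1)[of "- y"] unfolding \<phi>_def by (simp add: DERIV_mirror)
      show "continuous_on UNIV (\<lambda>y. - deriv (deriv \<phi>) (- y))"
        unfolding \<phi>_def by (intro continuous_intros continuous_on_compose2[OF cont]) auto
      show "m \<le> \<Phi> (- y)" for y by (rule m)
      show "\<exists>y. u < y \<and> y < v \<and> deriv \<phi> (- y) \<noteq> 0" if uv: "u < v" for u v
      proof -
        obtain y where "- v < y" "y < - u" "deriv \<phi> y \<noteq> 0"
          using second_derivative_nonzero[OF assms(3-5), of "- v" "- u"] uv unfolding \<phi>_def by auto
        then show ?thesis by (intro exI[of _ "- y"]) auto
      qed
    qed
    have "f x = drift_field x" for x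
    proof (rule prod_eqI)
      have components: "fst (f x) $ e j = snd x $ e j \<and> snd (f x) $ e j = force (\<lambda>y. - \<phi> (- y)) (fst x) $ e j" if j: "j \<in> {1..?n}" for j
      proof -
        define k where "k = Suc ?n - j"
        \<comment> \<open>The predecessor of \<open>k\<close> in the new numbering is the successor
          of \<open>j\<close> in the old one and conversely, with the two ends exchanged.\<close>
        have k: "k \<in> {1..?n}" "e' k = e j" "1 < k \<longleftrightarrow> j < ?n" "k < ?n \<longleftrightarrow> 1 < j"
          "1 < k \<Longrightarrow> e' (k - 1) = e (j + 1)" "k < ?n \<Longrightarrow> e' (k + 1) = e (j - 1)"
          using j by (auto simp: k_def e'_def intro!: arg_cong[where f = e])
        show ?thesis
          using drift_components[OF assms(1) e j, of \<phi> x] inner_force[OF k(1), of "\<lambda>y. - \<phi> (- y)" "fst x"] k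
          by (auto simp: assms(6) \<phi>_def[symmetric] \<epsilon>_def inner_axis' bond_def inner_diff_left pos_def)
      qed
      have *: "fst (f x) $ i = snd x $ i \<and> snd (f x) $ i = force (\<lambda>y. - \<phi> (- y)) (fst x) $ i" for i
      proof -
        obtain j where "j \<in> {1..?n}" "i = e j"
          using e unfolding bij_betw_def by blast
        then show ?thesis using components by simp
      qed
      show "fst (f x) = fst (drift_field x)" "snd (f x) = snd (drift_field x)"
        using * by (simp_all add: vec_eq_iff)
    qed
    moreover have "g = control_field"
      by (simp add: g d_mom_def \<epsilon>_def e'_def)
    ultimately show ?thesis
      using attainable_accessible attainable_subset_closure_interior by (simp add: ext[of f drift_field])
  qed
qed

end
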